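(* The following sets are meager in $\operatorname{Sub}(\overline{\mathbb{Q}})/\!\cong$: (1) the set of isomorphism types of fields $L$ in which $\mathcal{O}_L$ is existentially or universally definable; (2) the set of isomorphism types of fields $L$ in which $\mathbb{Z}$ is existentially or universally definable; (3) the set of isomorphism types of fields $L$ in which some number field $F\subset L$ is existentially definable. Here $L$ ranges over $\operatorname{Sub}(\overline{\mathbb{Q}})$.
   Context: $\operatorname{Sub}(\overline{\mathbb{Q}})$ is the set of all subfields of a fixed algebraic closure $\overline{\mathbb{Q}}$ of $\mathbb{Q}$. It is regarded as a subset of the power set $2^{\overline{\mathbb{Q}}}$ (identifying subsets with characteristic functions) and carries the topology inherited from the product topology; a basis is given by the sets $U_{\vec a,\vec b}=\{L : a_1,\dots,a_n\in L,\ b_1,\dots,b_k\notin L\}$ for finite tuples $\vec a,\vec b$ from $\overline{\mathbb{Q}}$. $\operatorname{Sub}(\overline{\mathbb{Q}})/\!\cong$ is the set of field-isomorphism classes $[L]_{\cong}$ of members of $\operatorname{Sub}(\overline{\mathbb{Q}})$ (equivalently, the orbits under $\operatorname{Gal}(\overline{\mathbb{Q}}/\mathbb{Q})$), with the quotient topology. A set is meager if it is a countable union of nowhere dense sets. $\mathcal{O}_L$ is the set of elements of $L$ integral over $\mathbb{Z}$; a number field is a finite extension of $\mathbb{Q}$. Definability: a subset $C\subseteq L$ is universally (resp. existentially) definable in the field $L$ if it is the set of $x\in L$ satisfying in $L$ a formula $\forall \vec Y\,\phi(X,\vec Y)$ (resp. $\exists\vec Y\,\phi(X,\vec Y)$),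 where $\phi$ is a quantifier-free formula in the language of rings with parameters from $L$. *)

theory Defs
  imports "HOL-Analysis.Analysis" "HOL-Algebra.Algebraic_Closure_Type"
begin

section \<open>Quotient topologies and meager sets\<close>

definition quotient_topology :: "'a topology \<Rightarrow> ('a \<Rightarrow> 'b) \<Rightarrow> 'b topology"
  where "quotient_topology T f =
    topology (\<lambda>U. U \<subseteq> f ` topspace T \<and> openin T {x \<in> topspace T. f x \<in> U})"

lemma openin_quotient_topology:
  "openin (quotient_topology T f) U \<longleftrightarrow>
     U \<subseteq> f ` topspace T \<and> openin T {x \<in> topspace T. f x \<in> U}"
proof -
  have "istopology (\<lambda>U. U \<subseteq> f ` topspace T \<and> openin T {x \<in> topspace T. f x \<in> U})"
    unfolding istopology_def
  proof (intro conjI allI impI)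
    fix U V
    assume U: "U \<subseteq> f ` topspace T \<and> openin T {x \<in> topspace T. f x \<in> U}"
      and V: "V \<subseteq> f ` topspace T \<and> openin T {x \<in> topspace T. f x \<in> V}"
    show "U \<inter> V \<subseteq> f ` topspace T" using U by blast
    have "{x \<in> topspace T. f x \<in> U \<inter> V} =
        {x \<in> topspace T. f x \<in> U} \<inter> {x \<in> topspace T. f x \<in> V}" by blast
    then show "openin T {x \<in> topspace T. f x \<in> U \<inter> V}" using U V by auto
  next
    fix \<U>
    assume \<U>: "\<forall>U\<in>\<U>. U \<subseteq> f ` topspace T \<and> openin T {x \<in> topspace T. f x \<in> U}"
    show "\<Union>\<U> \<subseteq> f ` topspace T" using \<U> by blast
    have "{x \<in> topspace T. f x \<in> \<Union>\<U>} = (\<Union>U\<in>\<U>. {x \<in> topspace T. f x \<in> U})" by blast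
    then show "openin T {x \<in> topspace T. f x \<in> \<Union>\<U>}" using \<U> by auto
  qed
  then show ?thesis
    by (simp add: quotient_topology_def topology_inverse')
qed

lemma topspace_quotient_topology [simp]:
  "topspace (quotient_topology T f) = f ` topspace T"
proof
  show "topspace (quotient_topology T f) \<subseteq> f ` topspace T"
    using openin_quotient_topology[of T f] openin_topspace by blast
  have "{x \<in> topspace T. f x \<in> f ` topspace T} = topspace T" by blast
  then have "openin (quotient_topology T f) (f ` topspace T)"
    by (simp add: openin_quotient_topology)
  then show "f ` topspace T \<subseteq> topspace (quotient_topology T f)"
    by (rule openin_subset)
qed

lemma quotient_map_quotient_topology: "quotient_map T (quotient_topology T f) f"
  by (auto simp: quotient_map_def openin_quotient_topology)

definition nowhere_dense_in :: "'a topology \<Rightarrow> 'a set \<Rightarrow> bool"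
  where "nowhere_dense_in T S \<longleftrightarrow>
    S \<subseteq> topspace T \<and> T interior_of (T closure_of S) = {}"

definition meager_in :: "'a topology \<Rightarrow> 'a set \<Rightarrow> bool"
  where "meager_in T S \<longleftrightarrow>
    (\<exists>\<N>. countable \<N> \<and> (\<forall>N\<in>\<N>. nowhere_dense_in T N) \<and> S = \<Union>\<N>)"


section \<open>Definability in rings\<close>

text \<open>
  Terms and quantifier-free formulas in the language of rings, with variables of type
  \<open>'v\<close> and with parameters of type \<open>'a\<close>.
\<close>

datatype (term_params: 'a, term_vars: 'v) ring_term =
    TVar 'v
  | TParam 'a
  | TZero
  | TOne
  | TAdd "('a, 'v) ring_term" "('a, 'v) ring_term"
  | TNeg "('a, 'v) ring_term"
  | TMult "('a, 'v) ring_term" "('a, 'v) ring_term"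

datatype (qf_params: 'a, qf_vars: 'v) qf_formula =
    FEq "('a, 'v) ring_term" "('a, 'v) ring_term"
  | FNot "('a, 'v) qf_formula"
  | FAnd "('a, 'v) qf_formula" "('a, 'v) qf_formula"
  | FOr "('a, 'v) qf_formula" "('a, 'v) qf_formula"

primrec term_val :: "('a, 'm) ring_scheme \<Rightarrow> ('v \<Rightarrow> 'a) \<Rightarrow> ('a, 'v) ring_term \<Rightarrow> 'a" where
  "term_val R v (TVar i) = v i"
| "term_val R v (TParam a) = a"
| "term_val R v TZero = \<zero>\<^bsub>R\<^esub>"
| "term_val R v TOne = \<one>\<^bsub>R\<^esub>"
| "term_val R v (TAdd s t) = term_val R v s \<oplus>\<^bsub>R\<^esub> term_val R v t"
| "term_val R v (TNeg t) = \<ominus>\<^bsub>R\<^esub> term_val R v t"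
| "term_val R v (TMult s t) = term_val R v s \<otimes>\<^bsub>R\<^esub> term_val R v t"

primrec qf_sat :: "('a, 'm) ring_scheme \<Rightarrow> ('v \<Rightarrow> 'a) \<Rightarrow> ('a, 'v) qf_formula \<Rightarrow> bool" where
  "qf_sat R v (FEq s t) \<longleftrightarrow> term_val R v s = term_val R v t"
| "qf_sat R v (FNot \<phi>) \<longleftrightarrow> \<not> qf_sat R v \<phi>"
| "qf_sat R v (FAnd \<phi> \<psi>) \<longleftrightarrow> qf_sat R v \<phi> \<and> qf_sat R v \<psi>"
| "qf_sat R v (FOr \<phi> \<psi>) \<longleftrightarrow> qf_sat R v \<phi> \<or> qf_sat R v \<psi>"

text \<open>
  Variable \<open>0\<close> is the free variable \<open>X\<close>, and variables \<open>1, \<dots>, n\<close> are the quantified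
  variables \<open>Y\<^sub>1, \<dots>, Y\<^sub>n\<close>.
\<close>

definition existentially_definable :: "('a, 'm) ring_scheme \<Rightarrow> 'a set \<Rightarrow> bool"
  where "existentially_definable R C \<longleftrightarrow>
    (\<exists>n (\<phi> :: ('a, nat) qf_formula).
       qf_params \<phi> \<subseteq> carrier R \<and> qf_vars \<phi> \<subseteq> {..n} \<and>
       C = {x \<in> carrier R. \<exists>ys. length ys = n \<and> set ys \<subseteq> carrier R \<and>
              qf_sat R (\<lambda>i. (x # ys) ! i) \<phi>})"

definition universally_definable :: "('a, 'm) ring_scheme \<Rightarrow> 'a set \<Rightarrow> bool"
  where "universally_definable R C \<longleftrightarrow>
    (\<exists>n (\<phi> :: ('a, nat) qf_formula).
       qf_params \<phi> \<subseteq> carrier R \<and> qf_vars \<phi> \<subseteq> {..n} \<and>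
       C = {x \<in> carrier R. \<forall>ys. length ys = n \<and> set ys \<subseteq> carrier R \<longrightarrow>
              qf_sat R (\<lambda>i. (x # ys) ! i) \<phi>})"


section \<open>The space of algebraic extensions of the rationals\<close>

type_synonym qbar = "rat alg_closure"

abbreviation Qbar :: "qbar ring"
  where "Qbar \<equiv> ring_of_type_algebra"

definition Sub_Qbar :: "qbar set set"
  where "Sub_Qbar = {L. subfield L Qbar}"

abbreviation field_on :: "qbar set \<Rightarrow> qbar ring"
  where "field_on L \<equiv> Qbar\<lparr>carrier := L\<rparr>"

definition Sub_Qbar_topology :: "qbar set topology"
  where "Sub_Qbar_topology =
    pullback_topology Sub_Qbar (\<lambda>L x. x \<in> L)
      (product_topology (\<lambda>_. discrete_topology (UNIV :: bool set)) UNIV)"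

definition iso_class :: "qbar set \<Rightarrow> qbar set set"
  where "iso_class L = {L' \<in> Sub_Qbar. field_on L \<simeq> field_on L'}"

definition Sub_Qbar_iso_topology :: "qbar set set topology"
  where "Sub_Qbar_iso_topology = quotient_topology Sub_Qbar_topology iso_class"

lemma topspace_Sub_Qbar_topology [simp]: "topspace Sub_Qbar_topology = Sub_Qbar"
  by (simp add: Sub_Qbar_topology_def topspace_pullback_topology)

lemma topspace_Sub_Qbar_iso_topology [simp]:
  "topspace Sub_Qbar_iso_topology = iso_class ` Sub_Qbar"
  by (simp add: Sub_Qbar_iso_topology_def)

definition ring_of_integers :: "qbar set \<Rightarrow> qbar set"
  where "ring_of_integers L = {x \<in> L. algebraic_int x}"

definition number_field :: "qbar set \<Rightarrow> bool"
  where "number_field F \<longleftrightarrow> subfield F Qbar \<and> ring.finite_dimension Qbar \<rat> F"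

end

theory Submission
  imports Defs
begin

text \<open>
  Let \<open>C\<close> be one of the sets in question, or its complement, defined by an existential formula \<open>\<phi>\<close> in \<open>L\<close>.
  Then \<open>\<phi>(X)\<close> has infinitely many solutions in \<open>L\<close>, but none in \<open>s + \<int>\<close> for some \<open>s \<in> L\<close>: take \<open>s = 1/2\<close> or \<open>s = 0\<close>
  for the integers and \<open>s \<in> L - F\<close> for a number field \<open>F \<noteq> L\<close>. There are only countably many pairs \<open>(\<phi>, s)\<close>, so it is
  enough that the fields with such a gap are nowhere dense for fixed \<open>(\<phi>, s)\<close>, i.e. that every basic open set
  \<open>{L. A \<subseteq> L \<and> B \<inter> L = {}}\<close> that contains one of them also contains a number field in which \<open>\<phi>\<close> holds at some point of
  \<open>s + \<int>\<close>, since an existential formula remains true in all larger fields.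

  To find this number field, choose a solution in the ultrapower of \<open>L\<close> with nonstandard \<open>X\<close>, hence transcendental
  over the algebraic numbers. By Hilbert's irreducibility theorem and saturation the ultrapower \<open>\<rat>\<^sup>*\<close> contains
  elements \<open>t\<^sub>1, t\<^sub>2, \<dots>\<close> of \<open>\<int>\<^sup>*\<close>, algebraically independent, such that every \<open>\<rat>(t\<^sub>1, \<dots>, t\<^sub>k)\<close> is relatively algebraically closed in \<open>\<rat>\<^sup>*\<close>.
  Moving a transcendence basis of the solution to \<open>s + t\<^sub>1, t\<^sub>2, \<dots>\<close> yields a solution in a finite
  extension of \<open>\<rat>\<^sup>*\<close>. This extension does not contain any \<open>b \<in> B\<close>, because finite extensions of \<open>\<rat>(t\<^sub>1, \<dots>, t\<^sub>k)\<close> are linearly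
  disjoint from \<open>\<rat>\<^sup>*\<close>. Almost all of its components are number fields of the required kind.

  Isomorphism classes are orbits under the automorphism group. An automorphism replaces \<open>(\<phi>, s)\<close> by one of finitely many conjugates,
  so that the saturation of a set of fields with a gap is still nowhere dense. Finally, a number field \<open>F = L\<close> itself is
  not isolated, since \<open>F(\<surd>n)\<close> avoids a given finite set for suitable \<open>n\<close>.\<close>

section \<open>Hilbert's irreducibility theorem over the integers\<close>

text \<open>The value of \<open>X\<close> has to fall into s + Z, so Hilbert's theorem is needed at
  integers. It is stated for roots rather than for irreducibility: at a suitable t, each rational
  root of finitely many separable polynomials G(t, Z) comes from a rational function that solves G
  identically. Such branches have bounded degree. Hence they glue in the ultrapower, and relative
  closedness of the smaller field forces the coefficients of the result into that field. The
  obstacle is the set B. Existential truth passes to larger fields, but an element of B may enter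
  the specialised field by accident. It is absent from the ultrapower of L because it is not in L; a
  map that is injective and fixes constants keeps it out of the image; linear disjointness keeps it
  out when the coefficients grow to all of the internal rationals. This last step is what relative
  closedness is for. The ultrafilter lives on the natural numbers, so only countably many conditions
  can be met at once, and the fields M have to stay countable.\<close>

hide_const (open) Divisibility.prime Module.smult Module.module.smult Polynomials.degree
  Polynomials.lead_coeff UnivPoly.up_ring.coeff UnivPoly.up_ring.monom

section \<open>Polynomials in two variables and Hensel lifting\<close>

abbreviation poly2 :: "'a::idom poly poly \<Rightarrow> 'a \<Rightarrow> 'a \<Rightarrow> 'a"
  where "poly2 G t z \<equiv> poly (poly G [:z:]) t"

lemma poly_poly_eq_poly2: "poly (poly G P) t = poly2 G t (poly P t)"
  by (induction G) auto

text \<open>The remainder is a multiple of \<open>h\<^sup>2\<close> in the ring itself, without a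
  factor 1/2, so the expansion can be read modulo prime powers.\<close>

lemma poly_taylor2:
  fixes p :: "'a::idom poly"
  shows "\<exists>c. poly p (y + h) = poly p y + h * poly (pderiv p) y + h\<^sup>2 * c"
proof (induction p)
  case 0
  show ?case by (intro exI[of _ 0]) simp
next
  case (pCons a p)
  then obtain c where c: "poly p (y + h) = poly p y + h * poly (pderiv p) y + h\<^sup>2 * c" by blast
  show ?case
    unfolding poly_pCons pderiv_pCons poly_add c
    by (rule exI[of _ "poly (pderiv p) y + y * c + h * c"])
       (simp add: algebra_simps power2_eq_square)
qed

lemma poly2_taylor2:
  "\<exists>c. poly2 G t (y + h) = poly2 G t y + h * poly2 (pderiv G) t y + h\<^sup>2 * c"
proof -
  obtain c where "poly G ([:y:] + [:h:]) = poly G [:y:] + [:h:] * poly (pderiv G) [:y:] + [:h:]\<^sup>2 * c"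
    using poly_taylor2 by blast
  then have "poly2 G t (y + h) = poly2 G t y + h * poly2 (pderiv G) t y + h\<^sup>2 * poly c t"
    by simp
  then show ?thesis by blast
qed

lemma dvd_poly_diff:
  fixes p :: "'a::idom poly"
  assumes "m dvd x - y"
  shows "m dvd poly p x - poly p y"
proof (induction p)
  case (pCons a p)
  have "poly (pCons a p) x - poly (pCons a p) y = (x - y) * poly p x + y * (poly p x - poly p y)"
    by (simp add: algebra_simps)
  then show ?case using pCons assms by (metis dvd_add dvd_mult dvd_mult2)
qed simp

lemma dvd_poly2_diff:
  fixes G :: "'a::idom poly poly"
  assumes "m dvd x - x'" "m dvd y - y'"
  shows "m dvd poly2 G x y - poly2 G x' y'"
proof -
  have "m dvd poly2 G x y - poly2 G x' y" using assms(1) by (rule dvd_poly_diff)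
  moreover have "m dvd poly2 G x' y - poly2 G x' y'"
  proof -
    have "[:m:] dvd [:y:] - [:y':]" using assms(2) by (simp add: const_poly_dvd_const_poly_iff)
    then have "[:m:] dvd poly G [:y:] - poly G [:y':]" by (rule dvd_poly_diff)
    then obtain k where "poly G [:y:] - poly G [:y':] = [:m:] * k" by (rule dvdE)
    then have "poly (poly G [:y:] - poly G [:y':]) x' = m * poly k x'" by simp
    then have "poly2 G x' y - poly2 G x' y' = m * poly k x'" by simp
    then show ?thesis by simp
  qed
  ultimately show ?thesis using dvd_add by fastforce
qed

text \<open>Newton's iteration is run on polynomials instead of numbers. Thus one integral
  polynomial \<open>f\<close> approximates the root near \<zeta> at all multiples of
  \<open>p\<close> simultaneously; it plays the role of the power series branch.\<close>

lemma hensel_poly: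
  fixes G :: "int poly poly" and p u \<zeta> :: int
  assumes "p dvd poly2 G 0 \<zeta>" "p dvd 1 - u * poly2 (pderiv G) 0 \<zeta>"
  shows "\<exists>f. \<forall>x. p dvd x \<longrightarrow> p ^ Suc k dvd poly2 G x (poly f x) \<and> p dvd poly f x - \<zeta>"
proof (induction k)
  case 0
  have "p dvd poly2 G x \<zeta>" if "p dvd x" for x
    using dvd_add[OF dvd_poly2_diff[of p x 0 \<zeta> \<zeta> G] assms(1)] that by simp
  then show ?case by (intro exI[of _ "[:\<zeta>:]"]) simp
next
  case (Suc k)
  then obtain f where f: "\<And>x. p dvd x \<Longrightarrow> p ^ Suc k dvd poly2 G x (poly f x) \<and> p dvd poly f x - \<zeta>"
    by blast
  \<comment> \<open>The inverse \<open>u\<close> of the derivative is only correct modulo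
    \<open>p\<close> and is never updated; each step therefore gains just one factor
    \<open>p\<close>.\<close>
  define g where "g = f - smult u (poly G f)"
  show ?case
  proof (intro exI[of _ g] allI impI)
    fix x assume x: "p dvd x"
    define y where "y = poly f x"
    define e where "e = poly2 G x y"
    have e: "p ^ Suc k dvd e" "p dvd y - \<zeta>" using f[OF x] by (auto simp: e_def y_def)
    have gx: "poly g x = y + (- u * e)" unfolding g_def y_def e_def by (simp add: poly_poly_eq_poly2[of G f x])
    obtain c where "poly2 G x (y + (- u * e)) = e + (- u * e) * poly2 (pderiv G) x y + (- u * e)\<^sup>2 * c"
      using poly2_taylor2 e_def by metis
    then have c: "poly2 G x (poly g x) = e * (1 - u * poly2 (pderiv G) x y) + e * e * (u\<^sup>2 * c)"
      unfolding gx by (simp add: algebra_simps power2_eq_square)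
    have "p dvd poly2 (pderiv G) x y - poly2 (pderiv G) 0 \<zeta>"
      using dvd_poly2_diff[of p x 0 y \<zeta> "pderiv G"] x e(2) by simp
    then have "p dvd u * (poly2 (pderiv G) x y - poly2 (pderiv G) 0 \<zeta>)" by simp
    with assms(2) have "p dvd (1 - u * poly2 (pderiv G) 0 \<zeta>) - u * (poly2 (pderiv G) x y - poly2 (pderiv G) 0 \<zeta>)"
      by (rule dvd_diff)
    then have "p dvd 1 - u * poly2 (pderiv G) x y" by (simp add: algebra_simps)
    then have 1: "p ^ Suc (Suc k) dvd e * (1 - u * poly2 (pderiv G) x y)"
      unfolding power_Suc2[of _ "Suc k"] by (rule mult_dvd_mono[OF e(1)])
    have pe: "p dvd e" using e(1) dvd_mult_left power_Suc by metis
    then have "p ^ Suc (Suc k) dvd e * e"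
      unfolding power_Suc2[of _ "Suc k"] by (rule mult_dvd_mono[OF e(1)])
    then have "p ^ Suc (Suc k) dvd e * e * (u\<^sup>2 * c)" by (rule dvd_mult2)
    with 1 have "p ^ Suc (Suc k) dvd poly2 G x (poly g x)" unfolding c by (rule dvd_add)
    moreover have "p dvd poly g x - \<zeta>"
      using pe e(2) unfolding gx
      using dvd_add[of p "y - \<zeta>" "- (u * e)"] by (simp add: algebra_simps)
    ultimately show "p ^ Suc (Suc k) dvd poly2 G x (poly g x) \<and> p dvd poly g x - \<zeta>" by blast
  qed
qed

text \<open>With h = z - w, Taylor expansion shows that \<open>p ^ M\<close> divides h times a
  second factor. That factor is the derivative plus a multiple of h, hence prime to
  \<open>p\<close>.\<close>

lemma hensel_unique:
  fixes G :: "int poly poly" and p z w x :: int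
  assumes "prime p" "p dvd z - w" "\<not> p dvd poly2 (pderiv G) x w"
    and "p ^ M dvd poly2 G x z" "p ^ M dvd poly2 G x w"
  shows "p ^ M dvd z - w"
proof -
  define h where "h = z - w"
  obtain c where c: "poly2 G x (w + h) = poly2 G x w + h * poly2 (pderiv G) x w + h\<^sup>2 * c"
    using poly2_taylor2 by blast
  then have "poly2 G x z - poly2 G x w = h * (poly2 (pderiv G) x w + h * c)"
    by (simp add: h_def algebra_simps power2_eq_square)
  then have d: "p ^ M dvd h * (poly2 (pderiv G) x w + h * c)"
    using dvd_diff[OF assms(4,5)] by simp
  have "\<not> p dvd poly2 (pderiv G) x w + h * c"
    using assms(2,3) by (simp add: h_def dvd_add_left_iff)
  then have "coprime (p ^ M) (poly2 (pderiv G) x w + h * c)"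
    using assms(1) by (simp add: prime_imp_coprime)
  with d show ?thesis by (simp add: coprime_dvd_mult_left_iff h_def)
qed

text \<open>Integral form of Lagrange interpolation, multiplied by
  \<open>lagrange_scale J\<close> to clear the denominators.\<close>

definition lagrange_scale :: "int set \<Rightarrow> int"
  where "lagrange_scale J = (\<Prod>k\<in>J. \<Prod>l\<in>J - {k}. k - l)"

definition lagrange_basis :: "int set \<Rightarrow> int \<Rightarrow> int poly"
  where "lagrange_basis J k =
    smult (\<Prod>k'\<in>J - {k}. \<Prod>l\<in>J - {k'}. k' - l) (\<Prod>l\<in>J - {k}. [:-l, 1:])"

lemma lagrange_scale_nonzero: "finite J \<Longrightarrow> lagrange_scale J \<noteq> 0"
  by (auto simp: lagrange_scale_def)

lemma poly_lagrange_basis: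
  assumes "finite J" "k \<in> J" "j \<in> J"
  shows "poly (lagrange_basis J k) j = (if j = k then lagrange_scale J else 0)"
proof (cases "j = k")
  case True
  then show ?thesis using assms
    by (simp add: lagrange_basis_def lagrange_scale_def poly_prod prod.remove[of J k] mult.commute)
next
  case False
  have "(\<Prod>l\<in>J - {k}. j - l) = 0" using assms False by (intro prod_zero) auto
  then show ?thesis using False by (simp add: lagrange_basis_def poly_prod)
qed

lemma degree_lagrange_basis:
  assumes "finite J" "k \<in> J"
  shows "degree (lagrange_basis J k) < card J"
proof -
  have "degree (\<Prod>l\<in>J - {k}. [:-l, 1:]) \<le> (\<Sum>l\<in>J - {k}. degree [:-l, 1:])"
    using degree_prod_sum_le[of "J - {k}" "\<lambda>l. [:-l, 1:]"] assms(1) by (simp add: comp_def)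
  also have "\<dots> = card J - 1" using assms by simp
  also have "\<dots> < card J" using assms by (metis card_gt_0_iff diff_less empty_iff zero_less_one)
  finally show ?thesis unfolding lagrange_basis_def
    by (meson degree_smult_le le_less_trans)
qed

lemma poly_eqI_degree_zero:
  fixes h :: "'a::idom poly"
  assumes "degree h < card J" "\<And>j. j \<in> J \<Longrightarrow> poly h j = 0"
  shows "h = 0"
proof (rule ccontr)
  assume "h \<noteq> 0"
  then have "card J \<le> card {x. poly h x = 0}"
    using assms(2) by (intro card_mono poly_roots_finite) auto
  also have "\<dots> \<le> degree h" using \<open>h \<noteq> 0\<close> by (rule card_poly_roots_bound)
  finally show False using assms(1) by simp
qed

lemma degree_lagrange_sum:
  assumes "finite J" "J \<noteq> {}"
  shows "degree (\<Sum>k\<in>J. smult (z k) (lagrange_basis J k)) < card J"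
proof (rule degree_sum_less)
  show "0 < card J" using assms by (simp add: card_gt_0_iff)
  show "degree (smult (z k) (lagrange_basis J k)) < card J" if "k \<in> J" for k
    using degree_lagrange_basis[OF assms(1) that] degree_smult_le le_less_trans by blast
qed

lemma lagrange_interpolation:
  assumes "finite J" "J \<noteq> {}" "degree g < card J"
  shows "lagrange_scale J * poly g j = (\<Sum>k\<in>J. poly (lagrange_basis J k) j * poly g k)"
proof -
  define h where "h = smult (lagrange_scale J) g - (\<Sum>k\<in>J. smult (poly g k) (lagrange_basis J k))"
  have "degree h < card J" unfolding h_def
    by (intro degree_diff_less degree_lagrange_sum assms le_less_trans[OF degree_smult_le])
  moreover have "poly h j = 0" if "j \<in> J" for j
  proof -
    have "(\<Sum>k\<in>J. poly g k * poly (lagrange_basis J k) j) =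
        (\<Sum>k\<in>J. if k = j then poly g j * lagrange_scale J else 0)"
      by (rule sum.cong) (auto simp: poly_lagrange_basis assms that)
    then show ?thesis using assms that by (simp add: h_def poly_sum)
  qed
  ultimately have "h = 0"
    by (rule poly_eqI_degree_zero)
  then have "poly h j = 0" by simp
  then show ?thesis by (simp add: h_def poly_sum mult.commute)
qed

section \<open>Cauchy's root bound and the growth of integral roots\<close>

lemma monic_root_bound:
  fixes q :: "int poly"
  assumes "lead_coeff q = 1" "poly q z = 0"
  shows "\<bar>z\<bar> \<le> 1 + (\<Sum>l<degree q. \<bar>coeff q l\<bar>)"
proof (rule ccontr)
  define d where "d = degree q"
  define S where "S = (\<Sum>l<d. \<bar>coeff q l\<bar>)"
  assume "\<not> \<bar>z\<bar> \<le> 1 + (\<Sum>l<degree q. \<bar>coeff q l\<bar>)"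
  then have z: "\<bar>z\<bar> > 1 + S" by (simp add: S_def d_def)
  have S0: "S \<ge> 0" unfolding S_def by (intro sum_nonneg) simp
  have "d \<noteq> 0"
  proof
    assume "d = 0"
    then have "q = [:1:]" using assms(1) d_def by (metis degree_eq_zeroE lead_coeff_pCons(2))
    then show False using assms(2) by simp
  qed
  then obtain k where k: "d = Suc k" by (cases d) auto
  have "0 = (\<Sum>i\<le>d. coeff q i * z ^ i)" using assms(2) by (simp add: poly_altdef d_def)
  also have "\<dots> = (\<Sum>i<d. coeff q i * z ^ i) + z ^ d"
    using assms(1) by (simp add: d_def lessThan_Suc_atMost[symmetric])
  finally have "z ^ d = - (\<Sum>i<d. coeff q i * z ^ i)" by linarith
  then have "\<bar>z\<bar> ^ d = \<bar>\<Sum>i<d. coeff q i * z ^ i\<bar>" by (metis power_abs abs_minus_cancel)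
  also have "\<dots> \<le> (\<Sum>i<d. \<bar>coeff q i * z ^ i\<bar>)" by (rule sum_abs)
  also have "\<dots> \<le> (\<Sum>i<d. \<bar>coeff q i\<bar> * \<bar>z\<bar> ^ k)"
  proof (rule sum_mono)
    fix i assume "i \<in> {..<d}"
    then have "\<bar>z\<bar> ^ i \<le> \<bar>z\<bar> ^ k" using z S0 k by (intro power_increasing) auto
    then show "\<bar>coeff q i * z ^ i\<bar> \<le> \<bar>coeff q i\<bar> * \<bar>z\<bar> ^ k"
      by (simp add: abs_mult power_abs mult_left_mono)
  qed
  also have "\<dots> = S * \<bar>z\<bar> ^ k" by (simp add: S_def sum_distrib_right)
  also have "\<dots> < \<bar>z\<bar> * \<bar>z\<bar> ^ k" using z S0 by (intro mult_strict_right_mono) auto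
  finally show False by (simp add: k)
qed

lemma abs_poly_le:
  fixes g :: "int poly"
  assumes "degree g \<le> e" "1 \<le> \<bar>t\<bar>"
  shows "\<bar>poly g t\<bar> \<le> (\<Sum>i\<le>degree g. \<bar>coeff g i\<bar>) * \<bar>t\<bar> ^ e"
proof -
  have "\<bar>poly g t\<bar> \<le> (\<Sum>i\<le>degree g. \<bar>coeff g i * t ^ i\<bar>)"
    unfolding poly_altdef by (rule sum_abs)
  also have "\<dots> \<le> (\<Sum>i\<le>degree g. \<bar>coeff g i\<bar> * \<bar>t\<bar> ^ e)"
  proof (rule sum_mono)
    fix i assume "i \<in> {..degree g}"
    then have "\<bar>t\<bar> ^ i \<le> \<bar>t\<bar> ^ e" using assms by (intro power_increasing) auto
    then show "\<bar>coeff g i * t ^ i\<bar> \<le> \<bar>coeff g i\<bar> * \<bar>t\<bar> ^ e"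
      by (simp add: abs_mult power_abs mult_left_mono)
  qed
  finally show ?thesis by (simp add: sum_distrib_right)
qed

lemma poly2_eq_poly_map: "poly2 G t z = poly (map_poly (\<lambda>c. poly c t) G) z"
  by (induction G) (simp_all add: map_poly_pCons)

text \<open>The exponent \<open>e\<close> bounds the degrees of the coefficients in the first
  variable. It decides how many interpolation nodes are needed: a congruence modulo
  \<open>q ^ Suc e\<close> beats roots of size O(\<open>q ^ e\<close>).\<close>

lemma monic_poly2_root_growth:
  fixes G :: "int poly poly"
  assumes "lead_coeff G = 1" "\<And>l. degree (coeff G l) \<le> e"
  shows "\<exists>C\<ge>0. \<forall>t z. 1 \<le> \<bar>t\<bar> \<longrightarrow> poly2 G t z = 0 \<longrightarrow> \<bar>z\<bar> \<le> C * \<bar>t\<bar> ^ e"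
proof -
  define c where "c l = (\<Sum>i\<le>degree (coeff G l). \<bar>coeff (coeff G l) i\<bar>)" for l
  define C where "C = 1 + (\<Sum>l<degree G. c l)"
  have c0: "c l \<ge> 0" for l unfolding c_def by (intro sum_nonneg) simp
  then have "C \<ge> 0" unfolding C_def by (simp add: sum_nonneg)
  moreover have "\<bar>z\<bar> \<le> C * \<bar>t\<bar> ^ e" if t: "1 \<le> \<bar>t\<bar>" and z: "poly2 G t z = 0" for t z
  proof -
    define q where "q = map_poly (\<lambda>c. poly c t) G"
    have cq: "coeff q l = poly (coeff G l) t" for l by (simp add: q_def coeff_map_poly)
    have "coeff q (degree G) = 1" using assms(1) by (simp add: cq)
    moreover have "degree q \<le> degree G" unfolding q_def by (rule map_poly_degree_leq)
    ultimately have dq: "degree q = degree G" "lead_coeff q = 1"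
      by (metis le_degree order_antisym zero_neq_one)+
    have "\<bar>z\<bar> \<le> 1 + (\<Sum>l<degree G. \<bar>coeff q l\<bar>)"
      using monic_root_bound[OF dq(2), of z] z unfolding poly2_eq_poly_map q_def[symmetric] dq(1) by blast
    also have "\<dots> \<le> \<bar>t\<bar> ^ e + (\<Sum>l<degree G. c l * \<bar>t\<bar> ^ e)"
      using t abs_poly_le[OF assms(2) t] by (intro add_mono sum_mono) (auto simp: cq c_def)
    finally show ?thesis by (simp add: C_def sum_distrib_right distrib_right)
  qed
  ultimately show ?thesis by blast
qed

abbreviation int_poly :: "int poly \<Rightarrow> 'a::field_char_0 poly"
  where "int_poly \<equiv> map_poly of_int"

lemma poly_int_poly: "poly (int_poly p) (of_int x) = of_int (poly p x)"
  by (induction p) (simp_all add: map_poly_pCons)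

lemma poly2_int_poly:
  "poly2 (map_poly int_poly G) (of_int t) (of_int z) = of_int (poly2 G t z)"
  by (induction G) (simp_all add: map_poly_pCons poly_int_poly)

lemma degree_poly_le:
  fixes G :: "'a::idom poly poly"
  assumes "\<And>l. degree (coeff G l) \<le> e" "degree P \<le> n"
  shows "degree (poly G P) \<le> e + degree G * n"
  unfolding poly_altdef
proof (rule degree_sum_le)
  fix i assume "i \<in> {..degree G}"
  then have "degree P * i \<le> degree G * n" using assms(2) by (simp add: mult.commute[of "degree P"] mult_le_mono)
  then show "degree (coeff G i * P ^ i) \<le> e + degree G * n"
    using degree_mult_le[of "coeff G i" "P ^ i"] degree_power_le[of P i] assms(1)[of i] by linarith
qed simp

text \<open>The polynomial is rational and not integral because it will arise from Lagrange
  interpolation, which introduces denominators.\<close>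

definition poly_branch :: "int poly poly \<Rightarrow> int \<Rightarrow> int \<Rightarrow> bool"
  where "poly_branch G t z \<longleftrightarrow>
    (\<exists>P :: rat poly. poly (map_poly int_poly G) P = 0 \<and> poly P (of_int t) = of_int z)"

lemma poly_split_at:
  fixes f :: "int poly"
  assumes "m > 0"
  obtains g h where "f = g + monom 1 m * h" "degree g < m"
proof
  show "f = poly_cutoff m f + monom 1 m * poly_shift m f"
    by (rule poly_eqI) (auto simp: coeff_poly_cutoff coeff_poly_shift coeff_monom_mult)
  show "degree (poly_cutoff m f) < m"
    using assms by (intro degree_lessI) (auto simp: coeff_poly_cutoff)
qed

text \<open>In one residue class modulo \<open>p\<close> all integral roots lie \<open>q\<^sup>m\<close>-adically close
  to a single power series (\<open>q = p\<^sup>s\<close>), so that their divided differences of order \<open>m\<close> are divisible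
  by \<open>q\<^sup>m\<close>. Since the roots are only \<open>O(q\<^sup>e)\<close> with \<open>e < m\<close>, these divided differences
  vanish and the roots lie on the graph of a polynomial.\<close>

lemma hilbert_one_class:
  fixes G :: "int poly poly" and p \<zeta> :: int
  assumes monic: "lead_coeff G = 1" and e: "\<And>l. degree (coeff G l) \<le> e"
    and p: "prime p" "p dvd poly2 G 0 \<zeta>" "\<not> p dvd poly2 (pderiv G) 0 \<zeta>"
  shows "\<exists>s0. \<forall>s\<ge>s0. \<forall>J\<subseteq>{1..int H}.
    (\<forall>j\<in>J. \<exists>z. p dvd z - \<zeta> \<and> poly2 G (p ^ s * j) z = 0 \<and> \<not> poly_branch G (p ^ s * j) z) \<longrightarrow>
    card J \<le> e + degree G * e"
proof -
  obtain C1 where C1: "C1 \<ge> 0" "\<And>t z. 1 \<le> \<bar>t\<bar> \<Longrightarrow> poly2 G t z = 0 \<Longrightarrow> \<bar>z\<bar> \<le> C1 * \<bar>t\<bar> ^ e"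
    using monic_poly2_root_growth[OF monic e] by blast
  define L where "L J j = \<bar>lagrange_scale J\<bar> + (\<Sum>k\<in>J. \<bar>poly (lagrange_basis J k) j\<bar>)" for J j
  \<comment> \<open>The set \<open>J\<close> may vary with \<open>s\<close>, whereas
    \<open>s0\<close> must not. So the interpolation constants are bounded over all subsets of the
    window at once.\<close>
  define Lmax where "Lmax = (\<Sum>(J,j)\<in>Pow {1..int H} \<times> {1..int H}. L J j)"
  have L0: "L J j \<ge> 0" for J j unfolding L_def by (intro add_nonneg_nonneg sum_nonneg) auto
  have Lmax: "L J j \<le> Lmax" if "J \<subseteq> {1..int H}" "j \<in> {1..int H}" for J j
  proof -
    have "(case (J, j) of (J, j) \<Rightarrow> L J j) \<le> Lmax" unfolding Lmax_def
      by (rule member_le_sum) (use that L0 in auto)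
    then show ?thesis by simp
  qed
  have Lmax0: "Lmax \<ge> 0" unfolding Lmax_def by (intro sum_nonneg) (auto intro: L0)
  define C where "C = Lmax * (C1 * int H ^ e)"
  \<comment> \<open>Since \<open>s < p ^ s\<close>, this choice makes \<open>q = p ^ s\<close>
    exceed \<open>C\<close>, so that the final estimate \<open>C * q ^ e\<close> stays below
    \<open>q ^ Suc e\<close>.\<close>
  define s0 where "s0 = Suc (nat C)"
  have p2: "p \<ge> 2" using p(1) by (rule prime_ge_2_int)
  obtain u where u: "p dvd 1 - u * poly2 (pderiv G) 0 \<zeta>"
  proof -
    have "coprime p (poly2 (pderiv G) 0 \<zeta>)" using p by (intro prime_imp_coprime)
    then obtain a b where "a * p + b * poly2 (pderiv G) 0 \<zeta> = 1"
      by (metis bezout_int coprime_iff_gcd_eq_1)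
    then have "1 - b * poly2 (pderiv G) 0 \<zeta> = a * p" by linarith
    then show ?thesis using that by (metis dvd_triv_right)
  qed
  show ?thesis
  proof (intro exI[of _ s0] allI impI)
    fix s J assume s: "s \<ge> s0" and J: "J \<subseteq> {1..int H}"
      and bad: "\<forall>j\<in>J. \<exists>z. p dvd z - \<zeta> \<and> poly2 G (p ^ s * j) z = 0 \<and> \<not> poly_branch G (p ^ s * j) z"
    then obtain z where z: "\<And>j. j \<in> J \<Longrightarrow> p dvd z j - \<zeta>" "\<And>j. j \<in> J \<Longrightarrow> poly2 G (p ^ s * j) (z j) = 0"
      "\<And>j. j \<in> J \<Longrightarrow> \<not> poly_branch G (p ^ s * j) (z j)" by metis
    define q where "q = p ^ s"
    have finJ: "finite J" using J finite_subset by blast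
    have "int s < q"
    proof -
      have "int s < 2 ^ s" by (metis of_nat_less_two_power)
      also have "\<dots> \<le> q" unfolding q_def using p2 by (intro power_mono) auto
      finally show ?thesis .
    qed
    then have qC: "C < q" using s unfolding s0_def by linarith
    have q1: "q \<ge> 1" using p2 by (simp add: q_def)
    have pq: "p dvd q" using s by (simp add: q_def s0_def)
    have j1: "j \<ge> 1" "j \<le> int H" if "j \<in> J" for j using that J by auto
    show "card J \<le> e + degree G * e"
    proof (rule ccontr)
      assume "\<not> card J \<le> e + degree G * e"
      then have cJ: "card J > e + degree G * e" by simp
      then have "Suc e \<le> card J" by linarith
      \<comment> \<open>\<open>Suc e\<close> nodes determine a polynomial of degree at most
        \<open>e\<close>; the roots at all other indices are then tested against it.\<close>
      then obtain J0 where J0: "J0 \<subseteq> J" "card J0 = Suc e" "finite J0"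
        by (metis obtain_subset_with_card_n)
      then have J0ne: "J0 \<noteq> {}" by auto
      obtain f where f: "\<And>x. p dvd x \<Longrightarrow> p ^ Suc (s * Suc e) dvd poly2 G x (poly f x) \<and> p dvd poly f x - \<zeta>"
        using hensel_poly[OF p(2) u] by blast
      have zf: "q ^ Suc e dvd z j - poly f (q * j)" if "j \<in> J" for j
      proof -
        have px: "p dvd q * j" using pq by simp
        have qe: "q ^ Suc e = p ^ (s * Suc e)" by (metis power_mult q_def)
        have "p dvd poly2 (pderiv G) (q * j) (poly f (q * j)) - poly2 (pderiv G) 0 \<zeta>"
          using dvd_poly2_diff[of p "q * j" 0 "poly f (q * j)" \<zeta> "pderiv G"] px f[OF px] by simp
        then have np: "\<not> p dvd poly2 (pderiv G) (q * j) (poly f (q * j))"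
          using p(3) dvd_diff[of p "poly2 (pderiv G) (q * j) (poly f (q * j))"] by fastforce
        have "p dvd (z j - \<zeta>) - (poly f (q * j) - \<zeta>)"
          using z(1)[OF that] f[OF px] dvd_diff by blast
        then have "p dvd z j - poly f (q * j)" by simp
        moreover have "p ^ (s * Suc e) dvd poly2 G (q * j) (poly f (q * j))"
        proof -
          have "p ^ (s * Suc e) dvd p ^ Suc (s * Suc e)" by (rule le_imp_power_dvd) (rule le_SucI, rule order_refl)
          with f[OF px] show ?thesis using dvd_trans by blast
        qed
        moreover have "p ^ (s * Suc e) dvd poly2 G (q * j) (z j)"
          unfolding q_def z(2)[OF that] by (rule dvd_0_right)
        ultimately show ?thesis unfolding qe
          using hensel_unique[OF p(1) _ np] by blast
      qed
      \<comment> \<open>At the arguments \<open>q * j\<close> the terms of degree above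
        \<open>e\<close> are multiples of \<open>q ^ Suc e\<close>. What remains has degree at most
        \<open>e\<close> and is reproduced exactly by interpolation.\<close>
      obtain g0 h where gh: "f = g0 + monom 1 (Suc e) * h" "degree g0 < Suc e"
        using poly_split_at by blast
      define g where "g = pcompose g0 [:0, q:]"
      have dg: "degree g < card J0"
        using gh(2) J0(2) q1 degree_pcompose_le[of g0 "[:0, q:]"] by (simp add: g_def split: if_splits)
      have zg: "q ^ Suc e dvd z j - poly g j" if "j \<in> J" for j
      proof -
        have "poly f (q * j) - poly g j = q ^ Suc e * (j ^ Suc e * poly h (q * j))"
          by (simp add: gh(1) g_def poly_pcompose poly_monom power_mult_distrib algebra_simps)
        then have "q ^ Suc e dvd (z j - poly f (q * j)) + (poly f (q * j) - poly g j)"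
          using zf[OF that] by (intro dvd_add) auto
        then show ?thesis by simp
      qed
      define V where "V = lagrange_scale J0"
      have V0: "V \<noteq> 0" using lagrange_scale_nonzero J0(3) by (simp add: V_def)
      \<comment> \<open>The interpolation defect \<delta> vanishes for \<open>g\<close>, hence is
        divisible by \<open>q ^ Suc e\<close> for \<open>z\<close>. Its absolute value is smaller
        than that, so it is 0.\<close>
      have interp: "V * z j = (\<Sum>k\<in>J0. z k * poly (lagrange_basis J0 k) j)" if j: "j \<in> J" for j
      proof -
        define \<delta> where "\<delta> = V * z j - (\<Sum>k\<in>J0. poly (lagrange_basis J0 k) j * z k)"
        have "\<delta> = V * (z j - poly g j) - (\<Sum>k\<in>J0. poly (lagrange_basis J0 k) j * (z k - poly g k))"
          unfolding \<delta>_def right_diff_distrib sum_subtractf V_def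
          using lagrange_interpolation[OF J0(3) J0ne dg, of j] by simp
        moreover have "q ^ Suc e dvd \<dots>"
          by (rule dvd_diff[OF dvd_mult[OF zg[OF j]] dvd_sum[OF dvd_mult[OF zg]]]) (use J0(1) in auto)
        ultimately have dvd: "q ^ Suc e dvd \<delta>" by simp
        have zb: "\<bar>z k\<bar> \<le> C1 * int H ^ e * q ^ e" if k: "k \<in> J" for k
        proof -
          have "1 \<le> \<bar>q * k\<bar>" using q1 j1[OF k] by (simp add: abs_mult) (metis mult_mono mult_1 zero_le_one order_trans abs_ge_self)
          then have "\<bar>z k\<bar> \<le> C1 * \<bar>q * k\<bar> ^ e"
            using C1(2) z(2)[OF k] by (simp add: q_def)
          also have "C1 * \<bar>q * k\<bar> ^ e \<le> C1 * (q * int H) ^ e"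
            using q1 j1[OF k] C1(1) by (intro mult_left_mono power_mono) (auto simp: abs_mult)
          finally show ?thesis by (simp add: power_mult_distrib mult_ac)
        qed
        have "\<bar>\<delta>\<bar> \<le> \<bar>V * z j\<bar> + \<bar>\<Sum>k\<in>J0. poly (lagrange_basis J0 k) j * z k\<bar>"
          unfolding \<delta>_def by (rule abs_triangle_ineq4)
        also have "\<dots> \<le> \<bar>V\<bar> * \<bar>z j\<bar> + (\<Sum>k\<in>J0. \<bar>poly (lagrange_basis J0 k) j\<bar> * \<bar>z k\<bar>)"
          using sum_abs[of "\<lambda>k. poly (lagrange_basis J0 k) j * z k" J0] by (simp add: abs_mult)
        also have "\<dots> \<le> \<bar>V\<bar> * (C1 * int H ^ e * q ^ e) +
            (\<Sum>k\<in>J0. \<bar>poly (lagrange_basis J0 k) j\<bar> * (C1 * int H ^ e * q ^ e))"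
          using zb j J0(1) by (intro add_mono sum_mono mult_left_mono) auto
        also have "\<dots> = L J0 j * (C1 * int H ^ e * q ^ e)"
          by (simp add: L_def V_def distrib_right sum_distrib_right)
        also have "\<dots> \<le> Lmax * (C1 * int H ^ e * q ^ e)"
          using Lmax[OF order_trans[OF J0(1) J] subsetD[OF J j]] C1(1) q1
          by (intro mult_right_mono) auto
        also have "\<dots> = C * q ^ e" by (simp add: C_def)
        also have "\<dots> < q * q ^ e" using qC q1 by (intro mult_strict_right_mono) auto
        finally have "\<bar>\<delta>\<bar> < q ^ Suc e" by simp
        with dvd have "\<delta> = 0"
          using dvd_imp_le_int[OF _ dvd] q1 by (fastforce simp: abs_mult power_abs)
        then show ?thesis by (simp add: \<delta>_def mult.commute)
      qed
      define P0 where "P0 = (\<Sum>k\<in>J0. smult (z k) (lagrange_basis J0 k))"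
      define P :: "rat poly" where "P = smult (1 / of_int V) (pcompose (int_poly P0) [:0, 1 / of_int q:])"
      have "degree P0 \<le> e" using degree_lagrange_sum[OF J0(3) J0ne, of z] J0(2) by (simp add: P0_def)
      then have dP: "degree P \<le> e"
        using degree_pcompose_le[of "int_poly P0 :: rat poly" "[:0, 1 / of_int q:]"]
        by (simp add: P_def degree_map_poly q1 split: if_splits)
      have PJ: "poly P (of_int (q * j)) = of_int (z j)" if "j \<in> J" for j
      proof -
        have "poly P (of_int (q * j)) = of_int (poly P0 j) / of_int V"
          using q1 by (simp add: P_def poly_pcompose poly_int_poly)
        also have "poly P0 j = V * z j" using interp[OF that] by (simp add: P0_def poly_sum)
        finally show ?thesis using V0 by simp
      qed
      \<comment> \<open>The degree is at most \<open>e + degree G * e\<close>, and every element of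
        \<open>J\<close> supplies a zero.\<close>
      have "poly (map_poly int_poly G) P = 0"
      proof (rule poly_eqI_degree_zero)
        have "degree (coeff (map_poly int_poly G) l :: rat poly) \<le> e" for l
          using e[of l] map_poly_degree_leq[of "of_int :: int \<Rightarrow> rat" "coeff G l"]
          by (simp add: coeff_map_poly)
        then have "degree (poly (map_poly int_poly G) P) \<le> e + degree (map_poly (int_poly :: int poly \<Rightarrow> rat poly) G) * e"
          using dP by (rule degree_poly_le)
        also have "\<dots> \<le> e + degree G * e" by (simp add: map_poly_degree_leq)
        also have "\<dots> < card J" by (rule cJ)
        also have "\<dots> = card ((\<lambda>j. of_int (q * j) :: rat) ` J)"
          using q1 by (intro card_image[symmetric] inj_onI) simp
        finally show "degree (poly (map_poly int_poly G) P) < card ((\<lambda>j. of_int (q * j) :: rat) ` J)" .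
      next
        fix x assume "x \<in> (\<lambda>j. of_int (q * j) :: rat) ` J"
        then obtain j where j: "j \<in> J" "x = of_int (q * j)" by blast
        show "poly (poly (map_poly int_poly G) P) x = 0"
          using poly_poly_eq_poly2[of "map_poly int_poly G" P x]
          unfolding j(2) PJ[OF j(1)] poly2_int_poly z(2)[OF j(1), folded q_def] by simp
      qed
      moreover obtain j where "j \<in> J" using J0 J0ne by blast
      ultimately have "poly_branch G (p ^ s * j) (z j)" using PJ q_def unfolding poly_branch_def by blast
      with z(3)[OF \<open>j \<in> J\<close>] show False by blast
    qed
  qed
qed

text \<open>A family of maps that is eventually compatible with any given sum or product. With a trivial
  filter this is a ring homomorphism; with an ultrafilter it is a choice of representatives for
  the elements of an ultrapower.\<close>

definition eventual_hom :: "'i filter \<Rightarrow> ('i \<Rightarrow> 'a::idom \<Rightarrow> 'b::idom) \<Rightarrow> bool"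
  where "eventual_hom F r \<longleftrightarrow> (\<forall>i. r i 0 = 0) \<and> (\<forall>\<^sub>F i in F. r i 1 = 1) \<and>
    (\<forall>x y. \<forall>\<^sub>F i in F. r i (x + y) = r i x + r i y) \<and>
    (\<forall>x y. \<forall>\<^sub>F i in F. r i (x * y) = r i x * r i y)"

lemma
  assumes "eventual_hom F r"
  shows eventual_hom_0: "r i 0 = 0"
    and eventual_hom_1: "\<forall>\<^sub>F i in F. r i 1 = 1"
    and eventual_hom_add: "\<forall>\<^sub>F i in F. r i (x + y) = r i x + r i y"
    and eventual_hom_mult: "\<forall>\<^sub>F i in F. r i (x * y) = r i x * r i y"
  using assms by (auto simp: eventual_hom_def)

lemma eventual_hom_uminus:
  assumes "eventual_hom F r"
  shows "\<forall>\<^sub>F i in F. r i (- x) = - r i x"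
  using eventual_hom_add[OF assms, of x "- x"]
  by eventually_elim (metis add.right_inverse add_eq_0_iff eventual_hom_0[OF assms])

lemma eventual_hom_diff:
  assumes "eventual_hom F r"
  shows "\<forall>\<^sub>F i in F. r i (x - y) = r i x - r i y"
  using eventual_hom_add[OF assms, of x "- y"] eventual_hom_uminus[OF assms, of y]
  by eventually_elim simp

lemma eventual_hom_of_nat:
  assumes "eventual_hom F r"
  shows "\<forall>\<^sub>F i in F. r i (of_nat n) = of_nat n"
proof (induction n)
  case (Suc n)
  then show ?case using eventual_hom_add[OF assms, of "of_nat n" 1] eventual_hom_1[OF assms]
    by eventually_elim (simp add: add.commute)
qed (simp add: eventual_hom_0[OF assms])

lemma eventual_hom_poly:
  assumes "eventual_hom F r"
  shows "\<forall>\<^sub>F i in F. r i (poly p x) = poly (map_poly (r i) p) (r i x)"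
proof (induction p)
  case (pCons a p)
  show ?case
    using pCons(2) eventual_hom_add[OF assms, of a "x * poly p x"]
      eventual_hom_mult[OF assms, of x "poly p x"]
    by eventually_elim (simp add: map_poly_pCons eventual_hom_0[OF assms])
qed (simp add: eventual_hom_0[OF assms])

lemma eventual_hom_map_poly:
  assumes "eventual_hom F r"
  shows "eventual_hom F (\<lambda>i. map_poly (r i))"
proof -
  note r0 = eventual_hom_0[OF assms]
  have add: "\<forall>\<^sub>F i in F. map_poly (r i) (p + q) = map_poly (r i) p + map_poly (r i) q" for p q
  proof (induction p q rule: poly_induct2)
    case (pCons a p b q)
    show ?case using pCons eventual_hom_add[OF assms, of a b]
      by eventually_elim (simp add: map_poly_pCons r0)
  qed simp
  have smult: "\<forall>\<^sub>F i in F. map_poly (r i) (smult a q) = smult (r i a) (map_poly (r i) q)" for a q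
  proof (induction q)
    case (pCons b q)
    show ?case using pCons(2) eventual_hom_mult[OF assms, of a b]
      by eventually_elim (simp add: map_poly_pCons r0)
  qed simp
  have mult: "\<forall>\<^sub>F i in F. map_poly (r i) (p * q) = map_poly (r i) p * map_poly (r i) q" for p q
  proof (induction p)
    case (pCons a p)
    show ?case using pCons(2) smult[of a q] add[of "smult a q" "pCons 0 (p * q)"]
      by eventually_elim (simp add: map_poly_pCons r0)
  qed simp
  have "\<forall>\<^sub>F i in F. map_poly (r i) 1 = 1"
    using eventual_hom_1[OF assms] by eventually_elim (simp add: map_poly_1')
  then show ?thesis using add mult by (simp add: eventual_hom_def)
qed

lemma eventual_hom_pderiv:
  fixes r :: "'i \<Rightarrow> 'a::idom \<Rightarrow> 'b::idom"
  assumes "eventual_hom F r"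
  shows "\<forall>\<^sub>F i in F. map_poly (r i) (pderiv p) = pderiv (map_poly (r i) p)"
proof (induction p)
  case (pCons a p)
  show ?case
    using pCons(2) eventual_hom_add[OF eventual_hom_map_poly[OF assms], of p "pCons 0 (pderiv p)"]
    by eventually_elim (simp add: pderiv_pCons map_poly_pCons eventual_hom_0[OF assms])
qed simp

abbreviation map_poly2 :: "('a::zero \<Rightarrow> 'b::zero) \<Rightarrow> 'a poly poly \<Rightarrow> 'b poly poly"
  where "map_poly2 f \<equiv> map_poly (map_poly f)"

lemma eventual_hom_poly2:
  fixes r :: "'i \<Rightarrow> 'a::idom \<Rightarrow> 'b::idom"
  assumes "eventual_hom F r"
  shows "\<forall>\<^sub>F i in F. r i (poly2 G x y) = poly2 (map_poly2 (r i) G) (r i x) (r i y)"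
  using eventual_hom_poly[OF assms, of "poly G [:y:]" x]
    eventual_hom_poly[OF eventual_hom_map_poly[OF assms], of G "[:y:]"]
  by eventually_elim (simp add: map_poly_pCons eventual_hom_0[OF assms])

definition is_ring_hom :: "('a::idom \<Rightarrow> 'b::idom) \<Rightarrow> bool"
  where "is_ring_hom f \<longleftrightarrow> eventual_hom (principal UNIV :: unit filter) (\<lambda>_. f)"

lemma is_ring_homI:
  assumes "f 0 = 0" "f 1 = 1" "\<And>x y. f (x + y) = f x + f y" "\<And>x y. f (x * y) = f x * f y"
  shows "is_ring_hom f"
  using assms by (simp add: is_ring_hom_def eventual_hom_def)

lemma
  assumes "is_ring_hom f"
  shows is_ring_hom_0: "f 0 = 0"
    and is_ring_hom_1: "f 1 = 1"
    and is_ring_hom_add: "f (x + y) = f x + f y"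
    and is_ring_hom_diff: "f (x - y) = f x - f y"
    and is_ring_hom_uminus: "f (- x) = - f x"
    and is_ring_hom_mult: "f (x * y) = f x * f y"
    and is_ring_hom_of_nat: "f (of_nat n) = of_nat n"
    and is_ring_hom_poly: "f (poly p x) = poly (map_poly f p) (f x)"
    and is_ring_hom_poly2: "f (poly2 G x y) = poly2 (map_poly2 f G) (f x) (f y)"
    and is_ring_hom_map_poly: "is_ring_hom (map_poly f)"
    and is_ring_hom_pderiv: "map_poly f (pderiv p) = pderiv (map_poly f p)"
  using assms
    eventual_hom_0[of "principal UNIV :: unit filter" "\<lambda>_. f"]
    eventual_hom_1[of "principal UNIV :: unit filter" "\<lambda>_. f"]
    eventual_hom_add[of "principal UNIV :: unit filter" "\<lambda>_. f" x y]
    eventual_hom_diff[of "principal UNIV :: unit filter" "\<lambda>_. f" x y]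
    eventual_hom_uminus[of "principal UNIV :: unit filter" "\<lambda>_. f" x]
    eventual_hom_mult[of "principal UNIV :: unit filter" "\<lambda>_. f" x y]
    eventual_hom_of_nat[of "principal UNIV :: unit filter" "\<lambda>_. f" n]
    eventual_hom_poly[of "principal UNIV :: unit filter" "\<lambda>_. f" p x]
    eventual_hom_poly2[of "principal UNIV :: unit filter" "\<lambda>_. f" G y x]
    eventual_hom_map_poly[of "principal UNIV :: unit filter" "\<lambda>_. f"]
    eventual_hom_pderiv[of "principal UNIV :: unit filter" "\<lambda>_. f" p]
  unfolding is_ring_hom_def by (simp_all add: eventually_principal)

lemma is_ring_hom_of_int: "is_ring_hom (of_int :: int \<Rightarrow> 'a::field_char_0)"
  by (rule is_ring_homI) auto

lemma is_ring_hom_of_rat: "is_ring_hom (of_rat :: rat \<Rightarrow> 'a::field_char_0)"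
  by (rule is_ring_homI) (auto simp: of_rat_add of_rat_mult)

lemma is_ring_hom_pcompose: "is_ring_hom (\<lambda>c :: 'a::idom poly. pcompose c q)"
  by (rule is_ring_homI) (auto simp: pcompose_add pcompose_mult pcompose_1)

abbreviation poly2_translate :: "int \<Rightarrow> int poly poly \<Rightarrow> int poly poly"
  where "poly2_translate n \<equiv> map_poly (\<lambda>c. pcompose c [:n, 1:])"

lemma poly2_translate: "poly2 (poly2_translate n G) t z = poly2 G (n + t) z"
  by (induction G) (simp_all add: map_poly_pCons poly_pcompose)

lemma lead_coeff_map_poly_monic:
  assumes "is_ring_hom f" "lead_coeff p = 1"
  shows "lead_coeff (map_poly f p) = 1" "degree (map_poly f p) = degree p"
proof -
  have c: "coeff (map_poly f p) i = f (coeff p i)" for i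
    by (simp add: coeff_map_poly is_ring_hom_0[OF assms(1)])
  then have "coeff (map_poly f p) (degree p) = 1" using assms by (simp add: is_ring_hom_1)
  then show "degree (map_poly f p) = degree p"
    by (metis le_degree map_poly_degree_leq order_antisym zero_neq_one)
  then show "lead_coeff (map_poly f p) = 1" using c assms by (simp add: is_ring_hom_1)
qed

lemma poly_branch_translate:
  assumes "poly_branch (poly2_translate n G) t z"
  shows "poly_branch G (n + t) z"
proof -
  obtain P :: "rat poly" where P: "poly (map_poly2 of_int (poly2_translate n G)) P = 0"
    "poly P (of_int t) = of_int z" using assms by (auto simp: poly_branch_def)
  define Q where "Q = pcompose P [:- of_int n, 1:]"
  have tr: "poly2 (map_poly2 of_int (poly2_translate n G)) x y =
      poly2 (map_poly2 of_int G) (of_int n + x) y" for x y :: rat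
  proof (induction G)
    case (pCons a G)
    have "poly (map_poly of_int (pcompose a [:n, 1:])) x = poly (map_poly of_int a) (of_int n + x)"
    proof (induction a)
      case (pCons b a)
      then show ?case
        by (simp add: map_poly_pCons pcompose_pCons map_poly_smult algebra_simps is_ring_hom_add[OF is_ring_hom_map_poly[OF is_ring_hom_of_int]]
          is_ring_hom_mult[OF is_ring_hom_map_poly[OF is_ring_hom_of_int]])
    qed simp
    then show ?case using pCons by (simp add: map_poly_pCons)
  qed simp
  have "poly (poly (map_poly2 of_int G) Q) x = 0" for x
  proof -
    have "poly (poly (map_poly2 of_int G) Q) x = poly2 (map_poly2 of_int G) (of_int n + (x - of_int n)) (poly P (x - of_int n))"
      using poly_poly_eq_poly2[of "map_poly2 of_int G" Q x] by (simp add: Q_def poly_pcompose algebra_simps)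
    also have "\<dots> = poly (poly (map_poly2 of_int (poly2_translate n G)) P) (x - of_int n)"
      using poly_poly_eq_poly2[of "map_poly2 of_int (poly2_translate n G)" P "x - of_int n"]
      unfolding tr[symmetric] by simp
    finally show ?thesis by (simp add: P)
  qed
  then have "poly (map_poly2 of_int G) Q = 0" using poly_all_0_iff_0 by blast
  moreover have "poly Q (of_int (n + t)) = of_int z" by (simp add: Q_def poly_pcompose P)
  ultimately show ?thesis unfolding poly_branch_def by blast
qed

section \<open>Counting bad arguments and choosing a good one\<close>

definition bad_value :: "int poly poly \<Rightarrow> int \<Rightarrow> bool"
  where "bad_value G t \<longleftrightarrow> (\<exists>z. poly2 G t z = 0 \<and> \<not> poly_branch G t z)"

text \<open>The bound is the one for a single residue class times the number \<open>p\<close> of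
  classes. It is uniform in the window length \<open>H\<close>; only \<open>s0\<close> depends on
  \<open>H\<close>. A window longer than the sum of finitely many such bounds therefore contains a
  good argument.\<close>

lemma bad_value_count_0:
  fixes G :: "int poly poly"
  assumes monic: "lead_coeff G = 1" and p: "prime p"
    and sep: "\<And>\<zeta>. p dvd poly2 G 0 \<zeta> \<Longrightarrow> \<not> p dvd poly2 (pderiv G) 0 \<zeta>"
  shows "\<exists>N. \<forall>H. \<exists>s0. \<forall>s\<ge>s0. card {j \<in> {1..int H}. bad_value G (p ^ s * j)} \<le> N"
proof -
  define e where "e = (\<Sum>l\<le>degree G. degree (coeff G l))"
  have e: "degree (coeff G l) \<le> e" for l
  proof (cases "l \<le> degree G")
    case True
    then show ?thesis unfolding e_def by (intro member_le_sum) auto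
  qed (simp add: coeff_eq_0)
  define M where "M = e + degree G * e"
  have p0: "p > 0" using p by (simp add: prime_gt_0_int)
  define J where "J s H \<zeta> = {j \<in> {1..int H}. \<exists>z. p dvd z - \<zeta> \<and> poly2 G (p ^ s * j) z = 0 \<and>
      \<not> poly_branch G (p ^ s * j) z}" for s H \<zeta>
  have "\<exists>s0. \<forall>s\<ge>s0. card (J s H \<zeta>) \<le> M" for H \<zeta>
  proof (cases "p dvd poly2 G 0 \<zeta>")
    case True
    obtain s0 where s0: "\<And>s J'. s \<ge> s0 \<Longrightarrow> J' \<subseteq> {1..int H} \<Longrightarrow>
        (\<And>j. j \<in> J' \<Longrightarrow> \<exists>z. p dvd z - \<zeta> \<and> poly2 G (p ^ s * j) z = 0 \<and> \<not> poly_branch G (p ^ s * j) z) \<Longrightarrow>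
        card J' \<le> M"
      using hilbert_one_class[OF monic e p True sep[OF True], of H] unfolding M_def by metis
    have "card (J s H \<zeta>) \<le> M" if "s \<ge> s0" for s
      by (rule s0[OF that]) (auto simp: J_def)
    then show ?thesis by blast
  next
    case False
    have "J s H \<zeta> = {}" if "s \<ge> 1" for s
    proof -
      have "\<not> (p dvd z - \<zeta> \<and> poly2 G (p ^ s * j) z = 0)" for j z
      proof
        assume a: "p dvd z - \<zeta> \<and> poly2 G (p ^ s * j) z = 0"
        have "p dvd p ^ s * j - 0" using that by (simp add: dvd_power)
        then have "p dvd poly2 G (p ^ s * j) z - poly2 G 0 \<zeta>" using a by (intro dvd_poly2_diff) auto
        then show False using a False by simp
      qed
      then show ?thesis by (auto simp: J_def)
    qed
    then show ?thesis by (metis card.empty le0)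
  qed
  then obtain s0 where s0: "\<And>H \<zeta> s. s \<ge> s0 H \<zeta> \<Longrightarrow> card (J s H \<zeta>) \<le> M" by metis
  show ?thesis
  proof (intro exI allI impI)
    fix H s assume s: "s \<ge> (\<Sum>\<zeta>\<in>{0..<p}. s0 H \<zeta>)"
    have "{j \<in> {1..int H}. bad_value G (p ^ s * j)} \<subseteq> (\<Union>\<zeta>\<in>{0..<p}. J s H \<zeta>)"
    proof
      fix j assume "j \<in> {j \<in> {1..int H}. bad_value G (p ^ s * j)}"
      then obtain z where z: "j \<in> {1..int H}" "poly2 G (p ^ s * j) z = 0" "\<not> poly_branch G (p ^ s * j) z"
        by (auto simp: bad_value_def)
      have "p dvd z - z mod p" by (simp add: minus_mod_eq_mult_div)
      then have "j \<in> J s H (z mod p)" unfolding J_def using z by blast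
      then show "j \<in> (\<Union>\<zeta>\<in>{0..<p}. J s H \<zeta>)" using p0 by auto
    qed
    then have "card {j \<in> {1..int H}. bad_value G (p ^ s * j)} \<le> card (\<Union>\<zeta>\<in>{0..<p}. J s H \<zeta>)"
    proof (rule card_mono[rotated])
      have "finite (J s H \<zeta>)" for \<zeta> unfolding J_def by (rule finite_subset[of _ "{1..int H}"]) auto
      then show "finite (\<Union>\<zeta>\<in>{0..<p}. J s H \<zeta>)" by simp
    qed
    also have "\<dots> \<le> (\<Sum>\<zeta>\<in>{0..<p}. card (J s H \<zeta>))" by (rule card_UN_le) simp
    also have "\<dots> \<le> (\<Sum>\<zeta>\<in>{0..<p}. M)"
    proof (rule sum_mono)
      fix \<zeta> assume "\<zeta> \<in> {0..<p}"
      then have "s0 H \<zeta> \<le> (\<Sum>\<zeta>\<in>{0..<p}. s0 H \<zeta>)" by (intro member_le_sum) auto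
      then show "card (J s H \<zeta>) \<le> M" using s0 s by (meson order_trans)
    qed
    finally show "card {j \<in> {1..int H}. bad_value G (p ^ s * j)} \<le> nat p * M" by simp
  qed
qed

lemma bad_value_count:
  fixes G :: "int poly poly"
  assumes monic: "lead_coeff G = 1" and p: "prime p"
    and sep: "\<And>\<zeta>. p dvd poly2 G n \<zeta> \<Longrightarrow> \<not> p dvd poly2 (pderiv G) n \<zeta>"
  shows "\<exists>N. \<forall>H. \<exists>s0. \<forall>s\<ge>s0. card {j \<in> {1..int H}. bad_value G (n + p ^ s * j)} \<le> N"
proof -
  have "\<exists>N. \<forall>H. \<exists>s0. \<forall>s\<ge>s0. card {j \<in> {1..int H}. bad_value (poly2_translate n G) (p ^ s * j)} \<le> N"
  proof (rule bad_value_count_0)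
    show "lead_coeff (poly2_translate n G) = 1"
      by (rule lead_coeff_map_poly_monic[OF is_ring_hom_pcompose monic])
    show "\<not> p dvd poly2 (pderiv (poly2_translate n G)) 0 \<zeta>" if "p dvd poly2 (poly2_translate n G) 0 \<zeta>" for \<zeta>
      using sep[of \<zeta>] that
      unfolding is_ring_hom_pderiv[OF is_ring_hom_pcompose, symmetric] poly2_translate by simp
  qed (rule p)
  then obtain N where N: "\<And>H. \<exists>s0. \<forall>s\<ge>s0. card {j \<in> {1..int H}. bad_value (poly2_translate n G) (p ^ s * j)} \<le> N"
    by blast
  have imp: "bad_value (poly2_translate n G) t" if "bad_value G (n + t)" for t
    using that poly_branch_translate by (auto simp: bad_value_def poly2_translate)
  have "card {j \<in> {1..int H}. bad_value G (n + p ^ s * j)} \<le> card {j \<in> {1..int H}. bad_value (poly2_translate n G) (p ^ s * j)}" for H s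
  proof (rule card_mono)
    show "finite {j \<in> {1..int H}. bad_value (poly2_translate n G) (p ^ s * j)}"
      by (rule finite_subset[of _ "{1..int H}"]) auto
  qed (use imp in auto)
  then show ?thesis using N by (meson order_trans)
qed

text \<open>The monic polynomial with roots \<open>lead_coeff G * z\<close>, where \<open>z\<close> runs through
  the roots of \<open>G\<close>.\<close>

definition monicize :: "'a::idom poly poly \<Rightarrow> 'a poly poly"
  where "monicize G = monom 1 (degree G) +
    (\<Sum>l<degree G. monom (lead_coeff G ^ (degree G - 1 - l) * coeff G l) l)"

lemma coeff_monicize:
  "coeff (monicize G) i = (if i = degree G then 1
     else if i < degree G then lead_coeff G ^ (degree G - 1 - i) * coeff G i else 0)"
proof -
  have "(\<Sum>l<degree G. coeff (monom (lead_coeff G ^ (degree G - 1 - l) * coeff G l) l) i) =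
      (\<Sum>l<degree G. if l = i then lead_coeff G ^ (degree G - 1 - i) * coeff G i else 0)"
    by (rule sum.cong) auto
  then show ?thesis by (simp add: monicize_def coeff_sum)
qed

lemma lead_coeff_monicize: "lead_coeff (monicize G) = 1"
proof -
  have "degree (monicize G) = degree G"
  proof (rule order_antisym)
    show "degree (monicize G) \<le> degree G" by (rule degree_le) (simp add: coeff_monicize)
    show "degree G \<le> degree (monicize G)" by (rule le_degree) (simp add: coeff_monicize)
  qed
  then show ?thesis by (simp add: coeff_monicize)
qed

lemma pcompose_monicize:
  assumes "degree G \<ge> 1"
  shows "pcompose (monicize G) [:0, lead_coeff G:] = smult (lead_coeff G ^ (degree G - 1)) G"
proof (rule poly_eqI)
  fix i
  define d where "d = degree G"
  define c where "c = lead_coeff G"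
  consider "i = d" | "i < d" | "i > d" by linarith
  then have "c ^ i * coeff (monicize G) i = c ^ (d - 1) * coeff G i"
  proof cases
    case 1
    have "c ^ d = c ^ (d - 1) * c" using assms by (simp add: d_def power_eq_if)
    then show ?thesis using 1 by (simp add: coeff_monicize d_def[symmetric] c_def)
  next
    case 2
    have "c ^ i * c ^ (d - 1 - i) = c ^ (d - 1)" using 2 by (simp add: power_add[symmetric])
    then show ?thesis using 2 by (simp add: coeff_monicize d_def[symmetric] c_def[folded d_def, symmetric] mult.assoc[symmetric])
  next
    case 3
    then show ?thesis by (simp add: coeff_monicize d_def coeff_eq_0)
  qed
  then show "coeff (pcompose (monicize G) [:0, lead_coeff G:]) i = coeff (smult (lead_coeff G ^ (degree G - 1)) G) i"
    by (simp add: coeff_pcompose_linear c_def d_def)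
qed

lemma poly2_monicize:
  assumes "degree G \<ge> 1"
  shows "poly2 (monicize G) x (poly (lead_coeff G) x * z) = poly (lead_coeff G) x ^ (degree G - 1) * poly2 G x z"
proof -
  have "poly (pcompose (monicize G) [:0, lead_coeff G:]) [:z:] = poly (smult (lead_coeff G ^ (degree G - 1)) G) [:z:]"
    by (simp only: pcompose_monicize[OF assms])
  then have "poly (poly (monicize G) (smult z (lead_coeff G))) x = poly (lead_coeff G ^ (degree G - 1) * poly G [:z:]) x"
    by (simp add: poly_pcompose)
  then show ?thesis
    using poly_poly_eq_poly2[of "monicize G" "smult z (lead_coeff G)" x] by (simp add: mult.commute poly_power)
qed

lemma poly2_pderiv_monicize:
  assumes "degree G \<ge> 1"
  shows "poly2 (pderiv (monicize G)) x (poly (lead_coeff G) x * z) * poly (lead_coeff G) x =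
    poly (lead_coeff G) x ^ (degree G - 1) * poly2 (pderiv G) x z"
proof -
  have "pcompose (pderiv (monicize G)) [:0, lead_coeff G:] * [:lead_coeff G:] = smult (lead_coeff G ^ (degree G - 1)) (pderiv G)"
    using arg_cong[OF pcompose_monicize[OF assms], of pderiv]
    by (simp add: pderiv_pcompose pderiv_smult pderiv_pCons)
  then have "poly (pcompose (pderiv (monicize G)) [:0, lead_coeff G:] * [:lead_coeff G:]) [:z:] =
      poly (smult (lead_coeff G ^ (degree G - 1)) (pderiv G)) [:z:]"
    by (simp only:)
  then have "poly (poly (pderiv (monicize G)) (smult z (lead_coeff G)) * lead_coeff G) x =
      poly (lead_coeff G ^ (degree G - 1) * poly (pderiv G) [:z:]) x"
    by (simp add: poly_pcompose mult.commute)
  then show ?thesis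
    using poly_poly_eq_poly2[of "pderiv (monicize G)" "smult z (lead_coeff G)" x] by (simp add: mult.commute poly_power)
qed

lemma map_poly_monicize:
  assumes "is_ring_hom f" "inj f"
  shows "map_poly2 f (monicize G) = monicize (map_poly2 f G)"
proof -
  note h = is_ring_hom_map_poly[OF assms(1)]
  have f0: "f x = 0 \<longleftrightarrow> x = 0" for x using assms(2) is_ring_hom_0[OF assms(1)] by (metis injD)
  have m0: "map_poly f p = 0 \<longleftrightarrow> p = 0" for p
    by (simp add: poly_eq_iff coeff_map_poly is_ring_hom_0[OF assms(1)] f0)
  have d: "degree (map_poly2 f G) = degree G" by (rule degree_map_poly) (simp add: m0)
  have pow: "map_poly f (p ^ n) = map_poly f p ^ n" for p n
    by (induction n) (simp_all add: is_ring_hom_1[OF h] is_ring_hom_mult[OF h])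
  show ?thesis
    by (rule poly_eqI)
      (simp add: coeff_map_poly coeff_monicize d is_ring_hom_1[OF h] is_ring_hom_mult[OF h] pow)
qed

lemma monic_int_poly_rat_root:
  fixes w :: rat
  assumes "lead_coeff p = 1" "poly (map_poly of_int p) w = 0"
  shows "w \<in> \<int>"
proof -
  have "algebraic_int w"
    using lead_coeff_map_poly_monic[OF is_ring_hom_of_int assms(1)] assms(2)
    by (intro algebraic_int.intros[of "map_poly of_int p"]) (auto simp: coeff_map_poly)
  moreover have "w \<in> \<rat>"
  proof -
    obtain a b where "w = of_int a / of_int b" using quotient_of_div surj_pair by metis
    then show ?thesis by simp
  qed
  ultimately show ?thesis by (rule rational_algebraic_int_is_int)
qed

text \<open>\<open>R\<close> plays the role of the resultant of \<open>G\<close> and its derivative.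
  The explicit identity survives specialisation, reduction modulo a prime and passage between the
  ultrapower and its components.\<close>

definition separable_over_int :: "int poly poly \<Rightarrow> bool"
  where "separable_over_int G \<longleftrightarrow> degree G \<ge> 1 \<and>
    (\<exists>A B R. A * G + B * pderiv G = [:R:] \<and> R \<noteq> 0)"

text \<open>As \<open>p\<close> does not divide the leading coefficient at \<open>n\<close>, the
  roots modulo \<open>p\<close> of the monic polynomial are multiples of roots of \<open>G\<close>;
  the certificate \<open>R\<close> then excludes a double root.\<close>

lemma bad_value_count_monicize:
  assumes G: "degree G \<ge> 1" "A * G + B * pderiv G = [:R:]"
    and p: "prime p" "\<not> p dvd poly (lead_coeff G) n" "\<not> p dvd poly R n"
  shows "\<exists>N. \<forall>H. \<exists>s0. \<forall>s\<ge>s0. card {j \<in> {1..int H}. bad_value (monicize G) (n + p ^ s * j)} \<le> N"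
proof (rule bad_value_count[OF lead_coeff_monicize p(1)])
  fix \<zeta> assume \<zeta>: "p dvd poly2 (monicize G) n \<zeta>"
  define c where "c = poly (lead_coeff G) n"
  have "coprime p c" using p by (simp add: c_def prime_imp_coprime)
  then obtain a b where ab: "a * p + b * c = 1"
    by (metis bezout_int coprime_iff_gcd_eq_1)
  \<comment> \<open>\<open>b\<close> inverts \<open>c\<close> modulo \<open>p\<close>, so
    \<open>z\<close> is the root of \<open>G\<close> modulo \<open>p\<close> that corresponds to the
    root \<zeta> of the monic polynomial.\<close>
  define z where "z = b * \<zeta>"
  have "c * z - \<zeta> = - (a * \<zeta>) * p" 
  proof -
    have "c * z = (b * c) * \<zeta>" by (simp add: z_def)
    also have "b * c = 1 - a * p" using ab by simp
    finally show ?thesis by (simp add: algebra_simps)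
  qed
  then have cz: "p dvd c * z - \<zeta>" by (metis dvd_triv_right)
  have cancel: "p dvd x" if "p dvd c ^ k * x" for k x
  proof -
    have "p dvd c ^ k \<or> p dvd x" using that prime_dvd_mult_iff[OF p(1)] by blast
    then show ?thesis using p(2) prime_dvd_power[OF p(1), of c k] unfolding c_def by blast
  qed
  have "p dvd poly2 (monicize G) n (c * z)"
    using dvd_add[OF dvd_poly2_diff[of p n n "c * z" \<zeta> "monicize G"] \<zeta>] cz by simp
  then have 1: "p dvd poly2 G n z" using cancel unfolding c_def poly2_monicize[OF G(1)] by blast
  show "\<not> p dvd poly2 (pderiv (monicize G)) n \<zeta>"
  proof
    assume \<zeta>': "p dvd poly2 (pderiv (monicize G)) n \<zeta>"
    have "p dvd poly2 (pderiv (monicize G)) n (c * z)"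
      using dvd_add[OF dvd_poly2_diff[of p n n "c * z" \<zeta> "pderiv (monicize G)"] \<zeta>'] cz by simp
    then have "p dvd poly2 (pderiv (monicize G)) n (c * z) * c" by simp
    then have 2: "p dvd poly2 (pderiv G) n z"
      using cancel unfolding c_def poly2_pderiv_monicize[OF G(1)] by blast
    have "poly2 (A * G + B * pderiv G) n z = poly R n" unfolding G(2) by simp
    then have "poly2 A n z * poly2 G n z + poly2 B n z * poly2 (pderiv G) n z = poly R n" by simp
    then have "p dvd poly R n" using dvd_add[OF dvd_mult[OF 1] dvd_mult[OF 2], of "poly2 A n z" "poly2 B n z"] by simp
    with p(3) show False by blast
  qed
qed

text \<open>The branch has the form \<open>P\<close> divided by the leading coefficient, because
  polynomial branches are found for the monic polynomial, whose roots are those of \<open>G\<close>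
  times the leading coefficient. The set \<open>E\<close> is there so that \<open>t\<close> can also
  be kept away from roots of auxiliary polynomials.\<close>

theorem hilbert_irreducibility:
  fixes \<G> :: "int poly poly set" and E :: "int set"
  assumes "finite \<G>" "\<And>G. G \<in> \<G> \<Longrightarrow> separable_over_int G" "finite E"
  obtains t where "t \<notin> E"
    "\<And>G z. G \<in> \<G> \<Longrightarrow> poly2 (map_poly2 of_int G) (of_int t) z = 0 \<Longrightarrow>
      \<exists>P :: rat poly. poly P (of_int t) = poly (map_poly of_int (lead_coeff G)) (of_int t) * z \<and>
        (\<forall>x. poly (map_poly of_int (lead_coeff G)) x \<noteq> 0 \<longrightarrow>
          poly2 (map_poly2 of_int G) x (poly P x / poly (map_poly of_int (lead_coeff G)) x) = 0)"
proof -
  obtain A B R where cert: "\<And>G. G \<in> \<G> \<Longrightarrow> A G * G + B G * pderiv G = [:R G:]" "\<And>G. G \<in> \<G> \<Longrightarrow> R G \<noteq> 0"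
    using assms(2) unfolding separable_over_int_def by metis
  have deg: "degree G \<ge> 1" if "G \<in> \<G>" for G using assms(2)[OF that] by (simp add: separable_over_int_def)
  define Q where "Q = (\<Prod>G\<in>\<G>. lead_coeff G * R G)"
  have "lead_coeff G * R G \<noteq> 0" if "G \<in> \<G>" for G
    using cert(2)[OF that] deg[OF that] by fastforce
  then have "Q \<noteq> 0" unfolding Q_def using assms(1) by (simp add: prod_zero_iff)
  then have "finite {n. poly Q n = 0}" by (rule poly_roots_finite)
  then obtain n where n: "poly Q n \<noteq> 0"
    by (metis (mono_tags, lifting) UNIV_I ex_new_if_finite infinite_UNIV_int mem_Collect_eq)
  \<comment> \<open>A prime larger than the nonzero value \<open>poly Q n\<close> does not divide
    it, nor any leading coefficient or certificate at \<open>n\<close>.\<close>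
  obtain p' :: nat where p': "prime p'" "p' > nat \<bar>poly Q n\<bar>" using bigger_prime by blast
  define p where "p = int p'"
  have p: "prime p" using p' by (simp add: p_def)
  have "\<not> p dvd poly Q n" using p' n dvd_imp_le_int[OF n, of p] unfolding p_def by linarith
  moreover have "poly (lead_coeff G) n * poly (R G) n dvd poly Q n" if "G \<in> \<G>" for G
    unfolding Q_def poly_prod poly_mult by (rule dvd_prodI[OF assms(1) that])
  ultimately have np: "\<not> p dvd poly (lead_coeff G) n" "\<not> p dvd poly (R G) n" if "G \<in> \<G>" for G
    using that by (meson dvd_mult dvd_mult2 dvd_trans)+
  define bad where "bad G H s = {j \<in> {1..int H}. bad_value (monicize G) (n + p ^ s * j)}" for G H s
  have "\<exists>N. \<forall>H. \<exists>s0. \<forall>s\<ge>s0. card (bad G H s) \<le> N" if "G \<in> \<G>" for G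
    unfolding bad_def using bad_value_count_monicize[OF deg[OF that] cert(1)[OF that] p np[OF that]] .
  then obtain N where N: "\<And>G. G \<in> \<G> \<Longrightarrow> \<forall>H. \<exists>s0. \<forall>s\<ge>s0. card (bad G H s) \<le> N G"
    by metis
  \<comment> \<open>One more than all bad and all excluded indices together. This choice is not
    circular, since the bounds \<open>N G\<close> were fixed before \<open>H\<close>.\<close>
  define H where "H = Suc (sum N \<G> + card E)"
  have "\<exists>s0. \<forall>s\<ge>s0. card (bad G H s) \<le> N G" if "G \<in> \<G>" for G using N[OF that] by blast
  then obtain s0 where s0: "\<And>G. G \<in> \<G> \<Longrightarrow> \<forall>s\<ge>s0 G. card (bad G H s) \<le> N G"
    by metis
  define s where "s = sum s0 \<G>"
  define badE where "badE = {j \<in> {1..int H}. n + p ^ s * j \<in> E}"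
  have fin: "finite (bad G H s)" "finite badE" for G
    unfolding bad_def badE_def by (rule finite_subset[of _ "{1..int H}"]; auto)+
  have "inj_on (\<lambda>j. n + p ^ s * j) badE"
    using prime_gt_0_int[OF p] by (intro inj_onI) simp
  then have "card badE \<le> card E" by (rule card_inj_on_le) (auto simp: badE_def assms(3))
  moreover have "card (\<Union>G\<in>\<G>. bad G H s) \<le> sum N \<G>"
  proof -
    have "card (\<Union>G\<in>\<G>. bad G H s) \<le> (\<Sum>G\<in>\<G>. card (bad G H s))" by (rule card_UN_le[OF assms(1)])
    also have "\<dots> \<le> sum N \<G>"
    proof (rule sum_mono)
      fix G assume G: "G \<in> \<G>"
      then have "s0 G \<le> s" unfolding s_def using assms(1) by (intro member_le_sum) auto
      then show "card (bad G H s) \<le> N G" using s0[OF G] by blast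
    qed
    finally show ?thesis .
  qed
  moreover have "card ((\<Union>G\<in>\<G>. bad G H s) \<union> badE) \<le> card (\<Union>G\<in>\<G>. bad G H s) + card badE" by (rule card_Un_le)
  moreover have "card {1..int H} = Suc (sum N \<G> + card E)" by (simp add: H_def del: of_nat_Suc of_nat_add of_nat_sum)
  ultimately have "card ((\<Union>G\<in>\<G>. bad G H s) \<union> badE) < card {1..int H}" by linarith
  moreover have "finite ((\<Union>G\<in>\<G>. bad G H s) \<union> badE)" using fin assms(1) by blast
  ultimately obtain j where j: "j \<in> {1..int H}" "j \<notin> (\<Union>G\<in>\<G>. bad G H s) \<union> badE"
    by (metis card_mono linorder_not_le subsetI)
  define t where "t = n + p ^ s * j"
  show ?thesis
  proof (rule that)
    show "t \<notin> E" using j by (auto simp: badE_def t_def)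
    fix G :: "int poly poly" and z :: rat
    assume G: "G \<in> \<G>" and z: "poly2 (map_poly2 of_int G) (of_int t) z = 0"
    define I where "I = map_poly2 (of_int :: int \<Rightarrow> rat) G"
    define c where "c = (map_poly of_int (lead_coeff G) :: rat poly)"
    have h: "is_ring_hom (of_int :: int \<Rightarrow> rat)" "inj (of_int :: int \<Rightarrow> rat)"
      by (rule is_ring_hom_of_int) (simp add: inj_def)
    have dI: "degree I = degree G" unfolding I_def
      by (rule degree_map_poly) (simp add: poly_eq_iff coeff_map_poly)
    have cI: "lead_coeff I = c" using dI by (simp add: I_def c_def coeff_map_poly)
    have IG: "map_poly2 of_int (monicize G) = monicize I" unfolding I_def by (rule map_poly_monicize[OF h])
    have root: "poly2 (monicize I) x (poly c x * y) = poly c x ^ (degree I - 1) * poly2 I x y" for x y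
      using poly2_monicize[of I x y] deg[OF G] by (simp add: dI[symmetric] cI)
    have r0: "poly2 (monicize I) (of_int t) (poly c (of_int t) * z) = 0"
      unfolding root using z by (simp add: I_def)
    then have "poly (map_poly of_int (map_poly (\<lambda>c. poly c t) (monicize G))) (poly c (of_int t) * z) = 0"
      unfolding IG[symmetric] poly2_eq_poly_map
      by (simp add: map_poly_map_poly comp_def poly_int_poly)
    \<comment> \<open>The counting only concerns integral roots. It applies here because a rational
      root of a monic integral polynomial is an integer.\<close>
    then have "poly c (of_int t) * z \<in> \<int>"
    proof (rule monic_int_poly_rat_root[rotated])
      show "lead_coeff (map_poly (\<lambda>c. poly c t) (monicize G)) = 1"
        by (rule lead_coeff_map_poly_monic[OF is_ring_homI lead_coeff_monicize]) auto
    qed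
    then obtain w where w: "poly c (of_int t) * z = of_int w" by (elim Ints_cases)
    have "of_int (poly2 (monicize G) t w) = (0 :: rat)"
      using r0 unfolding w IG[symmetric] poly2_int_poly .
    then have "poly2 (monicize G) t w = 0" by simp
    moreover have "\<not> bad_value (monicize G) t" using j G by (auto simp: bad_def t_def)
    ultimately obtain P :: "rat poly" where P: "poly (monicize I) P = 0" "poly P (of_int t) = of_int w"
      unfolding bad_value_def poly_branch_def IG by blast
    have "poly2 I x (poly P x / poly c x) = 0" if x: "poly c x \<noteq> 0" for x
    proof -
      have "poly c x ^ (degree I - 1) * poly2 I x (poly P x / poly c x) = poly2 (monicize I) x (poly P x)"
        using root[of x "poly P x / poly c x"] x by simp
      also have "\<dots> = 0" using poly_poly_eq_poly2[of "monicize I" P x] P(1) by simp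
      finally show ?thesis using x by simp
    qed
    then show "\<exists>P :: rat poly. poly P (of_int t) = poly (map_poly of_int (lead_coeff G)) (of_int t) * z \<and>
        (\<forall>x. poly (map_poly of_int (lead_coeff G)) x \<noteq> 0 \<longrightarrow>
          poly2 (map_poly2 of_int G) x (poly P x / poly (map_poly of_int (lead_coeff G)) x) = 0)"
      using P(2) w unfolding I_def c_def by auto
  qed
qed

section \<open>Subfields and linear disjointness\<close>

locale subring_set =
  fixes S :: "'a::idom set"
  assumes one_mem: "1 \<in> S"
    and diff_mem: "x \<in> S \<Longrightarrow> y \<in> S \<Longrightarrow> x - y \<in> S"
    and mult_mem: "x \<in> S \<Longrightarrow> y \<in> S \<Longrightarrow> x * y \<in> S"
begin

lemma zero_mem: "0 \<in> S" using diff_mem[OF one_mem one_mem] by simp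

lemma uminus_mem: "x \<in> S \<Longrightarrow> - x \<in> S" using diff_mem[OF zero_mem] by simp

lemma add_mem: "x \<in> S \<Longrightarrow> y \<in> S \<Longrightarrow> x + y \<in> S" using diff_mem[OF _ uminus_mem] by simp

lemma power_mem: "x \<in> S \<Longrightarrow> x ^ n \<in> S"
  by (induction n) (auto intro: one_mem mult_mem)

lemma of_nat_mem: "of_nat n \<in> S"
  by (induction n) (auto intro: zero_mem one_mem add_mem)

lemma of_int_mem: "of_int n \<in> S"
  by (cases n) (auto intro: of_nat_mem uminus_mem simp del: of_nat_Suc)

lemma sum_mem: "(\<And>i. i \<in> I \<Longrightarrow> f i \<in> S) \<Longrightarrow> sum f I \<in> S"
  by (induction I rule: infinite_finite_induct) (auto intro: zero_mem add_mem)

end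

definition polys_over :: "'a::zero set \<Rightarrow> 'a poly set"
  where "polys_over S = {p. \<forall>i. coeff p i \<in> S}"

lemma polys_overD: "p \<in> polys_over S \<Longrightarrow> coeff p i \<in> S"
  by (simp add: polys_over_def)

lemma polys_over_mono: "S \<subseteq> S' \<Longrightarrow> polys_over S \<subseteq> polys_over S'"
  by (auto simp: polys_over_def)

context subring_set
begin

lemma zero_over: "0 \<in> polys_over S" by (simp add: polys_over_def zero_mem)

lemma pCons_over: "a \<in> S \<Longrightarrow> p \<in> polys_over S \<Longrightarrow> pCons a p \<in> polys_over S"
  by (auto simp: polys_over_def coeff_pCons split: nat.split)

lemma monom_over: "a \<in> S \<Longrightarrow> monom a n \<in> polys_over S"
  by (auto simp: polys_over_def zero_mem)

lemma polys_over_subring: "subring_set (polys_over S)"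
proof
  show "1 \<in> polys_over S" by (auto simp: polys_over_def one_mem zero_mem)
  show "p - q \<in> polys_over S" if "p \<in> polys_over S" "q \<in> polys_over S" for p q
    using that by (auto simp: polys_over_def diff_mem)
  show "p * q \<in> polys_over S" if "p \<in> polys_over S" "q \<in> polys_over S" for p q
    using that by (auto simp: polys_over_def coeff_mult intro!: sum_mem mult_mem)
qed

lemma smult_over: "a \<in> S \<Longrightarrow> p \<in> polys_over S \<Longrightarrow> smult a p \<in> polys_over S"
  by (auto simp: polys_over_def mult_mem)

lemma pderiv_over: "p \<in> polys_over S \<Longrightarrow> pderiv p \<in> polys_over S"
  by (auto simp: polys_over_def coeff_pderiv simp del: of_nat_Suc intro!: mult_mem of_nat_mem)

lemma poly_mem: "p \<in> polys_over S \<Longrightarrow> x \<in> S \<Longrightarrow> poly p x \<in> S"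
  unfolding poly_altdef by (intro sum_mem mult_mem power_mem polys_overD)

lemma poly_over_induct [consumes 1, case_names zero pCons]:
  assumes "p \<in> polys_over S" "P 0"
    and "\<And>a p. a \<in> S \<Longrightarrow> p \<in> polys_over S \<Longrightarrow> P p \<Longrightarrow> P (pCons a p)"
  shows "P p"
  using assms(1)
proof (induction p)
  case (pCons a p)
  have "coeff (pCons a p) 0 \<in> S" "\<And>i. coeff (pCons a p) (Suc i) \<in> S"
    using pCons(3) by (blast dest: polys_overD)+
  then have "a \<in> S" "p \<in> polys_over S" by (auto simp: polys_over_def)
  then show ?case using assms(3) pCons by blast
qed (rule assms(2))

lemma pcompose_over:
  assumes "p \<in> polys_over S" "q \<in> polys_over S"
  shows "pcompose p q \<in> polys_over S"
  using assms(1)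
proof (induction rule: poly_over_induct)
  case (pCons a p)
  interpret P: subring_set "polys_over S" by (rule polys_over_subring)
  show ?case unfolding pcompose_pCons
    by (intro P.add_mem P.mult_mem pCons assms pCons_over zero_over)
qed (simp add: zero_over)

text \<open>The coefficients form only a ring, so \<open>f\<close> is multiplied by powers of the
  leading coefficient of \<open>g\<close> instead of being divided.\<close>

lemma pseudo_division:
  assumes g: "g \<in> polys_over S" "g \<noteq> 0"
  shows "f \<in> polys_over S \<Longrightarrow> \<exists>a\<in>S. \<exists>q\<in>polys_over S. \<exists>r\<in>polys_over S.
    a \<noteq> 0 \<and> smult a f = g * q + r \<and> (r = 0 \<or> degree r < degree g)"
\<comment> \<open>The measure puts the zero polynomial strictly below the nonzero constants, which
  \<open>degree\<close> does not.\<close>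
proof (induction "if f = 0 then 0 else Suc (degree f)" arbitrary: f rule: less_induct)
  case less
  interpret P: subring_set "polys_over S" by (rule polys_over_subring)
  show ?case
  proof (cases "f = 0 \<or> degree f < degree g")
    case True
    then show ?thesis using less(2) one_mem zero_over
      by (intro bexI[of _ 1] bexI[of _ 0] bexI[of _ f]) auto
  next
    case False
    define k where "k = degree f - degree g"
    define m where "m = monom (lead_coeff f) k"
    define h where "h = smult (lead_coeff g) f - g * m"
    have m: "m \<in> polys_over S" unfolding m_def by (intro monom_over polys_overD less)
    have h: "h \<in> polys_over S"
      unfolding h_def by (intro P.diff_mem P.mult_mem smult_over polys_overD m g less)
    have ck: "coeff (g * m) (degree f) = lead_coeff f * lead_coeff g"
      using False coeff_monom_mult[of "lead_coeff f" k g "degree f"]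
      by (simp add: m_def k_def mult.commute[of g])
    have dm: "degree (g * m) \<le> degree f"
      using False degree_mult_le[of g m] degree_monom_le[of "lead_coeff f" k] unfolding m_def k_def by linarith
    have "h = 0 \<or> degree h < degree f"
    proof (rule disjCI)
      assume "\<not> degree h < degree f"
      moreover have "degree h \<le> degree f" unfolding h_def
        by (rule degree_diff_le) (use dm degree_smult_le in auto)
      ultimately have "lead_coeff h = coeff h (degree f)" by simp
      also have "\<dots> = 0" by (simp add: h_def ck)
      finally show "h = 0" by simp
    qed
    then have dec: "(if h = 0 then 0 else Suc (degree h)) < (if f = 0 then 0 else Suc (degree f))"
      using False by auto
    obtain a q r where ih: "a \<in> S" "q \<in> polys_over S" "r \<in> polys_over S" "a \<noteq> 0"
      "smult a h = g * q + r" "r = 0 \<or> degree r < degree g" using less(1)[OF dec h] by blast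
    have "smult (a * lead_coeff g) f = smult a h + g * smult a m"
      by (simp add: h_def smult_diff_right)
    also have "\<dots> = g * (q + smult a m) + r" by (simp add: ih algebra_simps)
    finally have "smult (a * lead_coeff g) f = g * (q + smult a m) + r" .
    moreover have "a * lead_coeff g \<in> S" "q + smult a m \<in> polys_over S" "a * lead_coeff g \<noteq> 0"
      using ih g m by (auto intro: mult_mem polys_overD P.add_mem smult_over)
    ultimately show ?thesis using ih(3,6) by blast
  qed
qed

text \<open>A combination \<open>M\<close> of \<open>G\<close> and \<open>H\<close> of least degree
  divides both up to constants. As \<phi> does not kill \<open>H\<close>, it does not kill
  \<open>M\<close>, so it kills the cofactor of \<open>M\<close> in \<open>G\<close>; minimality of
  \<open>G\<close> then makes \<open>M\<close> constant. With evaluation at a point this inverts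
  elements of a simple extension; with evaluation in two variables it yields separability
  certificates.\<close>

lemma poly_bezout_min:
  fixes \<phi> :: "'a poly \<Rightarrow> 'b::idom"
  assumes \<phi>: "is_ring_hom \<phi>" "\<And>c. c \<in> S \<Longrightarrow> c \<noteq> 0 \<Longrightarrow> \<phi> [:c:] \<noteq> 0"
    and G: "G \<in> polys_over S" "G \<noteq> 0" "\<phi> G = 0"
      "\<And>p. p \<in> polys_over S \<Longrightarrow> p \<noteq> 0 \<Longrightarrow> \<phi> p = 0 \<Longrightarrow> degree G \<le> degree p"
    and H: "H \<in> polys_over S" "\<phi> H \<noteq> 0"
  obtains A B R where "A \<in> polys_over S" "B \<in> polys_over S" "R \<in> S" "R \<noteq> 0"
    "A * G + B * H = [:R:]"
proof -
  interpret P: subring_set "polys_over S" by (rule polys_over_subring)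
  define comb where "comb M \<longleftrightarrow> (\<exists>A\<in>polys_over S. \<exists>B\<in>polys_over S. M = A * G + B * H)" for M
  have comb_over: "M \<in> polys_over S" if "comb M" for M
    using that G H unfolding comb_def by (auto intro: P.add_mem P.mult_mem)
  have "G = 1 * G + 0 * H" "H = 0 * G + 1 * H" by simp_all
  then have "comb G \<and> G \<noteq> 0" and combH: "comb H"
    unfolding comb_def using G P.one_mem P.zero_mem by blast+
  then obtain M where M: "comb M" "M \<noteq> 0" "\<And>N. comb N \<Longrightarrow> N \<noteq> 0 \<Longrightarrow> degree M \<le> degree N"
    using ex_has_least_nat[of "\<lambda>M. comb M \<and> M \<noteq> 0" G degree] by blast
  have div: "\<exists>a\<in>S. \<exists>q\<in>polys_over S. a \<noteq> 0 \<and> smult a f = M * q" if f: "comb f" for f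
  proof -
    obtain a q r where d: "a \<in> S" "q \<in> polys_over S" "r \<in> polys_over S" "a \<noteq> 0"
      "smult a f = M * q + r" "r = 0 \<or> degree r < degree M"
      using pseudo_division[OF comb_over[OF M(1)] M(2) comb_over[OF f]] by blast
    obtain A B where AB: "A \<in> polys_over S" "B \<in> polys_over S" "M = A * G + B * H"
      using M(1) by (auto simp: comb_def)
    obtain A' B' where AB': "A' \<in> polys_over S" "B' \<in> polys_over S" "f = A' * G + B' * H"
      using f by (auto simp: comb_def)
    have "r = smult a f - M * q" using d(5) by simp
    also have "\<dots> = (smult a A' - A * q) * G + (smult a B' - B * q) * H"
      unfolding AB(3) AB'(3) by (simp add: algebra_simps smult_add_right)
    finally have "comb r" unfolding comb_def
      using d AB AB' by (blast intro: P.diff_mem P.mult_mem smult_over)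
    then have "r = 0" using M(3) d(6) by (metis linorder_not_le)
    then show ?thesis using d by auto
  qed
  have hom: "\<phi> (smult a f) = \<phi> [:a:] * \<phi> f" for a f
    using is_ring_hom_mult[OF \<phi>(1), of "[:a:]" f] by simp
  obtain a q where a: "a \<in> S" "q \<in> polys_over S" "a \<noteq> 0" "smult a H = M * q"
    using div[OF combH] by blast
  then have "\<phi> M * \<phi> q \<noteq> 0"
    using hom[of a H] \<phi>(2)[of a] H(2) is_ring_hom_mult[OF \<phi>(1), of M q] by simp
  then have M0: "\<phi> M \<noteq> 0" by auto
  obtain b p where b: "b \<in> S" "p \<in> polys_over S" "b \<noteq> 0" "smult b G = M * p"
    using div[OF conjunct1[OF \<open>comb G \<and> G \<noteq> 0\<close>]] by blast
  then have "\<phi> M * \<phi> p = 0"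
    using hom[of b G] G(3) is_ring_hom_mult[OF \<phi>(1), of M p] by simp
  then have "\<phi> p = 0" using M0 by simp
  moreover have "p \<noteq> 0" using b G(2) by auto
  ultimately have "degree G \<le> degree p" using G(4) b(2) by blast
  moreover have "degree G = degree M + degree p"
    using arg_cong[OF b(4), of degree] b(3) M(2) \<open>p \<noteq> 0\<close> by (simp add: degree_mult_eq)
  ultimately have "degree M = 0" by simp
  then obtain R where R: "M = [:R:]" by (rule degree_eq_zeroE)
  then have "R \<noteq> 0" "R \<in> S" using M(2) polys_overD[OF comb_over[OF M(1)], of 0] by auto
  then show ?thesis using that M(1) unfolding comb_def R by metis
qed

end

locale subfield_set = subring_set S for S :: "'a::field set" +
  assumes inverse_mem: "x \<in> S \<Longrightarrow> inverse x \<in> S"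
begin

lemma divide_mem: "x \<in> S \<Longrightarrow> y \<in> S \<Longrightarrow> x / y \<in> S"
  by (simp add: divide_inverse inverse_mem mult_mem)

end

section \<open>Subfields and algebraic elements, linked to HOL-Algebra\<close>

lemma subfield_iff_subfield_set:
  fixes S :: "'a::field set"
  shows "subfield S ring_of_type_algebra \<longleftrightarrow> subfield_set S"
proof -
  let ?R = "ring_of_type_algebra :: 'a ring"
  interpret R: field ?R by (rule field_from_type_algebra)
  have sel: "carrier ?R = UNIV" "monoid.mult ?R = (*)" "one ?R = 1" "ring.zero ?R = 0" "ring.add ?R = (+)"
    by (auto simp: ring_of_type_algebra_def)
  have minus: "\<ominus>\<^bsub>?R\<^esub> x = - x" for x
    using R.minus_equality[of "- x" x] by (simp add: sel)
  have inv: "inv\<^bsub>?R\<^esub> x = inverse x" if "x \<noteq> 0" for x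
    using R.inv_char[of x "inverse x"] that by (simp add: sel)
  show ?thesis
  proof
    assume "subfield S ?R"
    note S = subringE[OF subfieldE(1)[OF this]]
    show "subfield_set S"
    proof
      show "1 \<in> S" using S(3) by (simp add: sel)
      show "x - y \<in> S" if "x \<in> S" "y \<in> S" for x y
        using S(7)[OF that(1) S(5)[OF that(2)]] by (simp add: minus sel)
      show "x * y \<in> S" if "x \<in> S" "y \<in> S" for x y
        using S(6)[OF that] by (simp add: sel)
      show "inverse x \<in> S" if "x \<in> S" for x
        using R.subfield_m_inv(1)[OF \<open>subfield S ?R\<close>, of x] that inv[of x] by (cases "x = 0") (auto simp: sel)
    qed
  next
    assume "subfield_set S"
    then interpret S: subfield_set S .
    show "subfield S ?R"
    proof (rule R.subfieldI')
      show "subring S ?R"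
        by (rule R.subringI) (auto simp: sel minus S.one_mem S.uminus_mem S.mult_mem S.add_mem)
      show "inv\<^bsub>?R\<^esub> k \<in> S" if "k \<in> S - {\<zero>\<^bsub>?R\<^esub>}" for k
        using that inv[of k] S.inverse_mem by (auto simp: sel)
    qed
  qed
qed

definition algebraic_over :: "'a::field set \<Rightarrow> 'a \<Rightarrow> bool"
  where "algebraic_over F z \<longleftrightarrow> (\<exists>p\<in>polys_over F. p \<noteq> 0 \<and> poly p z = 0)"

lemma algebraic_over_iff_HOL_Algebra:
  assumes "subfield_set F"
  shows "ring.algebraic ring_of_type_algebra F z \<longleftrightarrow> algebraic_over F (z :: 'a::field)"
proof -
  let ?R = "ring_of_type_algebra :: 'a ring"
  interpret R: field ?R by (rule field_from_type_algebra)
  interpret F: subfield_set F by (rule assms)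
  have sel: "carrier ?R = UNIV" "monoid.mult ?R = (*)" "one ?R = 1" "ring.zero ?R = 0" "ring.add ?R = (+)"
    by (auto simp: ring_of_type_algebra_def)
  have sr: "subring F ?R" using assms subfield_iff_subfield_set subfieldE(1) by blast
  have pow: "x [^]\<^bsub>?R\<^esub> n = x ^ n" for x :: 'a and n :: nat
    by (induction n) (auto simp: sel mult.commute)
  \<comment> \<open>In HOL-Algebra the leading coefficient is the head of the list, whereas
    \<open>Poly\<close> expects it at the end.\<close>
  have eval: "R.eval p x = poly (Poly (rev p)) x" for p x
    by (induction p) (auto simp: sel pow Poly_append poly_monom)
  show ?thesis
  proof
    assume "R.algebraic F z"
    then obtain p where p: "p \<in> carrier (F[X]\<^bsub>?R\<^esub>)" "p \<noteq> []" "R.eval p z = \<zero>\<^bsub>?R\<^esub>"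
      using R.algebraicE[OF sr, of z] by (auto simp: sel over_def)
    then have s: "set p \<subseteq> F" "hd p \<noteq> 0" by (auto simp: univ_poly_def polynomial_def sel)
    have "Poly (rev p) \<in> polys_over F"
      using s(1) by (auto simp: polys_over_def nth_default_def rev_nth F.zero_mem)
    moreover have "Poly (rev p) \<noteq> 0"
    proof
      assume "Poly (rev p) = 0"
      then have "coeff (Poly (rev p)) (length p - 1) = 0" by simp
      then show False using p(2) s(2) by (simp add: nth_default_def rev_nth hd_conv_nth)
    qed
    ultimately show "algebraic_over F z" using p(3) eval by (auto simp: algebraic_over_def sel)
  next
    assume "algebraic_over F z"
    then obtain p where p: "p \<in> polys_over F" "p \<noteq> 0" "poly p z = 0" by (auto simp: algebraic_over_def)
    have "rev (coeffs p) \<in> carrier (F[X]\<^bsub>?R\<^esub>)"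
      using p by (auto simp: univ_poly_def polynomial_def sel hd_rev last_coeffs_eq_coeff_degree
        polys_over_def coeffs_def)
    moreover have "rev (coeffs p) \<noteq> []" using p(2) by simp
    moreover have "R.eval (rev (coeffs p)) z = \<zero>\<^bsub>?R\<^esub>" by (simp add: eval p sel)
    ultimately show "R.algebraic F z" using R.algebraicI[of "rev (coeffs p)" F z] by (simp add: over_def)
  qed
qed

lemma algebraic_over_mono: "F \<subseteq> K \<Longrightarrow> algebraic_over F z \<Longrightarrow> algebraic_over K z"
  using polys_over_mono[of F K] unfolding algebraic_over_def by blast

lemma (in subfield_set) algebraic_over_mem:
  assumes "z \<in> S" shows "algebraic_over S z"
proof -
  have "[:- z, 1:] \<in> polys_over S" by (intro pCons_over zero_over uminus_mem one_mem assms)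
  then show ?thesis unfolding algebraic_over_def by (intro bexI[of _ "[:- z, 1:]"]) auto
qed

lemma subfield_set_algebraics:
  assumes "subfield_set F"
  shows "subfield_set {z :: 'a::field. algebraic_over F z}"
proof -
  let ?R = "ring_of_type_algebra :: 'a ring"
  interpret R: field ?R by (rule field_from_type_algebra)
  have "subfield {x \<in> carrier ?R. (R.algebraic over F) x} ?R"
    using assms subfield_iff_subfield_set by (intro R.subfield_of_algebraics) auto
  moreover have "{x \<in> carrier ?R. (R.algebraic over F) x} = {z. algebraic_over F z}"
    using algebraic_over_iff_HOL_Algebra[OF assms] by (auto simp: over_def ring_of_type_algebra_def)
  ultimately show ?thesis using subfield_iff_subfield_set by metis
qed

text \<open>\<open>K\<close> may be any set: only the finitely many coefficients of one polynomial
  matter. They generate a finite extension of \<open>F\<close>, and adjoining \<open>z\<close> to it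
  gives a finite tower.\<close>

lemma algebraic_over_trans:
  fixes z :: "'a::field"
  assumes F: "subfield_set F" and z: "algebraic_over K z" and K: "\<And>x. x \<in> K \<Longrightarrow> algebraic_over F x"
  shows "algebraic_over F z"
proof -
  let ?R = "ring_of_type_algebra :: 'a ring"
  interpret R: field ?R by (rule field_from_type_algebra)
  have car: "carrier ?R = UNIV" by (simp add: ring_of_type_algebra_def)
  have sf: "subfield F ?R" using F subfield_iff_subfield_set by blast
  obtain p where p: "p \<in> polys_over K" "p \<noteq> 0" "poly p z = 0" using z by (auto simp: algebraic_over_def)
  have alg: "(R.algebraic over F) x" if "x \<in> set (coeffs p)" for x
  proof -
    have "algebraic_over F x" using that p(1) K by (auto simp: coeffs_def polys_over_def split: if_splits)
    then show ?thesis using algebraic_over_iff_HOL_Algebra[OF F] by (simp add: over_def)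
  qed
  define E where "E = R.finite_extension F (coeffs p)"
  have sE: "subfield E ?R" unfolding E_def
    by (rule R.finite_extension_is_subfield[OF sf]) (use alg car in auto)
  then have E: "subfield_set E" using subfield_iff_subfield_set by blast
  have "set (coeffs p) \<subseteq> E" unfolding E_def
    by (rule R.finite_extension_mem[OF subfieldE(1)[OF sf]]) (simp add: car)
  then have "coeff p i \<in> E" for i
    using E[THEN subfield_set.axioms(1), THEN subring_set.zero_mem]
    by (metis coeff_in_coeffs coeff_eq_0 le_degree not_le p(2) subsetD)
  then have "algebraic_over E z" using p by (auto simp: algebraic_over_def polys_over_def)
  then have "(R.algebraic over E) z" using algebraic_over_iff_HOL_Algebra[OF E] by (simp add: over_def)
  then have "R.finite_dimension E (R.simple_extension E z)"
    using R.finite_dimension_simple_extension[OF sE, of z] car by simp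
  moreover have "R.finite_dimension F E" unfolding E_def
    by (rule R.finite_extension_finite_dimension[OF sf]) (use alg car in auto)
  ultimately have "R.finite_dimension F (R.simple_extension E z)"
    using R.telescopic_base_dim(1)[OF sf sE] by blast
  then have "(R.algebraic over F) z"
    using R.finite_dimension_imp_algebraic[OF sf _ , of "R.simple_extension E z" z]
      R.simple_extension_mem[OF subfieldE(1)[OF sE], of z]
      R.simple_extension_is_subring[OF subfieldE(1)[OF sE], of z] car by auto
  then show ?thesis using algebraic_over_iff_HOL_Algebra[OF F] by (simp add: over_def)
qed

definition min_poly :: "'a::field set \<Rightarrow> 'a \<Rightarrow> 'a poly"
  where "min_poly F z = (SOME p. p \<in> polys_over F \<and> lead_coeff p = 1 \<and> poly p z = 0 \<and>
    (\<forall>q\<in>polys_over F. poly q z = 0 \<longrightarrow> p dvd q))"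

context subfield_set
begin

lemma min_poly:
  assumes "algebraic_over S z"
  shows "min_poly S z \<in> polys_over S" "lead_coeff (min_poly S z) = 1" "poly (min_poly S z) z = 0"
    "\<And>q. q \<in> polys_over S \<Longrightarrow> poly q z = 0 \<Longrightarrow> min_poly S z dvd q"
proof -
  interpret P: subring_set "polys_over S" by (rule polys_over_subring)
  obtain p0 where p0: "p0 \<in> polys_over S" "p0 \<noteq> 0" "poly p0 z = 0"
    using assms by (auto simp: algebraic_over_def)
  then obtain p1 where p1: "p1 \<in> polys_over S \<and> p1 \<noteq> 0 \<and> poly p1 z = 0"
    "\<And>q. q \<in> polys_over S \<and> q \<noteq> 0 \<and> poly q z = 0 \<Longrightarrow> degree p1 \<le> degree q"
    using ex_has_least_nat[of "\<lambda>p. p \<in> polys_over S \<and> p \<noteq> 0 \<and> poly p z = 0" p0 degree] by blast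
  define p where "p = smult (inverse (lead_coeff p1)) p1"
  have p: "p \<in> polys_over S" "lead_coeff p = 1" "poly p z = 0" "p \<noteq> 0" "degree p = degree p1"
    using p1(1) by (auto simp: p_def intro!: smult_over inverse_mem polys_overD)
  have "p dvd q" if q: "q \<in> polys_over S" "poly q z = 0" for q
  proof -
    obtain a s r where d: "a \<in> S" "s \<in> polys_over S" "r \<in> polys_over S" "a \<noteq> 0"
      "smult a q = p * s + r" "r = 0 \<or> degree r < degree p"
      using pseudo_division[OF p(1,4) q(1)] by blast
    have "poly r z = 0" using arg_cong[OF d(5), of "\<lambda>p. poly p z"] q p by simp
    then have "r = 0" using p1(2)[of r] d(3,6) p(5) by (metis linorder_not_le)
    then have "p dvd smult a q" using d(5) by simp
    then show ?thesis using d(4) by (simp add: dvd_smult_iff)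
  qed
  then have "\<exists>p. p \<in> polys_over S \<and> lead_coeff p = 1 \<and> poly p z = 0 \<and>
    (\<forall>q\<in>polys_over S. poly q z = 0 \<longrightarrow> p dvd q)" using p by blast
  from someI_ex[OF this]
  show "min_poly S z \<in> polys_over S" "lead_coeff (min_poly S z) = 1" "poly (min_poly S z) z = 0"
    "\<And>q. q \<in> polys_over S \<Longrightarrow> poly q z = 0 \<Longrightarrow> min_poly S z dvd q"
    unfolding min_poly_def[symmetric] by blast+
qed

lemma min_poly_nonzero: "algebraic_over S z \<Longrightarrow> min_poly S z \<noteq> 0"
  using min_poly(2) by (metis leading_coeff_0_iff zero_neq_one)

lemma degree_min_poly: "algebraic_over S z \<Longrightarrow> degree (min_poly S z) > 0"
proof (rule ccontr)
  assume z: "algebraic_over S z" and "\<not> degree (min_poly S z) > 0"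
  then obtain c where "min_poly S z = [:c:]" using degree_eq_zeroE by blast
  then show False using min_poly(2,3)[OF z] by simp
qed

lemma poly_root_min_poly:
  assumes "algebraic_over S z" "q \<in> polys_over S" "poly q z = 0" "poly (min_poly S z) w = 0"
  shows "poly q w = 0"
  using min_poly(4)[OF assms(1-3)] assms(4) by (auto elim: dvdE)

end

text \<open>Written with quotients so that it is the simple extension F(z) for transcendental
  \<open>z\<close> too.\<close>

definition adjoin :: "'a::field set \<Rightarrow> 'a \<Rightarrow> 'a set"
  where "adjoin F z = {poly p z / poly q z | p q. p \<in> polys_over F \<and> q \<in> polys_over F \<and> poly q z \<noteq> 0}"

context subfield_set
begin

lemma adjoinI:
  assumes "p \<in> polys_over S" shows "poly p z \<in> adjoin S z"
  unfolding adjoin_def using assms polys_over_subring[THEN subring_set.one_mem]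
  by (intro CollectI exI[of _ p] exI[of _ 1]) auto

lemma subset_adjoin: "S \<subseteq> adjoin S z"
proof
  fix x assume "x \<in> S"
  then show "x \<in> adjoin S z" using adjoinI[of "[:x:]" z] by (simp add: pCons_over zero_over)
qed

lemma mem_adjoin: "z \<in> adjoin S z"
  using adjoinI[of "[:0, 1:]" z] by (simp add: pCons_over zero_over zero_mem one_mem)

lemma adjoin_subset:
  assumes "subfield_set K" "S \<subseteq> K" "z \<in> K"
  shows "adjoin S z \<subseteq> K"
proof -
  interpret K: subfield_set K by (rule assms)
  show ?thesis using polys_over_mono[OF assms(2)] assms(3)
    by (auto simp: adjoin_def intro!: K.divide_mem K.poly_mem)
qed

lemma subfield_set_adjoin: "subfield_set (adjoin S z)"
proof -
  interpret P: subring_set "polys_over S" by (rule polys_over_subring)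
  show ?thesis
  proof
    show "1 \<in> adjoin S z" using subset_adjoin one_mem by blast
  next
    fix x y assume "x \<in> adjoin S z" "y \<in> adjoin S z"
    then obtain p q p' q' where x: "x = poly p z / poly q z" "p \<in> polys_over S" "q \<in> polys_over S" "poly q z \<noteq> 0"
      and y: "y = poly p' z / poly q' z" "p' \<in> polys_over S" "q' \<in> polys_over S" "poly q' z \<noteq> 0"
      unfolding adjoin_def by blast
    have "x - y = poly (p * q' - p' * q) z / poly (q * q') z"
      using x(4) y(4) by (simp add: x(1) y(1) field_simps)
    then show "x - y \<in> adjoin S z" unfolding adjoin_def using x y
      by (intro CollectI exI[of _ "p * q' - p' * q"] exI[of _ "q * q'"]) (auto intro: P.diff_mem P.mult_mem)
    have "x * y = poly (p * p') z / poly (q * q') z" by (simp add: x(1) y(1))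
    then show "x * y \<in> adjoin S z" unfolding adjoin_def using x y
      by (intro CollectI exI[of _ "p * p'"] exI[of _ "q * q'"]) (auto intro: P.mult_mem)
  next
    fix x assume "x \<in> adjoin S z"
    then obtain p q where x: "x = poly p z / poly q z" "p \<in> polys_over S" "q \<in> polys_over S" "poly q z \<noteq> 0"
      unfolding adjoin_def by blast
    show "inverse x \<in> adjoin S z"
    proof (cases "x = 0")
      case True
      then show ?thesis using subset_adjoin zero_mem by auto
    next
      case False
      then have "poly p z \<noteq> 0" "inverse x = poly q z / poly p z" using x by auto
      then show ?thesis unfolding adjoin_def using x by blast
    qed
  qed
qed

lemma adjoin_mono: "S \<subseteq> K \<Longrightarrow> subfield_set K \<Longrightarrow> adjoin S z \<subseteq> adjoin K z"
  using subfield_set.subset_adjoin subfield_set.mem_adjoin subfield_set.subfield_set_adjoin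
  by (metis adjoin_subset order_trans)

text \<open>A Bezout identity between the minimal polynomial and the denominator turns the
  denominator into a unit.\<close>

lemma adjoin_algebraic:
  assumes z: "algebraic_over S z" and x: "x \<in> adjoin S z"
  obtains p where "p \<in> polys_over S" "x = poly p z"
proof -
  interpret P: subring_set "polys_over S" by (rule polys_over_subring)
  obtain p q where pq: "x = poly p z / poly q z" "p \<in> polys_over S" "q \<in> polys_over S" "poly q z \<noteq> 0"
    using x unfolding adjoin_def by blast
  obtain A B R where "R \<in> S" "R \<noteq> 0" "B \<in> polys_over S" "A * min_poly S z + B * q = [:R:]"
  proof (rule poly_bezout_min[of "\<lambda>p. poly p z" "min_poly S z" q])
    show "is_ring_hom (\<lambda>p. poly p z)" by (rule is_ring_homI) auto
    show "degree (min_poly S z) \<le> degree p" if "p \<in> polys_over S" "p \<noteq> 0" "poly p z = 0" for p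
      using min_poly(4)[OF z] that by (intro dvd_imp_degree_le) auto
  qed (use min_poly[OF z] min_poly_nonzero[OF z] pq in auto)
  then have B: "R \<in> S" "R \<noteq> 0" "B \<in> polys_over S" "poly (A * min_poly S z + B * q) z = R" by auto
  then have "poly B z * poly q z = R" using min_poly(3)[OF z] by simp
  then have "x = poly (smult (inverse R) (p * B)) z" using pq B(2) by (auto simp: field_simps)
  then show ?thesis using that B pq by (blast intro: smult_over inverse_mem P.mult_mem)
qed

end

text \<open>This is where characteristic zero enters: minimal polynomials have no multiple roots.\<close>

lemma unique_conjugate_mem:
  fixes z :: "'a::{alg_closed_field, field_char_0}"
  assumes F: "subfield_set F"
    and z: "algebraic_over F z" "\<And>w. poly (min_poly F z) w = 0 \<Longrightarrow> w = z"
  shows "z \<in> F"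
proof -
  interpret subfield_set F by (rule F)
  define m where "m = min_poly F z"
  note m = min_poly[OF z(1), folded m_def] degree_min_poly[OF z(1), folded m_def]
  obtain q where q: "m = [:- z, 1:] * q" using m(3) by (metis dvdE poly_eq_0_iff_dvd)
  have q0: "q \<noteq> 0" using q m(5) by auto
  have "poly (pderiv m) z \<noteq> 0"
  proof
    assume "poly (pderiv m) z = 0"
    then have "m dvd pderiv m" by (intro m(4) pderiv_over m(1))
    then show False using m(5) not_dvd_pderiv[of m] by simp
  qed
  then have qz: "poly q z \<noteq> 0" by (simp add: q pderiv_mult pderiv_pCons del: mult_pCons_left)
  have "degree q = 0"
  proof (rule ccontr)
    assume "degree q \<noteq> 0"
    then obtain w where "poly q w = 0" using alg_closed_imp_poly_has_root by blast
    then show False using z(2)[of w] qz by (auto simp: m_def[symmetric] q)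
  qed
  then obtain c where c: "q = [:c:]" by (rule degree_eq_zeroE)
  then have "c = 1" using m(2) q0 by (simp add: q)
  then have "coeff m 0 = - z" by (simp add: q c)
  then show ?thesis using polys_overD[OF m(1), of 0] uminus_mem by fastforce
qed

text \<open>The multiplier \<open>c\<close> avoids the finitely many quotients for which another
  pair of conjugates would give the same sum. It is a natural number, so the primitive element lies
  in every field that contains \<open>a\<close> and \<open>b\<close>.\<close>

lemma primitive_element:
  fixes a b :: "'a::{alg_closed_field, field_char_0}"
  assumes F: "subfield_set F" and a: "algebraic_over F a" and b: "algebraic_over F b"
  obtains c :: nat where "a \<in> adjoin F (a + of_nat c * b)" "b \<in> adjoin F (a + of_nat c * b)"
proof -
  interpret subfield_set F by (rule F)
  define f where "f = min_poly F a"
  define g where "g = min_poly F b"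
  note f = min_poly[OF a, folded f_def] min_poly_nonzero[OF a, folded f_def]
  note g = min_poly[OF b, folded g_def] min_poly_nonzero[OF b, folded g_def]
  define E where "E = (\<lambda>(a', b'). (a' - a) / (b - b')) ` ({x. poly f x = 0} \<times> {x. poly g x = 0})"
  have "finite E" unfolding E_def using f(5) g(5) by (intro finite_imageI finite_cartesian_product poly_roots_finite)
  moreover have "infinite (range (of_nat :: nat \<Rightarrow> 'a))"
    using infinite_UNIV_nat inj_of_nat finite_imageD by blast
  ultimately obtain c :: nat where c: "(of_nat c :: 'a) \<notin> E" by (metis finite_subset image_subsetI)
  define w where "w = a + of_nat c * b"
  define K where "K = adjoin F w"
  interpret K: subfield_set K unfolding K_def by (rule subfield_set_adjoin)
  have FK: "F \<subseteq> K" and wK: "w \<in> K" unfolding K_def by (rule subset_adjoin, rule mem_adjoin)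
  have bK: "algebraic_over K b" by (rule algebraic_over_mono[OF FK b])
  \<comment> \<open>The polynomial f(w - cX) has coefficients in F(w). By the choice of
    \<open>c\<close>, its only common root with \<open>g\<close> is \<open>b\<close>, so
    \<open>b\<close> has no other conjugate over F(w).\<close>
  define h where "h = pcompose f [:w, - of_nat c:]"
  have h: "h \<in> polys_over K" unfolding h_def
    using f(1) polys_over_mono[OF FK]
    by (intro K.pcompose_over K.pCons_over K.zero_over K.uminus_mem K.of_nat_mem wK) auto
  have "b \<in> K"
  proof (rule unique_conjugate_mem[OF K.subfield_set_axioms bK])
    fix b' assume b': "poly (min_poly K b) b' = 0"
    have "poly h b' = 0"
      by (rule K.poly_root_min_poly[OF bK h _ b']) (simp add: h_def poly_pcompose w_def f)
    then have fa: "poly f (w - of_nat c * b') = 0" by (simp add: h_def poly_pcompose mult.commute)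
    have gb: "poly g b' = 0"
      using g(1,3) polys_over_mono[OF FK] by (intro K.poly_root_min_poly[OF bK _ _ b']) auto
    show "b' = b"
    proof (rule ccontr)
      assume ne: "b' \<noteq> b"
      have "of_nat c = (w - of_nat c * b' - a) / (b - b')"
        using ne by (simp add: w_def field_simps)
      then have "of_nat c \<in> E" unfolding E_def using fa gb by (intro image_eqI[of _ _ "(w - of_nat c * b', b')"]) auto
      with c show False by blast
    qed
  qed
  moreover from this have "w - of_nat c * b \<in> K" by (intro K.diff_mem K.mult_mem K.of_nat_mem wK)
  then have "a \<in> K" by (simp add: w_def)
  ultimately show ?thesis using that unfolding K_def w_def by blast
qed

text \<open>Keeping \<theta> inside a prescribed field \<open>E\<close> matters later: the field
  generated by \<theta> then cannot leave the image of a specialisation.\<close>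

lemma primitive_element_finite:
  fixes A :: "'a::{alg_closed_field, field_char_0} set"
  assumes F: "subfield_set F" and "finite A" "\<And>a. a \<in> A \<Longrightarrow> algebraic_over F a"
    and E: "subfield_set E" "F \<subseteq> E" "A \<subseteq> E"
  obtains \<theta> where "\<theta> \<in> E" "algebraic_over F \<theta>" "A \<subseteq> adjoin F \<theta>"
  using assms(2,3) E(3)
proof (induction A arbitrary: thesis rule: finite_induct)
  case empty
  interpret subfield_set F by (rule F)
  show ?case using empty(1)[of 0] algebraic_over_mem[OF zero_mem] E(2) zero_mem by auto
next
  case (insert a A)
  interpret subfield_set F by (rule F)
  interpret E: subfield_set E by (rule E(1))
  obtain \<theta> where \<theta>: "\<theta> \<in> E" "algebraic_over F \<theta>" "A \<subseteq> adjoin F \<theta>" using insert by auto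
  obtain c :: nat where c: "a \<in> adjoin F (a + of_nat c * \<theta>)" "\<theta> \<in> adjoin F (a + of_nat c * \<theta>)"
    using primitive_element[OF F _ \<theta>(2)] insert by blast
  have "a + of_nat c * \<theta> \<in> E" using insert \<theta>(1) by (intro E.add_mem E.mult_mem E.of_nat_mem) auto
  moreover have "algebraic_over F (a + of_nat c * \<theta>)"
  proof -
    interpret A: subfield_set "{x. algebraic_over F x}" by (rule subfield_set_algebraics[OF F])
    have "a + of_nat c * \<theta> \<in> {x. algebraic_over F x}"
      using insert \<theta>(2) by (intro A.add_mem A.mult_mem A.of_nat_mem) auto
    then show ?thesis by simp
  qed
  moreover have "adjoin F \<theta> \<subseteq> adjoin F (a + of_nat c * \<theta>)"
    by (rule adjoin_subset[OF subfield_set_adjoin subset_adjoin c(2)])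
  ultimately show ?case using insert(4) c(1) \<theta>(3) by blast
qed

definition relatively_closed :: "'a::field set \<Rightarrow> 'a set \<Rightarrow> bool"
  where "relatively_closed F M \<longleftrightarrow> (\<forall>z\<in>M. algebraic_over F z \<longrightarrow> z \<in> F)"

text \<open>The minimal polynomial over \<open>M\<close> divides the one over \<open>F\<close>, so
  its roots and therefore its coefficients are algebraic over \<open>F\<close>. The coefficients lie
  in \<open>M\<close>, hence in \<open>F\<close> by relative closedness.\<close>

lemma min_poly_dvd_extension:
  fixes z :: "'a::alg_closed_field"
  assumes F: "subfield_set F" and M: "subfield_set M" "F \<subseteq> M" "relatively_closed F M"
    and z: "algebraic_over F z" and q: "q \<in> polys_over M" "poly q z = 0"
  shows "min_poly F z dvd q"
proof -
  interpret F: subfield_set F by (rule F)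
  interpret M: subfield_set M by (rule M)
  interpret A: subfield_set "{x. algebraic_over F x}" by (rule subfield_set_algebraics[OF F])
  have zM: "algebraic_over M z" by (rule algebraic_over_mono[OF M(2) z])
  define n where "n = min_poly M z"
  note n = M.min_poly[OF zM, folded n_def] M.min_poly_nonzero[OF zM, folded n_def]
  obtain B where B: "n = smult (lead_coeff n) (\<Prod>x\<in>#B. [:- x, 1:])"
    using alg_closed_imp_factorization[OF n(5)] by blast
  then have B': "n = (\<Prod>x\<in>#B. [:- x, 1:])" using n(2) by simp
  have "algebraic_over F x" if "x \<in># B" for x
  proof -
    have "poly n x = 0" unfolding B' using that by (auto simp: poly_prod_mset prod_mset_zero_iff)
    moreover have "n dvd min_poly F z"
      using F.min_poly[OF z] polys_over_mono[OF M(2)] by (intro n(4)) auto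
    ultimately have "poly (min_poly F z) x = 0" by (auto elim: dvdE)
    then show ?thesis using F.min_poly(1)[OF z] F.min_poly_nonzero[OF z] by (auto simp: algebraic_over_def)
  qed
  then have "n \<in> polys_over {x. algebraic_over F x}" unfolding B'
  proof (induction B)
    case empty
    show ?case using A.polys_over_subring[THEN subring_set.one_mem] by simp
  next
    case (add x B)
    interpret P: subring_set "polys_over {x. algebraic_over F x}" by (rule A.polys_over_subring)
    show ?case using add
      by (auto intro!: P.mult_mem A.pCons_over A.zero_over A.uminus_mem A.one_mem simp del: mult_pCons_left)
  qed
  then have "n \<in> polys_over F"
    using n(1) M(3) by (auto simp: polys_over_def relatively_closed_def)
  then have "min_poly F z dvd n" by (intro F.min_poly(4)[OF z] n(3))
  also have "n dvd q" by (rule n(4)[OF q])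
  finally show ?thesis .
qed

text \<open>If \<open>b\<close> were not in \<open>F(\<theta>)\<close>, it would have a conjugate \<open>b' \<noteq> b\<close> over \<open>F(\<theta>)\<close>. The two primitive elements
  \<open>\<theta> + c b\<close> and \<open>\<theta> + c b'\<close> are conjugate over \<open>F\<close>, hence over \<open>M\<close>, so the relation \<open>b = P(\<theta>)\<close>
  is inherited by \<open>b'\<close>.\<close>

lemma linearly_disjoint:
  fixes \<theta> b :: "'a::{alg_closed_field, field_char_0}"
  assumes F: "subfield_set F" and M: "subfield_set M" "F \<subseteq> M" "relatively_closed F M"
    and \<theta>: "algebraic_over F \<theta>" and b: "algebraic_over F b"
    and P: "P \<in> polys_over M" "b = poly P \<theta>"
  shows "b \<in> adjoin F \<theta>"
proof (rule ccontr)
  assume nb: "b \<notin> adjoin F \<theta>"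
  interpret F: subfield_set F by (rule F)
  interpret M: subfield_set M by (rule M)
  interpret PM: subring_set "polys_over M" by (rule M.polys_over_subring)
  define K where "K = adjoin F \<theta>"
  interpret K: subfield_set K unfolding K_def by (rule F.subfield_set_adjoin)
  interpret PK: subring_set "polys_over K" by (rule K.polys_over_subring)
  have FK: "F \<subseteq> K" and \<theta>K: "\<theta> \<in> K" unfolding K_def by (rule F.subset_adjoin, rule F.mem_adjoin)
  have bK: "algebraic_over K b" by (rule algebraic_over_mono[OF FK b])
  obtain b' where b': "poly (min_poly K b) b' = 0" "b' \<noteq> b"
    using unique_conjugate_mem[OF K.subfield_set_axioms bK] nb by (auto simp: K_def)
  have conj: "poly q b' = 0" if "q \<in> polys_over K" "poly q b = 0" for q
    by (rule K.poly_root_min_poly[OF bK that b'(1)])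
  obtain c :: nat where c: "\<theta> \<in> adjoin F (\<theta> + of_nat c * b)" "b \<in> adjoin F (\<theta> + of_nat c * b)"
    using primitive_element[OF F \<theta> b] by blast
  define w where "w = \<theta> + of_nat c * b"
  define w' where "w' = \<theta> + of_nat c * b'"
  have w: "algebraic_over F w"
  proof -
    interpret A: subfield_set "{x. algebraic_over F x}" by (rule subfield_set_algebraics[OF F])
    have "w \<in> {x. algebraic_over F x}"
      unfolding w_def using \<theta> b by (intro A.add_mem A.mult_mem A.of_nat_mem) auto
    then show ?thesis by simp
  qed
  define l where "l = [:\<theta>, of_nat c:]"
  have lK: "l \<in> polys_over K" unfolding l_def by (intro K.pCons_over K.zero_over K.of_nat_mem \<theta>K)
  \<comment> \<open>Identities pass from \<open>b\<close> to \<open>b'\<close>: a polynomial over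
    \<open>F\<close> in \<open>w\<close> is a polynomial over \<open>K\<close> in
    \<open>b\<close>.\<close>
  have conjF: "poly q w' = poly r b'" if "q \<in> polys_over F" "r \<in> polys_over K" "poly q w = poly r b" for q r
  proof -
    have "poly (pcompose q l - r) b' = 0"
    proof (rule conj)
      show "pcompose q l - r \<in> polys_over K"
        using that polys_over_mono[OF FK] lK by (intro PK.diff_mem K.pcompose_over) auto
    qed (use that in \<open>simp add: poly_pcompose l_def w_def mult.commute\<close>)
    then show ?thesis by (simp add: poly_pcompose l_def w'_def mult.commute)
  qed
  obtain A where A: "A \<in> polys_over F" "\<theta> = poly A w"
    using F.adjoin_algebraic[OF w] c(1) w_def by blast
  obtain B where B: "B \<in> polys_over F" "b = poly B w"
    using F.adjoin_algebraic[OF w] c(2) w_def by blast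
  have "min_poly F w dvd B - pcompose P A"
  proof (rule min_poly_dvd_extension[OF F M w])
    show "B - pcompose P A \<in> polys_over M"
      using A B P polys_over_mono[OF M(2)] by (intro PM.diff_mem M.pcompose_over) auto
    show "poly (B - pcompose P A) w = 0" using A(2) B(2) P(2) by (simp add: poly_pcompose)
  qed
  moreover have "poly (min_poly F w) w' = 0"
    using conjF[OF F.min_poly(1)[OF w], of 0] F.min_poly(3)[OF w] K.zero_over by simp
  ultimately have "poly (B - pcompose P A) w' = 0" by (meson dvd_trans poly_eq_0_iff_dvd)
  moreover have "poly A w' = \<theta>"
  proof -
    have "[:\<theta>:] \<in> polys_over K" by (intro K.pCons_over K.zero_over \<theta>K)
    from conjF[OF A(1) this] show ?thesis using A(2)[symmetric] by simp
  qed
  moreover have "poly B w' = b'"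
  proof -
    have "[:0, 1:] \<in> polys_over K" by (intro K.pCons_over K.zero_over K.zero_mem K.one_mem)
    from conjF[OF B(1) this] show ?thesis using B(2)[symmetric] by simp
  qed
  ultimately have "b' = poly P \<theta>" unfolding poly_diff poly_pcompose by simp
  with P(2) b'(2) show False by simp
qed

section \<open>Extension of homomorphisms\<close>

locale field_hom_on =
  D: subfield_set D for D :: "'a::field set" +
  fixes \<sigma> :: "'a \<Rightarrow> 'b::field"
  assumes hom_one: "\<sigma> 1 = 1"
    and hom_add: "x \<in> D \<Longrightarrow> y \<in> D \<Longrightarrow> \<sigma> (x + y) = \<sigma> x + \<sigma> y"
    and hom_mult: "x \<in> D \<Longrightarrow> y \<in> D \<Longrightarrow> \<sigma> (x * y) = \<sigma> x * \<sigma> y"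
begin

lemma hom_zero: "\<sigma> 0 = 0"
proof -
  have "\<sigma> 0 + \<sigma> 0 = \<sigma> 0 + 0" using hom_add[OF D.zero_mem D.zero_mem] by (metis add.right_neutral)
  then show ?thesis by (rule add_left_imp_eq)
qed

lemma hom_uminus: "x \<in> D \<Longrightarrow> \<sigma> (- x) = - \<sigma> x"
  using hom_add[of x "- x"] D.uminus_mem hom_zero minus_unique[of "\<sigma> x" "\<sigma> (- x)"] by simp

lemma hom_diff: "x \<in> D \<Longrightarrow> y \<in> D \<Longrightarrow> \<sigma> (x - y) = \<sigma> x - \<sigma> y"
  using hom_add[of x "- y"] by (simp add: D.uminus_mem hom_uminus)

lemma hom_inverse: "x \<in> D \<Longrightarrow> \<sigma> (inverse x) = inverse (\<sigma> x)"
proof (cases "x = 0")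
  case False
  assume x: "x \<in> D"
  have "\<sigma> x * \<sigma> (inverse x) = 1"
    using hom_mult[OF x D.inverse_mem[OF x]] False hom_one by simp
  then show ?thesis by (metis inverse_unique)
qed (simp add: hom_zero)

lemma hom_eq_0_iff: "x \<in> D \<Longrightarrow> \<sigma> x = 0 \<longleftrightarrow> x = 0"
  using hom_mult[of x "inverse x"] hom_zero hom_one D.inverse_mem[of x]
  by (metis mult_zero_left right_inverse zero_neq_one)

lemma hom_inj: "inj_on \<sigma> D"
  by (rule inj_onI) (metis D.diff_mem hom_diff hom_eq_0_iff right_minus_eq)

lemma subfield_set_image: "E \<subseteq> D \<Longrightarrow> subfield_set E \<Longrightarrow> subfield_set (\<sigma> ` E)"
proof -
  assume E: "E \<subseteq> D" "subfield_set E"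
  interpret E: subfield_set E by (rule E)
  show ?thesis
  proof
    show "1 \<in> \<sigma> ` E" using E.one_mem hom_one by force
    fix x y assume "x \<in> \<sigma> ` E" "y \<in> \<sigma> ` E"
    then obtain a b where ab: "a \<in> E" "b \<in> E" "x = \<sigma> a" "y = \<sigma> b" by blast
    then have "a \<in> D" "b \<in> D" using E by auto
    then have "x - y = \<sigma> (a - b)" "x * y = \<sigma> (a * b)" by (simp_all add: ab hom_diff hom_mult)
    then show "x - y \<in> \<sigma> ` E" "x * y \<in> \<sigma> ` E" using ab E.diff_mem E.mult_mem by auto
  next
    fix x assume "x \<in> \<sigma> ` E"
    then obtain a where a: "a \<in> E" "x = \<sigma> a" by blast
    then have "inverse x = \<sigma> (inverse a)" using E by (simp add: hom_inverse subsetD)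
    then show "inverse x \<in> \<sigma> ` E" using a E.inverse_mem by auto
  qed
qed

lemma map_poly_add_on:
  "p \<in> polys_over D \<Longrightarrow> q \<in> polys_over D \<Longrightarrow> map_poly \<sigma> (p + q) = map_poly \<sigma> p + map_poly \<sigma> q"
  by (rule poly_eqI) (simp add: coeff_map_poly hom_zero hom_add polys_overD)

lemma map_poly_smult_on:
  "a \<in> D \<Longrightarrow> p \<in> polys_over D \<Longrightarrow> map_poly \<sigma> (smult a p) = smult (\<sigma> a) (map_poly \<sigma> p)"
  by (rule poly_eqI) (simp add: coeff_map_poly hom_zero hom_mult polys_overD)

lemma map_poly_diff_on:
  "p \<in> polys_over D \<Longrightarrow> q \<in> polys_over D \<Longrightarrow> map_poly \<sigma> (p - q) = map_poly \<sigma> p - map_poly \<sigma> q"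
  by (rule poly_eqI) (simp add: coeff_map_poly hom_zero hom_diff polys_overD)

lemma map_poly_mult_on:
  assumes "p \<in> polys_over D" "q \<in> polys_over D"
  shows "map_poly \<sigma> (p * q) = map_poly \<sigma> p * map_poly \<sigma> q"
  using assms(1)
proof (induction rule: D.poly_over_induct)
  case (pCons a p)
  interpret P: subring_set "polys_over D" by (rule D.polys_over_subring)
  have "pCons 0 (p * q) \<in> polys_over D"
    using pCons assms by (intro D.pCons_over D.zero_mem P.mult_mem)
  then show ?case using pCons assms(2)
    by (simp add: map_poly_pCons hom_zero map_poly_add_on map_poly_smult_on D.smult_over)
qed simp

lemma hom_poly:
  assumes "p \<in> polys_over D" "x \<in> D"
  shows "\<sigma> (poly p x) = poly (map_poly \<sigma> p) (\<sigma> x)"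
  using assms(1)
proof (induction rule: D.poly_over_induct)
  case (pCons a p)
  then show ?case using assms(2)
    by (simp add: map_poly_pCons hom_zero hom_add hom_mult D.mult_mem D.poly_mem)
qed (simp add: hom_zero)

lemma map_poly_eq_0_iff_on: "p \<in> polys_over D \<Longrightarrow> map_poly \<sigma> p = 0 \<longleftrightarrow> p = 0"
  by (simp add: poly_eq_iff coeff_map_poly hom_zero hom_eq_0_iff polys_overD)

text \<open>The hypothesis says that \<open>u\<close> and \<open>u'\<close> satisfy corresponding
  relations, which makes the value on fractions well defined. It covers transcendental elements and
  roots of minimal polynomials alike.\<close>

lemma extend:
  assumes corr: "\<And>p. p \<in> polys_over D \<Longrightarrow> poly p u = 0 \<longleftrightarrow> poly (map_poly \<sigma> p) u' = 0"
  obtains \<tau> where "field_hom_on (adjoin D u) \<tau>" "\<And>x. x \<in> D \<Longrightarrow> \<tau> x = \<sigma> x" "\<tau> u = u'"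
proof -
  interpret P: subring_set "polys_over D" by (rule D.polys_over_subring)
  define rep where "rep x pq \<longleftrightarrow> fst pq \<in> polys_over D \<and> snd pq \<in> polys_over D \<and> poly (snd pq) u \<noteq> 0 \<and>
    x = poly (fst pq) u / poly (snd pq) u" for x pq
  define ev where "ev pq = poly (map_poly \<sigma> (fst pq)) u' / poly (map_poly \<sigma> (snd pq)) u'" for pq
  define \<tau> where "\<tau> x = ev (SOME pq. rep x pq)" for x
  have wd: "ev pq = ev pq'" if "rep x pq" "rep x pq'" for x pq pq'
  proof -
    note r = that[unfolded rep_def]
    have nz: "poly (map_poly \<sigma> (snd pq)) u' \<noteq> 0" "poly (map_poly \<sigma> (snd pq')) u' \<noteq> 0"
      using r corr by blast+
    have "poly (fst pq) u * poly (snd pq') u = poly (fst pq') u * poly (snd pq) u"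
      using r by (metis frac_eq_eq)
    then have "poly (fst pq * snd pq' - fst pq' * snd pq) u = 0" by simp
    then have "poly (map_poly \<sigma> (fst pq * snd pq' - fst pq' * snd pq)) u' = 0"
      using corr[of "fst pq * snd pq' - fst pq' * snd pq"] r P.diff_mem P.mult_mem by simp
    then have "poly (map_poly \<sigma> (fst pq)) u' * poly (map_poly \<sigma> (snd pq')) u' =
        poly (map_poly \<sigma> (fst pq')) u' * poly (map_poly \<sigma> (snd pq)) u'"
      using r by (simp add: map_poly_diff_on map_poly_mult_on P.mult_mem)
    then show ?thesis unfolding ev_def using nz by (simp add: frac_eq_eq)
  qed
  have \<tau>: "\<tau> x = ev pq" if "rep x pq" for x pq
    unfolding \<tau>_def by (rule wd[OF someI[of "rep x", OF that] that])
  have base: "\<tau> (poly p u) = poly (map_poly \<sigma> p) u'" if "p \<in> polys_over D" for p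
  proof -
    have "rep (poly p u) (p, 1)" using that by (simp add: rep_def P.one_mem)
    from \<tau>[OF this] show ?thesis by (simp add: ev_def map_poly_1' hom_one)
  qed
  have rep_ex: "\<exists>pq. rep x pq" if "x \<in> adjoin D u" for x
    using that unfolding adjoin_def rep_def by auto
  have "field_hom_on (adjoin D u) \<tau>"
  proof (rule field_hom_on.intro[OF D.subfield_set_adjoin], unfold_locales)
    show "\<tau> 1 = 1" using base[of 1] by (simp add: P.one_mem map_poly_1' hom_one)
    fix x y assume "x \<in> adjoin D u" "y \<in> adjoin D u"
    then obtain p q p' q' where r: "rep x (p, q)" "rep y (p', q')" using rep_ex by (metis surj_pair)
    note R = r[unfolded rep_def fst_conv snd_conv]
    have nz: "poly (map_poly \<sigma> q) u' \<noteq> 0" "poly (map_poly \<sigma> q') u' \<noteq> 0" using R corr by blast+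
    have "rep (x + y) (p * q' + p' * q, q * q')"
      using R by (simp add: rep_def P.add_mem P.mult_mem field_simps)
    then have "\<tau> (x + y) = ev (p * q' + p' * q, q * q')" by (rule \<tau>)
    also have "\<dots> = ev (p, q) + ev (p', q')"
      unfolding ev_def using R nz
      by (simp add: map_poly_add_on map_poly_mult_on P.mult_mem field_simps)
    finally show "\<tau> (x + y) = \<tau> x + \<tau> y" using \<tau>[OF r(1)] \<tau>[OF r(2)] by simp
    have "rep (x * y) (p * p', q * q')" using R by (simp add: rep_def P.mult_mem)
    then have "\<tau> (x * y) = ev (p * p', q * q')" by (rule \<tau>)
    also have "\<dots> = ev (p, q) * ev (p', q')" unfolding ev_def using R by (simp add: map_poly_mult_on)
    finally show "\<tau> (x * y) = \<tau> x * \<tau> y" using \<tau>[OF r(1)] \<tau>[OF r(2)] by simp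
  qed
  moreover have "\<tau> x = \<sigma> x" if "x \<in> D" for x
    using base[of "[:x:]"] that by (simp add: D.pCons_over D.zero_over map_poly_pCons hom_zero)
  moreover have "\<tau> u = u'"
    using base[of "[:0, 1:]"] by (simp add: D.pCons_over D.zero_over D.zero_mem D.one_mem map_poly_pCons hom_zero hom_one)
  ultimately show ?thesis using that by blast
qed

lemma extend_transcendental:
  assumes "\<not> algebraic_over D u" "\<not> algebraic_over (\<sigma> ` D) u'"
  obtains \<tau> where "field_hom_on (adjoin D u) \<tau>" "\<And>x. x \<in> D \<Longrightarrow> \<tau> x = \<sigma> x" "\<tau> u = u'"
proof (rule extend)
  fix p assume p: "p \<in> polys_over D"
  have "map_poly \<sigma> p \<in> polys_over (\<sigma> ` D)"
    using p by (auto simp: polys_over_def coeff_map_poly hom_zero)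
  then have "poly (map_poly \<sigma> p) u' = 0 \<longleftrightarrow> map_poly \<sigma> p = 0"
    using assms(2) by (auto simp: algebraic_over_def)
  moreover have "poly p u = 0 \<longleftrightarrow> p = 0" using assms(1) p by (auto simp: algebraic_over_def)
  ultimately show "poly p u = 0 \<longleftrightarrow> poly (map_poly \<sigma> p) u' = 0"
    using map_poly_eq_0_iff_on[OF p] by simp
qed (use that in blast)

lemma extend_root:
  assumes u: "algebraic_over D u" and u': "poly (map_poly \<sigma> (min_poly D u)) u' = 0"
  obtains \<tau> where "field_hom_on (adjoin D u) \<tau>" "\<And>x. x \<in> D \<Longrightarrow> \<tau> x = \<sigma> x" "\<tau> u = u'"
proof (rule extend)
  interpret P: subring_set "polys_over D" by (rule D.polys_over_subring)
  note m = D.min_poly[OF u] D.min_poly_nonzero[OF u]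
  fix p assume p: "p \<in> polys_over D"
  show "poly p u = 0 \<longleftrightarrow> poly (map_poly \<sigma> p) u' = 0"
  proof
    assume pu: "poly p u = 0"
    obtain a s r where d: "a \<in> D" "s \<in> polys_over D" "r \<in> polys_over D" "a \<noteq> 0"
      "smult a p = min_poly D u * s + r" "r = 0 \<or> degree r < degree (min_poly D u)"
      using D.pseudo_division[OF m(1,5) p] by blast
    have "poly r u = 0" using arg_cong[OF d(5), of "\<lambda>p. poly p u"] pu m by simp
    then have "min_poly D u dvd r" by (rule m(4)[OF d(3)])
    then have "r = 0" using d(6) by (metis dvd_imp_degree_le linorder_not_le)
    then have "map_poly \<sigma> (smult a p) = map_poly \<sigma> (min_poly D u * s)" using d(5) by simp
    then have "smult (\<sigma> a) (map_poly \<sigma> p) = map_poly \<sigma> (min_poly D u) * map_poly \<sigma> s"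
      unfolding map_poly_smult_on[OF d(1) p] map_poly_mult_on[OF m(1) d(2)] .
    then have "\<sigma> a * poly (map_poly \<sigma> p) u' = 0"
      using u' by (metis mult_zero_left poly_mult poly_smult)
    then show "poly (map_poly \<sigma> p) u' = 0" using d(1,4) by (simp add: hom_eq_0_iff)
  next
    assume pu: "poly (map_poly \<sigma> p) u' = 0"
    show "poly p u = 0"
    proof (rule ccontr)
      assume ne: "poly p u \<noteq> 0"
      \<comment> \<open>The image under \<sigma> of a Bezout identity for the minimal polynomial and
        \<open>p\<close> shows that the two images have no common root.\<close>
      obtain A B R where AB: "A \<in> polys_over D" "B \<in> polys_over D" "R \<in> D" "R \<noteq> 0"
        "A * min_poly D u + B * p = [:R:]"
      proof (rule D.poly_bezout_min[of "\<lambda>p. poly p u" "min_poly D u" p])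
        show "is_ring_hom (\<lambda>p. poly p u)" by (rule is_ring_homI) auto
        show "degree (min_poly D u) \<le> degree p" if "p \<in> polys_over D" "p \<noteq> 0" "poly p u = 0" for p
          using m(4) that by (intro dvd_imp_degree_le) auto
      qed (use m p ne in auto)
      have "map_poly \<sigma> A * map_poly \<sigma> (min_poly D u) + map_poly \<sigma> B * map_poly \<sigma> p =
          map_poly \<sigma> (A * min_poly D u + B * p)"
        using AB(1,2) p m(1) by (simp add: map_poly_add_on map_poly_mult_on P.mult_mem)
      also have "\<dots> = [:\<sigma> R:]" unfolding AB(5) by (simp add: map_poly_pCons hom_zero)
      finally have "map_poly \<sigma> A * map_poly \<sigma> (min_poly D u) + map_poly \<sigma> B * map_poly \<sigma> p = [:\<sigma> R:]" .
      from arg_cong[OF this, of "\<lambda>q. poly q u'"] have "\<sigma> R = 0" using pu u' by simp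
      then show False using AB by (simp add: hom_eq_0_iff)
    qed
  qed
qed (use that in blast)

end

lemma extend_algebraic:
  fixes \<sigma> :: "'a::field \<Rightarrow> 'b::alg_closed_field"
  assumes "field_hom_on D \<sigma>" and u: "algebraic_over D u"
  obtains \<tau> where "field_hom_on (adjoin D u) \<tau>" "\<And>x. x \<in> D \<Longrightarrow> \<tau> x = \<sigma> x"
    "poly (map_poly \<sigma> (min_poly D u)) (\<tau> u) = 0"
proof -
  interpret field_hom_on D \<sigma> by (rule assms)
  have "degree (map_poly \<sigma> (min_poly D u)) = degree (min_poly D u)"
    by (rule map_poly_degree_eq) (simp add: D.min_poly[OF u] hom_one)
  then obtain u' where "poly (map_poly \<sigma> (min_poly D u)) u' = 0"
    using D.degree_min_poly[OF u] alg_closed_imp_poly_has_root by metis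
  then show ?thesis using extend_root[OF u] that by metis
qed

lemma hom_image_algebraic:
  assumes "field_hom_on D \<sigma>" "x \<in> D" "F \<subseteq> D" "algebraic_over F x"
  shows "algebraic_over (\<sigma> ` F) (\<sigma> x)"
proof -
  interpret field_hom_on D \<sigma> by (rule assms)
  obtain p where p: "p \<in> polys_over F" "p \<noteq> 0" "poly p x = 0" using assms(4) by (auto simp: algebraic_over_def)
  have pD: "p \<in> polys_over D" using p(1) polys_over_mono[OF assms(3)] by blast
  have "coeff (map_poly \<sigma> p) i \<in> \<sigma> ` F" for i using p(1) by (simp add: coeff_map_poly hom_zero polys_overD)
  moreover have "map_poly \<sigma> p \<noteq> 0" using map_poly_eq_0_iff_on[OF pD] p(2) by simp
  moreover have "poly (map_poly \<sigma> p) (\<sigma> x) = 0" using hom_poly[OF pD assms(2)] p(3) hom_zero by simp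
  ultimately show ?thesis unfolding algebraic_over_def polys_over_def by blast
qed

section \<open>The algebraic closure of the rationals and its automorphisms\<close>

lemma countable_UNIV_alg_closure: "countable (UNIV :: 'a::{field, countable} alg_closure set)"
proof -
  have "x \<in> (\<Union>cs\<in>{cs :: 'a list. Poly cs \<noteq> 0}. {x. poly (map_poly to_ac (Poly cs)) x = 0})"
    for x :: "'a alg_closure"
  proof -
    obtain p :: "'a poly" where "p \<noteq> 0" "poly (map_poly to_ac p) x = 0"
      by (rule alg_closure_algebraic)
    then show ?thesis by (intro UN_I[of "coeffs p"]) auto
  qed
  then have "UNIV = (\<Union>cs\<in>{cs :: 'a list. Poly cs \<noteq> 0}. {x :: 'a alg_closure. poly (map_poly to_ac (Poly cs)) x = 0})"
    by blast
  also have "countable \<dots>"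
  proof (rule countable_UN[OF countableI_type countable_finite])
    fix cs :: "'a list" assume "cs \<in> {cs. Poly cs \<noteq> 0}"
    then have "map_poly to_ac (Poly cs) \<noteq> (0 :: 'a alg_closure poly)"
      by (simp add: poly_eq_iff coeff_map_poly)
    then show "finite {x :: 'a alg_closure. poly (map_poly to_ac (Poly cs)) x = 0}"
      by (rule poly_roots_finite)
  qed
  finally show ?thesis .
qed

instance alg_closure :: ("{field, countable}") countable
  by (rule countable_classI[of "to_nat_on UNIV"]) (simp add: countable_UNIV_alg_closure)

lemma Rats_subset_subfield:
  fixes S :: "'a::field_char_0 set"
  assumes "subfield_set S" shows "\<rat> \<subseteq> S"
proof
  interpret S: subfield_set S by (rule assms)
  fix x :: 'a assume "x \<in> \<rat>"
  then obtain a b where "x = of_int a / of_int b" by (auto elim: Rats_cases')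
  then show "x \<in> S" by (simp add: S.divide_mem S.of_int_mem)
qed

lemma subfield_set_Rats: "subfield_set (\<rat> :: 'a::field_char_0 set)"
  by unfold_locales auto

lemma alg_closure_algebraic_over_Rats: "algebraic_over \<rat> (x :: rat alg_closure)"
proof -
  obtain p :: "rat poly" where p: "p \<noteq> 0" "poly (map_poly to_ac p) x = 0"
    by (rule alg_closure_algebraic)
  have "to_ac r \<in> (\<rat> :: rat alg_closure set)" for r :: rat
  proof -
    obtain a b where "r = of_int a / of_int b" using quotient_of_div surj_pair by metis
    then show ?thesis by simp
  qed
  then have "map_poly to_ac p \<in> polys_over (\<rat> :: rat alg_closure set)"
    by (simp add: polys_over_def coeff_map_poly)
  moreover have "map_poly to_ac p \<noteq> (0 :: rat alg_closure poly)"
    using p(1) by (simp add: poly_eq_iff coeff_map_poly)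
  ultimately show ?thesis using p(2) by (auto simp: algebraic_over_def)
qed

lemma is_ring_hom_imp_field_hom_on:
  fixes \<alpha> :: "'a::field \<Rightarrow> 'b::field"
  assumes "is_ring_hom \<alpha>" "subfield_set D"
  shows "field_hom_on D \<alpha>"
  using assms(2) is_ring_hom_1[OF assms(1)] is_ring_hom_add[OF assms(1)] is_ring_hom_mult[OF assms(1)]
  by (intro field_hom_on.intro field_hom_on_axioms.intro) auto

lemma subfield_set_UNIV: "subfield_set UNIV"
  by unfold_locales auto

lemma field_hom_Rats:
  fixes \<sigma> :: "'a::field_char_0 \<Rightarrow> 'b::field_char_0"
  assumes "field_hom_on D \<sigma>" "x = of_int a / of_int b"
  shows "\<sigma> x = of_int a / of_int b"
proof -
  interpret field_hom_on D \<sigma> by (rule assms)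
  have nat: "\<sigma> (of_nat n) = of_nat n" for n
    by (induction n) (simp_all add: hom_zero hom_one hom_add D.of_nat_mem D.one_mem)
  have int: "\<sigma> (of_int n) = of_int n" for n
    by (cases n) (simp_all add: nat hom_uminus D.of_nat_mem del: of_nat_Suc)
  show ?thesis
    by (simp add: assms(2) divide_inverse hom_mult hom_inverse D.of_int_mem D.inverse_mem int)
qed

lemma field_hom_root_Rats:
  fixes \<sigma> :: "'a::field_char_0 \<Rightarrow> 'a"
  assumes "field_hom_on UNIV \<sigma>" "p \<in> polys_over \<rat>" "poly p a = 0"
  shows "poly p (\<sigma> a) = 0"
proof -
  interpret field_hom_on UNIV \<sigma> by (rule assms(1))
  have "\<sigma> (coeff p i) = coeff p i" for i
    using polys_overD[OF assms(2), of i] field_hom_Rats[OF assms(1)] by (metis Rats_cases')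
  then have "map_poly \<sigma> p = p" by (intro poly_eqI) (simp add: coeff_map_poly hom_zero)
  moreover have "p \<in> polys_over UNIV" by (simp add: polys_over_def)
  ultimately show ?thesis using hom_poly[of p a] assms(3) hom_zero by simp
qed

text \<open>All elements of the closure are adjoined in turn along an enumeration, and the resulting
  chain of maps is glued.\<close>

lemma extend_to_automorphism:
  fixes \<tau> :: "rat alg_closure \<Rightarrow> rat alg_closure"
  assumes "field_hom_on L \<tau>"
  obtains \<alpha> where "is_ring_hom \<alpha>" "bij \<alpha>" "\<And>x. x \<in> L \<Longrightarrow> \<alpha> x = \<tau> x"
proof -
  define e :: "nat \<Rightarrow> rat alg_closure" where "e = from_nat_into UNIV"
  define idx :: "rat alg_closure \<Rightarrow> nat" where "idx = to_nat_on UNIV"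
  have e_idx: "e (idx x) = x" for x unfolding e_def idx_def
    by (simp add: countable_UNIV_alg_closure)
  define P where "P n s \<longleftrightarrow> field_hom_on (fst s) (snd s) \<and> (n = 0 \<longrightarrow> s = (L, \<tau>))"
    for n :: nat and s :: "rat alg_closure set \<times> (rat alg_closure \<Rightarrow> rat alg_closure)"
  define Q where "Q n s s' \<longleftrightarrow> fst s \<subseteq> fst s' \<and> e n \<in> fst s' \<and> (\<forall>x\<in>fst s. snd s' x = snd s x)"
    for n and s s' :: "rat alg_closure set \<times> (rat alg_closure \<Rightarrow> rat alg_closure)"
  have "\<exists>f. \<forall>n. P n (f n) \<and> Q n (f n) (f (Suc n))"
  proof (rule dependent_nat_choice)
    show "\<exists>s. P 0 s" using assms by (auto simp: P_def)
    fix s n assume "P n s"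
    then have h: "field_hom_on (fst s) (snd s)" by (simp add: P_def)
    interpret field_hom_on "fst s" "snd s" by (rule h)
    have "algebraic_over (fst s) (e n)"
      using algebraic_over_mono[OF Rats_subset_subfield[OF D.subfield_set_axioms] alg_closure_algebraic_over_Rats] .
    from extend_algebraic[OF h this] obtain \<tau>' where "field_hom_on (adjoin (fst s) (e n)) \<tau>'"
      "\<And>x. x \<in> fst s \<Longrightarrow> \<tau>' x = snd s x" by blast
    then have "P (Suc n) (adjoin (fst s) (e n), \<tau>') \<and> Q n s (adjoin (fst s) (e n), \<tau>')"
      using D.subset_adjoin D.mem_adjoin by (auto simp: P_def Q_def)
    then show "\<exists>s'. P (Suc n) s' \<and> Q n s s'" by blast
  qed
  then obtain f where f: "\<And>n. P n (f n)" "\<And>n. Q n (f n) (f (Suc n))" by blast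
  define D where "D n = fst (f n)" for n
  define \<sigma> where "\<sigma> n = snd (f n)" for n
  have hom: "field_hom_on (D n) (\<sigma> n)" for n using f(1) by (simp add: P_def D_def \<sigma>_def)
  have step: "D n \<subseteq> D (Suc n)" "e n \<in> D (Suc n)" "\<And>x. x \<in> D n \<Longrightarrow> \<sigma> (Suc n) x = \<sigma> n x" for n
    using f(2)[of n] by (auto simp: Q_def D_def \<sigma>_def)
  have mono: "D n \<subseteq> D m" if "n \<le> m" for n m using lift_Suc_mono_le[of D] step(1) that by blast
  have agree: "\<sigma> m x = \<sigma> n x" if "n \<le> m" "x \<in> D n" for n m x
    using that by (induction rule: dec_induct) (use step(3) mono in \<open>auto simp: subset_iff\<close>)
  define \<alpha> where "\<alpha> x = \<sigma> (Suc (idx x)) x" for x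
  have inD: "x \<in> D (Suc (idx x))" for x using step(2)[of "idx x"] by (simp add: e_idx)
  have \<alpha>: "\<alpha> x = \<sigma> n x" if "x \<in> D n" for x n
    using agree[of n "max n (Suc (idx x))" x] agree[of "Suc (idx x)" "max n (Suc (idx x))" x] that inD
    by (simp add: \<alpha>_def)
  have \<alpha>hom: "field_hom_on UNIV \<alpha>"
  proof (rule field_hom_on.intro[OF subfield_set_UNIV], unfold_locales)
    interpret h: field_hom_on "D 0" "\<sigma> 0" by (rule hom)
    show "\<alpha> 1 = 1" using \<alpha>[OF h.D.one_mem] h.hom_one by simp
    fix x y :: "rat alg_closure"
    define n where "n = max (Suc (idx x)) (Suc (idx y))"
    interpret h: field_hom_on "D n" "\<sigma> n" by (rule hom)
    have xy: "x \<in> D n" "y \<in> D n" using mono inD unfolding n_def by (meson max.cobounded1 max.cobounded2 subsetD)+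
    show "\<alpha> (x + y) = \<alpha> x + \<alpha> y"
      using \<alpha>[OF xy(1)] \<alpha>[OF xy(2)] \<alpha>[OF h.D.add_mem[OF xy]] h.hom_add[OF xy] by simp
    show "\<alpha> (x * y) = \<alpha> x * \<alpha> y"
      using \<alpha>[OF xy(1)] \<alpha>[OF xy(2)] \<alpha>[OF h.D.mult_mem[OF xy]] h.hom_mult[OF xy] by simp
  qed
  interpret \<alpha>: field_hom_on UNIV \<alpha> by (rule \<alpha>hom)
  have rh: "is_ring_hom \<alpha>"
    by (rule is_ring_homI) (simp_all add: \<alpha>.hom_zero \<alpha>.hom_one \<alpha>.hom_add \<alpha>.hom_mult)
  have inj: "inj \<alpha>" by (rule \<alpha>.hom_inj)
  have "y \<in> range \<alpha>" for y
  proof -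
    obtain p where p: "p \<in> polys_over \<rat>" "p \<noteq> 0" "poly p y = 0"
      using alg_closure_algebraic_over_Rats unfolding algebraic_over_def by blast
    \<comment> \<open>Surjectivity comes from finiteness: an injective map of the root set of a
      rational polynomial into itself is onto.\<close>
    have "\<alpha> ` {x. poly p x = 0} \<subseteq> {x. poly p x = 0}"
      using field_hom_root_Rats[OF \<alpha>hom p(1)] by blast
    then have "\<alpha> ` {x. poly p x = 0} = {x. poly p x = 0}"
      using inj poly_roots_finite[OF p(2)] by (intro endo_inj_surj) (auto simp: inj_on_def)
    then show ?thesis using p(3) by blast
  qed
  then have "bij \<alpha>" using inj by (auto simp: bij_def)
  moreover have "\<alpha> x = \<tau> x" if "x \<in> L" for x
  proof -
    have "f 0 = (L, \<tau>)" using f(1)[of 0] by (simp add: P_def)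
    then show ?thesis using \<alpha>[of x 0] that by (simp add: D_def \<sigma>_def)
  qed
  ultimately show ?thesis using that rh by blast
qed

section \<open>Ultrapowers\<close>

text \<open>Zorn's lemma gives a minimal proper filter below \<open>sequentially\<close>, since
  infima of chains stay proper. Minimality decides every \<open>P\<close>: the filter either already
  contains \<open>P\<close> or cannot be refined by it.\<close>

lemma nonprincipal_ultrafilter_exists:
  "\<exists>F :: nat filter. F \<noteq> bot_class.bot \<and> F \<le> sequentially \<and> (\<forall>P. eventually P F \<or> (\<forall>\<^sub>F i in F. \<not> P i))"
proof -
  define \<A> where "\<A> = {F :: nat filter. F \<noteq> bot_class.bot \<and> F \<le> sequentially}"
  have "\<exists>F\<in>\<A>. \<forall>G\<in>\<A>. F \<ge> G \<longrightarrow> G = F"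
  proof (rule predicate_Zorn)
    show "partial_order_on \<A> (relation_of (\<ge>) \<A>)"
      by (rule partial_order_on_relation_ofI) auto
    fix C assume "C \<in> Chains (relation_of (\<ge>) \<A>)"
    then have C: "C \<subseteq> \<A>" and lin: "\<And>F G. F \<in> C \<Longrightarrow> G \<in> C \<Longrightarrow> F \<ge> G \<or> G \<ge> F"
      by (auto simp: Chains_def relation_of_def)
    show "\<exists>u\<in>\<A>. \<forall>a\<in>C. a \<ge> u"
    proof (cases "C = {}")
      case True
      have "sequentially \<in> \<A>" by (simp add: \<A>_def)
      then show ?thesis using True by blast
    next
      case False
      have "Inf Y \<noteq> bot_class.bot" if "Y \<subseteq> C" "finite Y" for Y
      proof (cases "Y = {}")
        case nonempty: False
        have "\<exists>F\<in>Y. \<forall>G\<in>Y. F \<le> G" using that(2) nonempty that(1)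
        proof (induction Y rule: finite_ne_induct)
          case (insert F Y)
          then obtain G where "G \<in> Y" "\<forall>H\<in>Y. G \<le> H" by auto
          then have G: "G \<in> Y" "\<And>H. H \<in> Y \<Longrightarrow> G \<le> H" by auto
          have "F \<le> G \<or> G \<le> F" using lin[of F G] G(1) insert.prems by auto
          then show ?case
          proof
            assume "F \<le> G"
            then have "\<forall>H\<in>insert F Y. F \<le> H" using G(2) order_trans by blast
            then show ?thesis by blast
          next
            assume "G \<le> F"
            then have "\<forall>H\<in>insert F Y. G \<le> H" using G(2) by blast
            then show ?thesis using G(1) by blast
          qed
        qed auto
        then obtain F where "F \<in> Y" "F \<le> Inf Y" by (meson Inf_greatest)
        then show ?thesis using that C by (auto simp: \<A>_def bot_unique)
      next
        case True
        have "sequentially \<le> Inf Y" by (simp add: True)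
        then show ?thesis using bot_unique trivial_limit_sequentially by metis
      qed
      then have "Inf C \<noteq> bot_class.bot" by (rule Inf_filter_not_bot)
      moreover have "Inf C \<le> sequentially" using False C by (auto simp: \<A>_def intro: Inf_lower2)
      ultimately have "Inf C \<in> \<A>" by (simp add: \<A>_def)
      then show ?thesis using Inf_lower by blast
    qed
  qed
  then obtain F where F: "F \<in> \<A>" "\<And>G. G \<in> \<A> \<Longrightarrow> G \<le> F \<Longrightarrow> G = F" by blast
  have "eventually P F \<or> (\<forall>\<^sub>F i in F. \<not> P i)" for P
  proof (cases "inf_class.inf F (principal {i. P i}) = bot_class.bot")
    case True
    then have "eventually (\<lambda>i. False) (inf_class.inf F (principal {i. P i}))" by simp
    then show ?thesis by (simp add: eventually_inf_principal)
  next
    case False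
    then have "inf_class.inf F (principal {i. P i}) = F"
      using F by (intro F(2)) (auto simp: \<A>_def intro: le_infI1)
    then have "F \<le> principal {i. P i}" by (metis Lattices.inf_le2)
    then show ?thesis by (simp add: le_principal)
  qed
  then show ?thesis using F(1) unfolding \<A>_def by blast
qed

definition \<U> :: "nat filter"
  where "\<U> = (SOME F. F \<noteq> bot_class.bot \<and> F \<le> sequentially \<and> (\<forall>P. eventually P F \<or> (\<forall>\<^sub>F i in F. \<not> P i)))"

lemma
  shows ultra_not_bot: "\<U> \<noteq> bot_class.bot"
    and ultra_le_sequentially: "\<U> \<le> sequentially"
    and ultra_cases: "eventually P \<U> \<or> (\<forall>\<^sub>F i in \<U>. \<not> P i)"
  using someI_ex[OF nonprincipal_ultrafilter_exists] unfolding \<U>_def[symmetric] by blast+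

lemma ultra_frequently: "(\<not> eventually P \<U>) \<longleftrightarrow> (\<forall>\<^sub>F i in \<U>. \<not> P i)"
proof -
  have False if "eventually P \<U>" "\<forall>\<^sub>F i in \<U>. \<not> P i"
  proof -
    have "\<forall>\<^sub>F i in \<U>. False" using that by eventually_elim simp
    then show False using ultra_not_bot by simp
  qed
  then show ?thesis using ultra_cases[of P] by blast
qed

lemma ultra_const [simp]: "(\<forall>\<^sub>F i in \<U>. P) \<longleftrightarrow> P"
  using ultra_not_bot by (cases P) auto

lemma ultra_ex: "eventually P \<U> \<Longrightarrow> \<exists>i. P i"
  using ultra_not_bot eventually_happens by blast

lemma ultra_large: "\<forall>\<^sub>F i in \<U>. i \<ge> n"
  using eventually_ge_at_top ultra_le_sequentially filter_leD by blast

quotient_type 'a ultrapower = "nat \<Rightarrow> 'a" / "\<lambda>f g. \<forall>\<^sub>F i in \<U>. f i = g i"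
proof (rule equivpI)
  show "transp (\<lambda>f g :: nat \<Rightarrow> 'a. \<forall>\<^sub>F i in \<U>. f i = g i)"
    by (rule transpI) (erule (1) eventually_elim2, simp)
qed (auto simp: reflp_def symp_def eq_commute)

instantiation ultrapower :: (field) field
begin

lift_definition zero_ultrapower :: "'a ultrapower" is "\<lambda>_. 0" .
lift_definition one_ultrapower :: "'a ultrapower" is "\<lambda>_. 1" .
lift_definition plus_ultrapower :: "'a ultrapower \<Rightarrow> 'a ultrapower \<Rightarrow> 'a ultrapower"
  is "\<lambda>f g i. f i + g i" by (erule (1) eventually_elim2) simp
lift_definition minus_ultrapower :: "'a ultrapower \<Rightarrow> 'a ultrapower \<Rightarrow> 'a ultrapower"
  is "\<lambda>f g i. f i - g i" by (erule (1) eventually_elim2) simp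
lift_definition times_ultrapower :: "'a ultrapower \<Rightarrow> 'a ultrapower \<Rightarrow> 'a ultrapower"
  is "\<lambda>f g i. f i * g i" by (erule (1) eventually_elim2) simp
lift_definition inverse_ultrapower :: "'a ultrapower \<Rightarrow> 'a ultrapower"
  is "\<lambda>f i. inverse (f i)" by (erule eventually_mono) simp
lift_definition divide_ultrapower :: "'a ultrapower \<Rightarrow> 'a ultrapower \<Rightarrow> 'a ultrapower"
  is "\<lambda>f g i. f i / g i" by (erule (1) eventually_elim2) simp
lift_definition uminus_ultrapower :: "'a ultrapower \<Rightarrow> 'a ultrapower"
  is "\<lambda>f i. - f i" by (erule eventually_mono) simp

instance
proof intro_classes
  fix a b c :: "'a ultrapower"
  show "a * b * c = a * (b * c)" by transfer (simp add: mult.assoc)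
  show "a * b = b * a" by transfer (simp add: mult.commute)
  show "1 * a = a" by transfer simp
  show "a + b + c = a + (b + c)" by transfer (simp add: add.assoc)
  show "a + b = b + a" by transfer (simp add: add.commute)
  show "0 + a = a" by transfer simp
  show "- a + a = 0" by transfer simp
  show "a - b = a + - b" by transfer simp
  show "(a + b) * c = a * c + b * c" by transfer (simp add: distrib_right)
  show "(0 :: 'a ultrapower) \<noteq> 1" by transfer simp
  show "a \<noteq> 0 \<Longrightarrow> inverse a * a = 1"
    by transfer (auto simp: ultra_frequently elim: eventually_mono)
  show "a div b = a * inverse b" by transfer (simp add: divide_inverse)
  show "inverse (0 :: 'a ultrapower) = 0" by transfer simp
qed

end

lift_definition star :: "(nat \<Rightarrow> 'a) \<Rightarrow> 'a ultrapower" is "\<lambda>f. f" .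

definition const :: "'a \<Rightarrow> 'a ultrapower"
  where "const c = star (\<lambda>_. c)"

text \<open>A choice of representatives that sends \<open>0\<close> to the zero sequence.\<close>

definition rep :: "nat \<Rightarrow> 'a::field ultrapower \<Rightarrow> 'a"
  where "rep i x = (if x = 0 then 0 else rep_ultrapower x i)"

lemma star_eq_iff: "star f = star g \<longleftrightarrow> (\<forall>\<^sub>F i in \<U>. f i = g i)"
  by transfer simp

lemma star_rep: "star (\<lambda>i. rep i x) = x"
proof (cases "x = 0")
  case True
  then show ?thesis unfolding rep_def by simp (transfer, simp)
next
  case False
  then have "(\<lambda>i. rep i x) = rep_ultrapower x" by (auto simp: rep_def)
  then show ?thesis using Quotient3_abs_rep[OF Quotient3_ultrapower] unfolding star.abs_eq by metis
qed

lemma rep_star: "\<forall>\<^sub>F i in \<U>. rep i (star f) = f i"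
  using star_rep[of "star f"] by (simp add: star_eq_iff)

lemma ultra_eq_iff: "x = y \<longleftrightarrow> (\<forall>\<^sub>F i in \<U>. rep i x = rep i y)"
  by (metis star_rep star_eq_iff)

lemma
  shows star_add: "star f + star g = star (\<lambda>i. f i + g i)"
    and star_mult: "star f * star g = star (\<lambda>i. f i * g i)"
    and star_inverse: "inverse (star f) = star (\<lambda>i. inverse (f i))"
    and star_zero: "0 = star (\<lambda>_. 0)" and star_one: "1 = star (\<lambda>_. 1)"
  by (transfer, simp)+

lemma rep_0 [simp]: "rep i 0 = 0" by (simp add: rep_def)

lemma eventual_hom_rep: "eventual_hom \<U> rep"
  unfolding eventual_hom_def
proof (intro conjI allI)
  show "\<forall>\<^sub>F i in \<U>. rep i (1 :: 'a ultrapower) = 1" unfolding star_one by (rule rep_star)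
  fix x y :: "'a ultrapower"
  have "x + y = star (\<lambda>i. rep i x + rep i y)" "x * y = star (\<lambda>i. rep i x * rep i y)"
    by (simp_all add: star_rep flip: star_add star_mult)
  then show "\<forall>\<^sub>F i in \<U>. rep i (x + y) = rep i x + rep i y" "\<forall>\<^sub>F i in \<U>. rep i (x * y) = rep i x * rep i y"
    using rep_star by metis+
qed simp

lemma rep_inverse: "\<forall>\<^sub>F i in \<U>. rep i (inverse x) = inverse (rep i x)"
  by (metis rep_star star_inverse star_rep)

lemma rep_const: "\<forall>\<^sub>F i in \<U>. rep i (const c) = c"
  unfolding const_def by (rule rep_star)

lemma const_eq_iff [simp]: "const c = const d \<longleftrightarrow> c = d"
  by (simp add: const_def star_eq_iff)

lemma is_ring_hom_const: "is_ring_hom (const :: 'a::field \<Rightarrow> 'a ultrapower)"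
  by (rule is_ring_homI) (simp_all add: const_def star_add star_mult star_zero star_one)

instance ultrapower :: (field_char_0) field_char_0
proof
  have "(of_nat n :: 'a ultrapower) = const (of_nat n)" for n
    by (simp add: is_ring_hom_of_nat[OF is_ring_hom_const])
  then show "inj (of_nat :: nat \<Rightarrow> 'a ultrapower)" by (auto intro: injI)
qed

text \<open>Roots are chosen in the components. Algebraic closedness is required since conjugates
  over fields of nonstandard rationals are taken inside the ultrapower.\<close>

lemma ultrapower_poly_root:
  fixes p :: "'a::alg_closed_field ultrapower poly"
  assumes p: "degree p > 0" "lead_coeff p = 1"
  shows "\<exists>x. poly p x = 0"
proof -
  have "\<forall>\<^sub>F i in \<U>. rep i (1 :: 'a ultrapower) = 1" by (rule eventual_hom_1[OF eventual_hom_rep])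
  then have "\<forall>\<^sub>F i in \<U>. \<exists>x. poly (map_poly (rep i) p) x = 0"
  proof eventually_elim
    case (elim i)
    then have "degree (map_poly (rep i) p) = degree p" using p by (intro map_poly_degree_eq) simp
    then show ?case using p(1) alg_closed_imp_poly_has_root by metis
  qed
  moreover define g where "g i = (SOME x. poly (map_poly (rep i) p) x = 0)" for i
  ultimately have g: "\<forall>\<^sub>F i in \<U>. poly (map_poly (rep i) p) (g i) = 0"
    by (auto elim!: eventually_mono intro: someI_ex)
  have "\<forall>\<^sub>F i in \<U>. rep i (poly p (star g)) = rep i 0"
    using eventual_hom_poly[OF eventual_hom_rep, of p "star g"] rep_star[of g] g
    by eventually_elim simp
  then have "poly p (star g) = 0" by (simp add: ultra_eq_iff)
  then show ?thesis by blast
qed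

instance ultrapower :: (alg_closed_field) alg_closed_field
  by (rule alg_closedI) (rule ultrapower_poly_root)

text \<open>The ultrapower of \<open>L\<close> inside the ultrapower of the ambient field;
  \<open>internal \<rat>\<close> is the field of nonstandard rationals.\<close>

definition internal :: "'a::field set \<Rightarrow> 'a ultrapower set"
  where "internal L = {x. \<forall>\<^sub>F i in \<U>. rep i x \<in> L}"

lemma star_in_internal: "star f \<in> internal L \<longleftrightarrow> (\<forall>\<^sub>F i in \<U>. f i \<in> L)"
proof -
  have "(\<forall>\<^sub>F i in \<U>. rep i (star f) \<in> L) \<longleftrightarrow> (\<forall>\<^sub>F i in \<U>. f i \<in> L)"
    by (rule eventually_cong[OF rep_star[of f]]) simp
  then show ?thesis by (simp add: internal_def)
qed

lemma const_in_internal [simp]: "const c \<in> internal L \<longleftrightarrow> c \<in> L"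
  by (simp add: const_def star_in_internal)

lemma subfield_set_internal:
  assumes "subfield_set L" shows "subfield_set (internal L)"
proof -
  interpret L: subfield_set L by (rule assms)
  note h = eventual_hom_rep
  show ?thesis
  proof
    have "\<forall>\<^sub>F i in \<U>. rep i (1 :: 'a ultrapower) = 1" by (rule eventual_hom_1[OF h])
    then have "\<forall>\<^sub>F i in \<U>. rep i (1 :: 'a ultrapower) \<in> L"
      by eventually_elim (simp add: L.one_mem)
    then show "1 \<in> internal L" by (simp add: internal_def)
    fix x y :: "'a ultrapower" assume "x \<in> internal L" "y \<in> internal L"
    then have xy: "\<forall>\<^sub>F i in \<U>. rep i x \<in> L" "\<forall>\<^sub>F i in \<U>. rep i y \<in> L" by (simp_all add: internal_def)
    have "\<forall>\<^sub>F i in \<U>. rep i (x - y) \<in> L"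
      using eventual_hom_diff[OF h, of x y] xy by eventually_elim (simp add: L.diff_mem)
    then show "x - y \<in> internal L" by (simp add: internal_def)
    have "\<forall>\<^sub>F i in \<U>. rep i (x * y) \<in> L"
      using eventual_hom_mult[OF h, of x y] xy by eventually_elim (simp add: L.mult_mem)
    then show "x * y \<in> internal L" by (simp add: internal_def)
  next
    fix x :: "'a ultrapower" assume "x \<in> internal L"
    then have x: "\<forall>\<^sub>F i in \<U>. rep i x \<in> L" by (simp add: internal_def)
    have "\<forall>\<^sub>F i in \<U>. rep i (inverse x) \<in> L"
      using rep_inverse[of x] x by eventually_elim (simp add: L.inverse_mem)
    then show "inverse x \<in> internal L" by (simp add: internal_def)
  qed
qed

lemma rep_polys_over:
  assumes "p \<in> polys_over (internal L)" "0 \<in> L"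
  shows "\<forall>\<^sub>F i in \<U>. map_poly (rep i) p \<in> polys_over L"
proof -
  have "\<forall>\<^sub>F i in \<U>. \<forall>j\<in>{..degree p}. rep i (coeff p j) \<in> L"
    using assms by (intro eventually_ball_finite) (auto simp: polys_over_def internal_def)
  then show ?thesis
  proof eventually_elim
    case (elim i)
    show ?case unfolding polys_over_def
    proof (intro CollectI allI)
      fix j show "coeff (map_poly (rep i) p) j \<in> L"
        using elim assms(2) by (cases "j \<le> degree p") (auto simp: coeff_map_poly coeff_eq_0)
    qed
  qed
qed

text \<open>The common degree bound is essential. Without it the sequence would only define an
  internal polynomial of nonstandard degree.\<close>

lemma star_poly_exists:
  assumes "\<And>i. degree (P i) \<le> n"
  obtains p where "\<forall>\<^sub>F i in \<U>. map_poly (rep i) p = P i" "degree p \<le> n"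
proof
  define p where "p = (\<Sum>j\<le>n. monom (star (\<lambda>i. coeff (P i) j)) j)"
  have cp: "coeff p j = (if j \<le> n then star (\<lambda>i. coeff (P i) j) else 0)" for j
  proof -
    have "coeff p j = (\<Sum>k\<le>n. if k = j then star (\<lambda>i. coeff (P i) j) else 0)"
      unfolding p_def coeff_sum by (rule sum.cong) auto
    then show ?thesis by simp
  qed
  show "degree p \<le> n" by (rule degree_le) (simp add: cp)
  have "\<forall>\<^sub>F i in \<U>. \<forall>j\<in>{..n}. rep i (star (\<lambda>i. coeff (P i) j)) = coeff (P i) j"
    by (intro eventually_ball_finite) (auto intro: rep_star)
  then show "\<forall>\<^sub>F i in \<U>. map_poly (rep i) p = P i"
  proof eventually_elim
    case (elim i)
    show ?case
    proof (rule poly_eqI)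
      fix j show "coeff (map_poly (rep i) p) j = coeff (P i) j"
        using elim assms[of i] by (simp add: coeff_map_poly cp coeff_eq_0)
    qed
  qed
qed

lemma polys_over_internalI:
  assumes "\<forall>\<^sub>F i in \<U>. map_poly (rep i) p \<in> polys_over L"
  shows "p \<in> polys_over (internal L)"
  using assms by (auto simp: polys_over_def internal_def coeff_map_poly elim: eventually_mono)

text \<open>Splitting off X - y at a point of \<open>Y\<close> leaves a quotient of smaller degree
  whose values at the other points are again in \<open>F\<close>.\<close>

lemma values_imp_polys_over:
  assumes F: "subfield_set F" and Y: "infinite Y" "Y \<subseteq> F" "\<And>y. y \<in> Y \<Longrightarrow> poly P y \<in> F"
  shows "P \<in> polys_over F"
  using Y
proof (induction "degree P" arbitrary: P Y rule: less_induct)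
  case less
  interpret F: subfield_set F by (rule F)
  interpret P: subring_set "polys_over F" by (rule F.polys_over_subring)
  obtain y where y: "y \<in> Y" using less(2) by fastforce
  have c: "poly P y \<in> F" using less(4) y by blast
  show ?case
  proof (cases "degree P = 0")
    case True
    then obtain a where "P = [:a:]" by (rule degree_eq_zeroE)
    then show ?thesis using c by (simp add: F.pCons_over F.zero_over)
  next
    case False
    define Q where "Q = synthetic_div P y"
    have PQ: "P = [:- y, 1:] * Q + [:poly P y:]" unfolding Q_def by (simp only: synthetic_div_correct')
    have "Q \<in> polys_over F"
    proof (rule less(1)[of Q "Y - {y}"])
      show "degree Q < degree P" using False by (simp add: Q_def degree_synthetic_div)
      show "infinite (Y - {y})" "Y - {y} \<subseteq> F" using less(2,3) by auto
      fix x assume x: "x \<in> Y - {y}"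
      have "poly P x = (x - y) * poly Q x + poly P y"
        using arg_cong[OF PQ, of "\<lambda>p. poly p x"] by (simp add: algebra_simps)
      then have "poly Q x = (poly P x - poly P y) / (x - y)" using x by simp
      also have "\<dots> \<in> F" using x y less(3,4) by (intro F.divide_mem F.diff_mem) auto
      finally show "poly Q x \<in> F" .
    qed
    moreover have "[:- y, 1:] \<in> polys_over F" "[:poly P y:] \<in> polys_over F"
      using y less(3) c by (auto intro!: F.pCons_over F.zero_over F.uminus_mem F.one_mem)
    ultimately show ?thesis by (subst PQ) (intro P.add_mem P.mult_mem)
  qed
qed

text \<open>If the degree of \<open>P\<close> exceeded \<open>e\<close>, the top power of
  \<open>P\<close> would have larger degree than all other terms of the equation together.\<close>

lemma degree_root_monic_le:
  fixes H :: "'a::idom poly poly"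
  assumes "lead_coeff H = 1" "\<And>l. degree (coeff H l) \<le> e" "poly H P = 0"
  shows "degree P \<le> e"
proof (rule ccontr)
  assume "\<not> degree P \<le> e"
  then have m: "degree P > e" by simp
  define d where "d = degree H"
  have "d \<noteq> 0"
  proof
    assume "d = 0"
    then obtain c where "H = [:c:]" unfolding d_def by (rule degree_eq_zeroE)
    then show False using assms(1,3) by simp
  qed
  then obtain k where k: "d = Suc k" by (cases d) auto
  have "0 = (\<Sum>i<d. coeff H i * P ^ i) + P ^ d"
    using assms(1,3) by (simp add: poly_altdef d_def lessThan_Suc_atMost[symmetric])
  then have "P ^ d = - (\<Sum>i<d. coeff H i * P ^ i)" by (simp add: eq_neg_iff_add_eq_0 add.commute)
  then have "degree P * d = degree (\<Sum>i<d. coeff H i * P ^ i)"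
    using m by (metis degree_minus degree_power_eq degree_0 mult.commute not_less_zero)
  also have "\<dots> \<le> e + degree P * k"
  proof (rule degree_sum_le)
    fix i assume "i \<in> {..<d}"
    then have "degree P * i \<le> degree P * k" using k by simp
    then show "degree (coeff H i * P ^ i) \<le> e + degree P * k"
      using degree_mult_le[of "coeff H i" "P ^ i"] degree_power_le[of P i] assms(2)[of i] by linarith
  qed simp
  finally show False using m k by simp
qed

section \<open>Hilbert's theorem over the rationals and in the ultrapower\<close>

lemma rat_polys2_integral:
  assumes "H \<in> polys_over (polys_over (\<rat> :: 'a::field_char_0 set))"
  obtains D :: int and H' where "D \<noteq> 0" "map_poly2 of_int H' = smult [:of_int D:] H"
proof -
  interpret Q: subfield_set "\<rat> :: 'a set" by (rule subfield_set_Rats)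
  interpret PQ: subring_set "polys_over (\<rat> :: 'a set)" by (rule Q.polys_over_subring)
  have one: "\<exists>D::int. \<exists>p'. D \<noteq> 0 \<and> map_poly of_int p' = smult (of_int D) p"
    if "p \<in> polys_over (\<rat> :: 'a set)" for p
    using that
  proof (induction rule: Q.poly_over_induct)
    case zero
    show ?case by (intro exI[of _ 1] exI[of _ 0]) simp
  next
    case (pCons a p)
    obtain D p' where IH: "D \<noteq> (0::int)" "map_poly of_int p' = smult (of_int D) p" using pCons(3) by blast
    obtain m n where a: "a = of_int m / of_int n" "n > 0" using pCons(1) by (auto elim: Rats_cases')
    have "map_poly of_int (pCons (D * m) (smult n p')) = smult (of_int (D * n)) (pCons a p)"
      using a IH(2) by (simp add: map_poly_pCons map_poly_smult mult_ac)
    then show ?case using IH(1) a(2) by (intro exI[of _ "D * n"] exI[of _ "pCons (D * m) (smult n p')"]) auto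
  qed
  have "\<exists>D::int. \<exists>H'. D \<noteq> 0 \<and> map_poly2 of_int H' = smult [:of_int D:] H"
    using assms
  proof (induction rule: PQ.poly_over_induct)
    case zero
    show ?case by (intro exI[of _ 1] exI[of _ 0]) simp
  next
    case (pCons p H)
    obtain D H' where IH: "D \<noteq> (0::int)" "map_poly2 of_int H' = smult [:of_int D:] H" using pCons(3) by blast
    obtain n p' where p: "n \<noteq> (0::int)" "map_poly of_int p' = smult (of_int n) p" using one[OF pCons(1)] by blast
    have m: "map_poly2 of_int (smult [:n:] H') = smult [:of_int n:] (map_poly2 of_int H' :: 'a poly poly)"
      by (subst map_poly_smult)
        (simp_all add: is_ring_hom_mult[OF is_ring_hom_map_poly[OF is_ring_hom_of_int]] map_poly_pCons map_poly_smult)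
    have "map_poly2 of_int (pCons (smult D p') (smult [:n:] H')) = smult [:of_int (D * n):] (pCons p H)"
      using IH(2) p(2) by (simp add: map_poly_pCons m) (simp add: map_poly_smult mult_ac)
    then show ?case using IH(1) p(1) by (intro exI[of _ "D * n"] exI[of _ "pCons (smult D p') (smult [:n:] H')"]) auto
  qed
  then show ?thesis using that by blast
qed

definition separable_over_Rats :: "'a::field_char_0 poly poly \<Rightarrow> bool"
  where "separable_over_Rats G \<longleftrightarrow> G \<in> polys_over (polys_over \<rat>) \<and> degree G \<ge> 1 \<and>
    (\<exists>A\<in>polys_over (polys_over \<rat>). \<exists>B\<in>polys_over (polys_over \<rat>). \<exists>R. A * G + B * pderiv G = [:R:] \<and> R \<noteq> 0)"

lemma separable_over_Rats_integral:
  assumes "separable_over_Rats (G :: 'a::field_char_0 poly poly)"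
  obtains D :: int and G' where "D \<noteq> 0" "map_poly2 of_int G' = smult [:of_int D:] G" "separable_over_int G'"
proof -
  obtain A B R where c: "A \<in> polys_over (polys_over \<rat>)" "B \<in> polys_over (polys_over \<rat>)"
    "A * G + B * pderiv G = [:R:]" "R \<noteq> 0" and G: "G \<in> polys_over (polys_over \<rat>)" "degree G \<ge> 1"
    using assms by (auto simp: separable_over_Rats_def)
  obtain D :: int and G' where D: "D \<noteq> 0" "map_poly2 of_int G' = smult [:of_int D:] G"
    using rat_polys2_integral[OF G(1)] .
  obtain a :: int and A' where A: "a \<noteq> 0" "map_poly2 of_int A' = smult [:of_int a:] A"
    using rat_polys2_integral[OF c(1)] .
  obtain b :: int and B' where B: "b \<noteq> 0" "map_poly2 of_int B' = smult [:of_int b:] B"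
    using rat_polys2_integral[OF c(2)] .
  let ?I = "map_poly2 (of_int :: int \<Rightarrow> 'a)"
  note h2 = is_ring_hom_map_poly[OF is_ring_hom_map_poly[OF is_ring_hom_of_int[where ?'a='a]]]
  note h1 = is_ring_hom_map_poly[OF is_ring_hom_of_int[where ?'a='a]]
  have sc: "?I [:[:n:]:] = [:[:of_int n:]:]" for n by (simp add: map_poly_pCons)
  define N where "N = [:[:b:]:] * A' * G' + [:[:a:]:] * B' * pderiv G'"
  have "?I N = [:[:of_int b:]:] * ?I A' * ?I G' + [:[:of_int a:]:] * ?I B' * pderiv (?I G')"
    unfolding N_def is_ring_hom_add[OF h2] is_ring_hom_mult[OF h2] sc is_ring_hom_pderiv[OF h1] ..
  also have "\<dots> = smult [:of_int (a * b * D):] (A * G + B * pderiv G)"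
    unfolding A(2) B(2) D(2) by (simp add: pderiv_smult smult_add_right mult_ac)
  finally have N: "?I N = [:smult (of_int (a * b * D)) R:]" unfolding c(3) by simp
  then have "degree (?I N) = 0" by simp
  moreover have "degree (?I N) = degree N"
    by (rule degree_map_poly) (simp add: poly_eq_iff coeff_map_poly)
  ultimately obtain R' where R': "N = [:R':]" by (metis degree_eq_zeroE)
  have "R' \<noteq> 0"
  proof
    assume "R' = 0"
    then have "smult (of_int (a * b * D)) R = 0" using N R' by simp
    then show False using A(1) B(1) D(1) c(4) by simp
  qed
  moreover have "degree G' = degree (?I G')"
    by (rule degree_map_poly[symmetric]) (simp add: poly_eq_iff coeff_map_poly)
  then have "degree G' \<ge> 1" using G(2) D by simp
  moreover have "([:[:b:]:] * A') * G' + ([:[:a:]:] * B') * pderiv G' = [:R':]"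
    using R' by (simp only: N_def)
  ultimately have "separable_over_int G'" unfolding separable_over_int_def by blast
  then show ?thesis using that D by blast
qed

lemma map_poly2_of_rat_of_int:
  "map_poly2 of_rat (map_poly2 of_int G) = (map_poly2 of_int G :: 'a::field_char_0 poly poly)"
  by (simp add: poly_eq_iff coeff_map_poly)

lemma hilbert_irreducibility_Rats:
  fixes \<G> :: "'a::field_char_0 poly poly set"
  assumes fin: "finite \<G>" and sep: "\<And>G. G \<in> \<G> \<Longrightarrow> separable_over_Rats G" and E: "finite E"
  obtains t where "t \<in> \<int>" "t \<notin> E"
    "\<And>G z. G \<in> \<G> \<Longrightarrow> z \<in> \<rat> \<Longrightarrow> poly2 G t z = 0 \<Longrightarrow>
      \<exists>P\<in>polys_over \<rat>. poly P t = poly (lead_coeff G) t * z \<and>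
        (\<forall>x\<in>\<rat>. poly (lead_coeff G) x \<noteq> 0 \<longrightarrow> poly2 G x (poly P x / poly (lead_coeff G) x) = 0)"
proof -
  have "\<exists>D G'. D \<noteq> (0::int) \<and> map_poly2 of_int G' = smult [:of_int D:] G \<and> separable_over_int G'" if "G \<in> \<G>" for G
    using separable_over_Rats_integral[OF sep[OF that]] by metis
  then obtain D :: "'a poly poly \<Rightarrow> int" and I where I: "\<And>G. G \<in> \<G> \<Longrightarrow> D G \<noteq> 0"
    "\<And>G. G \<in> \<G> \<Longrightarrow> map_poly2 of_int (I G) = smult [:of_int (D G):] G"
    "\<And>G. G \<in> \<G> \<Longrightarrow> separable_over_int (I G)" by metis
  have E': "finite {n :: int. of_int n \<in> E}"
    using finite_vimageI[OF E, of "of_int :: int \<Rightarrow> 'a"] by (simp add: vimage_def inj_def)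
  show ?thesis
  proof (rule hilbert_irreducibility[of "I ` \<G>" "{n. of_int n \<in> E}"])
    fix t :: int
    assume t: "t \<notin> {n. of_int n \<in> E}"
      and hit: "\<And>G z. G \<in> I ` \<G> \<Longrightarrow> poly2 (map_poly2 of_int G) (of_int t) z = 0 \<Longrightarrow>
        \<exists>P :: rat poly. poly P (of_int t) = poly (map_poly of_int (lead_coeff G)) (of_int t) * z \<and>
        (\<forall>x. poly (map_poly of_int (lead_coeff G)) x \<noteq> 0 \<longrightarrow>
          poly2 (map_poly2 of_int G) x (poly P x / poly (map_poly of_int (lead_coeff G)) x) = 0)"
    show ?thesis
    proof (rule that[of "of_int t"])
      show "of_int t \<in> \<int>" "of_int t \<notin> E" using t by auto
      fix G :: "'a poly poly" and z :: 'a
      assume G: "G \<in> \<G>" and z: "z \<in> \<rat>" "poly2 G (of_int t) z = 0"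
      obtain z' :: rat where z': "z = of_rat z'" using z(1) by (auto elim: Rats_cases)
      define J where "J = map_poly2 (of_int :: int \<Rightarrow> rat) (I G)"
      define c where "c = (map_poly of_int (lead_coeff (I G)) :: rat poly)"
      have JG: "map_poly2 of_rat J = smult [:of_int (D G):] G"
        unfolding J_def map_poly2_of_rat_of_int using I(2)[OF G] .
      have ev: "of_rat (poly2 J x y) = of_int (D G) * poly2 G (of_rat x) (of_rat y)" for x y
        unfolding is_ring_hom_poly2[OF is_ring_hom_of_rat] JG by simp
      have "degree (I G) = degree (smult [:of_int (D G):] G)"
        unfolding I(2)[OF G, symmetric]
        by (rule degree_map_poly[symmetric]) (simp add: poly_eq_iff coeff_map_poly)
      then have dI: "degree (I G) = degree G" using I(1)[OF G] by simp
      have "coeff (map_poly2 of_rat J :: 'a poly poly) (degree G) = map_poly of_rat c"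
        by (simp add: J_def c_def coeff_map_poly dI)
      then have cG: "map_poly of_rat c = smult (of_int (D G)) (lead_coeff G)"
        unfolding JG coeff_smult by simp
      have evc: "of_rat (poly c x) = of_int (D G) * poly (lead_coeff G) (of_rat x)" for x
        unfolding is_ring_hom_poly[OF is_ring_hom_of_rat] cG by simp
      have "of_rat (poly2 J (of_int t) z') = (0 :: 'a)" unfolding ev using z(2) z' by simp
      then have "poly2 J (of_int t) z' = 0" by simp
      then obtain P :: "rat poly" where P: "poly P (of_int t) = poly c (of_int t) * z'"
        "\<And>x. poly c x \<noteq> 0 \<Longrightarrow> poly2 J x (poly P x / poly c x) = 0"
        using hit[of "I G" z'] G unfolding J_def c_def by blast
      define Q where "Q = smult (1 / of_int (D G)) (map_poly of_rat P :: 'a poly)"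
      have evQ: "poly Q (of_rat x) = of_rat (poly P x) / of_int (D G)" for x
        unfolding is_ring_hom_poly[OF is_ring_hom_of_rat] Q_def by simp
      have D0: "of_int (D G) \<noteq> (0 :: 'a)" using I(1)[OF G] by simp
      show "\<exists>P\<in>polys_over \<rat>. poly P (of_int t) = poly (lead_coeff G) (of_int t) * z \<and>
        (\<forall>x\<in>\<rat>. poly (lead_coeff G) x \<noteq> 0 \<longrightarrow> poly2 G x (poly P x / poly (lead_coeff G) x) = 0)"
      proof (intro bexI[of _ Q] conjI ballI impI)
        show "Q \<in> polys_over \<rat>" by (auto simp: Q_def polys_over_def coeff_map_poly)
        show "poly Q (of_int t) = poly (lead_coeff G) (of_int t) * z"
          using evQ[of "of_int t"] evc[of "of_int t"] D0 by (simp add: P(1) z' of_rat_mult)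
        fix x :: 'a assume x: "x \<in> \<rat>" "poly (lead_coeff G) x \<noteq> 0"
        then obtain x' where x': "x = of_rat x'" by (auto elim: Rats_cases)
        have "of_rat (poly c x') \<noteq> (0 :: 'a)" unfolding evc using x x' D0 by simp
        then have c0: "poly c x' \<noteq> 0" by simp
        have "of_rat (poly P x' / poly c x') = poly Q x / poly (lead_coeff G) x"
          unfolding of_rat_divide evc using evQ[of x'] D0 x' by simp
        then have "of_int (D G) * poly2 G x (poly Q x / poly (lead_coeff G) x) = of_rat (poly2 J x' (poly P x' / poly c x'))"
          unfolding ev x' by simp
        then show "poly2 G x (poly Q x / poly (lead_coeff G) x) = 0" using P(2)[OF c0] D0 by simp
      qed
    qed
  qed (use fin I(3) E' in auto)
qed

lemma countable_polys_over: "countable F \<Longrightarrow> countable (polys_over F)"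
proof -
  assume F: "countable F"
  have "polys_over F \<subseteq> Poly ` lists F"
  proof
    fix p assume p: "p \<in> polys_over F"
    have "coeffs p \<in> lists F" using p by (auto simp: polys_over_def coeffs_def split: if_splits)
    then show "p \<in> Poly ` lists F" by (intro image_eqI[of _ _ "coeffs p"]) auto
  qed
  then show ?thesis using F by (meson countable_image countable_lists countable_subset)
qed

lemma countable_adjoin: "countable F \<Longrightarrow> countable (adjoin F t)"
proof -
  assume F: "countable F"
  have "adjoin F t \<subseteq> (\<lambda>(p, q). poly p t / poly q t) ` (polys_over F \<times> polys_over F)"
    by (auto simp: adjoin_def)
  then show ?thesis using countable_polys_over[OF F] by (meson countable_SIGMA countable_image countable_subset)
qed

lemma clear_denominators:
  assumes F: "subfield_set F" and p: "p \<in> polys_over (adjoin F t)"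
  obtains d G where "d \<in> polys_over F" "poly d t \<noteq> 0" "G \<in> polys_over (polys_over F)"
    "\<And>j. poly (coeff G j) t = poly d t * coeff p j"
proof -
  interpret F: subfield_set F by (rule F)
  interpret PF: subring_set "polys_over F" by (rule F.polys_over_subring)
  interpret A: subfield_set "adjoin F t" by (rule F.subfield_set_adjoin)
  have "\<exists>d\<in>polys_over F. \<exists>G\<in>polys_over (polys_over F). poly d t \<noteq> 0 \<and>
    (\<forall>j. poly (coeff G j) t = poly d t * coeff p j)" using p
  proof (induction rule: A.poly_over_induct)
    case zero
    show ?case by (intro bexI[of _ 1] bexI[of _ 0]) (auto intro: PF.one_mem PF.zero_over)
  next
    case (pCons a p)
    obtain d G where IH: "d \<in> polys_over F" "G \<in> polys_over (polys_over F)" "poly d t \<noteq> 0"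
      "\<And>j. poly (coeff G j) t = poly d t * coeff p j" using pCons(3) by blast
    obtain u v where a: "a = poly u t / poly v t" "u \<in> polys_over F" "v \<in> polys_over F" "poly v t \<noteq> 0"
      using pCons(1) by (auto simp: adjoin_def)
    have "poly (coeff (pCons (u * d) (smult v G)) j) t = poly (v * d) t * coeff (pCons a p) j" for j
      using a IH by (auto simp: coeff_pCons split: nat.split)
    moreover have "pCons (u * d) (smult v G) \<in> polys_over (polys_over F)"
      using a IH by (intro PF.pCons_over PF.mult_mem PF.smult_over)
    moreover have "v * d \<in> polys_over F" "poly (v * d) t \<noteq> 0" using a IH by (auto intro: PF.mult_mem)
    ultimately show ?case by blast
  qed
  then show ?thesis using that by blast
qed

text \<open>Makes the degree of a branch depend only on degrees of \<open>G\<close>, so that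
  branches found in the components glue. In \<open>monicize G\<close> a coefficient is at most
  \<open>degree G\<close> powers of the leading coefficient times one coefficient of
  \<open>G\<close>, whence the factor \<open>degree G + 1\<close>.\<close>

lemma degree_branch_le:
  fixes G :: "'a::field_char_0 poly poly"
  assumes G: "degree G \<ge> 1" "\<And>l. degree (coeff G l) \<le> e"
    and P: "\<And>x. x \<in> \<rat> \<Longrightarrow> poly (lead_coeff G) x \<noteq> 0 \<Longrightarrow> poly2 G x (poly P x / poly (lead_coeff G) x) = 0"
  shows "degree P \<le> (degree G + 1) * e"
proof (rule degree_root_monic_le[OF lead_coeff_monicize])
  define c where "c = lead_coeff G"
  have "c \<noteq> 0" using G(1) by (auto simp: c_def)
  then have fin: "finite {x. poly c x = 0}" by (rule poly_roots_finite)
  have "poly (poly (monicize G) P) x = 0" if x: "x \<in> \<rat>" "poly c x \<noteq> 0" for x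
  proof -
    have "poly (poly (monicize G) P) x = poly2 (monicize G) x (poly c x * (poly P x / poly c x))"
      using poly_poly_eq_poly2[of "monicize G" P x] x by simp
    also have "\<dots> = 0" unfolding c_def poly2_monicize[OF G(1)] using P x by (simp add: c_def)
    finally show ?thesis .
  qed
  then have "\<rat> \<subseteq> {x. poly c x = 0} \<union> {x. poly (poly (monicize G) P) x = 0}" by blast
  moreover have "infinite (\<rat> :: 'a set)" by (rule Rats_infinite)
  ultimately have "infinite {x. poly (poly (monicize G) P) x = 0}" using fin by (meson finite_UnI finite_subset)
  then show "poly (monicize G) P = 0" using poly_roots_finite by blast
  show "degree (coeff (monicize G) l) \<le> (degree G + 1) * e" for l
  proof -
    have "degree (c ^ (degree G - 1 - l) * coeff G l) \<le> (degree G + 1) * e"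
    proof -
      have "degree (c ^ (degree G - 1 - l)) \<le> e * (degree G - 1 - l)"
        using degree_power_le[of c "degree G - 1 - l"] G(2)[of "degree G"]
        by (metis c_def mult_le_mono1 order_trans)
      also have "\<dots> \<le> e * degree G" by simp
      finally show ?thesis using degree_mult_le[of "c ^ (degree G - 1 - l)" "coeff G l"] G(2)[of l]
        by (simp add: mult.commute[of _ e])
    qed
    then show ?thesis by (simp add: coeff_monicize c_def)
  qed
qed

lemma rep_nonzero:
  assumes "x \<noteq> 0" shows "\<forall>\<^sub>F i in \<U>. rep i x \<noteq> 0"
  using assms ultra_eq_iff[of x 0] ultra_frequently[of "\<lambda>i. rep i x = 0"] by simp

lemma map_rep_nonzero:
  assumes "p \<noteq> 0" shows "\<forall>\<^sub>F i in \<U>. map_poly (rep i) p \<noteq> 0"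
proof -
  have "\<forall>\<^sub>F i in \<U>. rep i (lead_coeff p) \<noteq> 0" using assms by (intro rep_nonzero) simp
  then show ?thesis
    by eventually_elim (metis coeff_0 coeff_map_poly rep_0)
qed

lemma rep_polys2_over:
  fixes G :: "'a::field ultrapower poly poly"
  assumes "G \<in> polys_over (polys_over (internal L))" "0 \<in> L"
  shows "\<forall>\<^sub>F i in \<U>. map_poly2 (rep i) G \<in> polys_over (polys_over L)"
proof -
  have "\<forall>\<^sub>F i in \<U>. \<forall>j\<in>{..degree G}. map_poly (rep i) (coeff G j) \<in> polys_over L"
    using assms by (intro eventually_ball_finite ballI rep_polys_over polys_overD) auto
  then show ?thesis
  proof eventually_elim
    case (elim i)
    show ?case unfolding polys_over_def[of "polys_over L"]
    proof (intro CollectI allI)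
      fix j show "coeff (map_poly2 (rep i) G) j \<in> polys_over L"
        using elim assms(2) by (cases "j \<le> degree G") (auto simp: coeff_map_poly coeff_eq_0 polys_over_def)
    qed
  qed
qed

text \<open>Since \<open>M\<close> is countable, there are only countably many polynomials to specialise. A diagonal
  choice of specialisations \<open>t\<^sub>i\<close>, each good for the first \<open>i\<close> of them, is good for all of them in the
  ultrapower.\<close>

theorem hilbert_extension:
  fixes M :: "'a::field_char_0 ultrapower set"
  assumes M: "subfield_set M" "countable M" "M \<subseteq> internal \<rat>" "relatively_closed M (internal \<rat>)"
  obtains t where "t \<in> internal \<int>" "\<not> algebraic_over M t" "relatively_closed (adjoin M t) (internal \<rat>)"
proof -
  interpret M: subfield_set M by (rule M)
  interpret PM: subring_set "polys_over M" by (rule M.polys_over_subring)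
  interpret IQ: subfield_set "internal (\<rat> :: 'a set)" by (rule subfield_set_internal[OF subfield_set_Rats])
  define g where "g = from_nat_into (polys_over (polys_over M))"
  have "range g = polys_over (polys_over M)" unfolding g_def
    by (rule range_from_nat_into) (use PM.zero_over countable_polys_over[OF countable_polys_over[OF M(2)]] in auto)
  then have g: "\<exists>k. G = g k" if "G \<in> polys_over (polys_over M)" for G using that by (metis rangeE)
  define \<rho> where "\<rho> i = map_poly2 (rep i :: 'a ultrapower \<Rightarrow> 'a)" for i
  note h0 = eventual_hom_rep[where ?'a = 'a]
  note h1 = eventual_hom_map_poly[OF h0]
  note h2 = eventual_hom_map_poly[OF h1, folded \<rho>_def]
  define good where "good G t \<longleftrightarrow> (\<forall>z\<in>\<rat>. poly2 G t z = 0 \<longrightarrow>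
      (\<exists>P\<in>polys_over \<rat>. poly P t = poly (lead_coeff G) t * z \<and>
        (\<forall>x\<in>\<rat>. poly (lead_coeff G) x \<noteq> 0 \<longrightarrow> poly2 G x (poly P x / poly (lead_coeff G) x) = 0)))"
    for G and t :: 'a
  \<comment> \<open>Avoiding the roots of all coefficients makes \<open>t\<close> transcendental: a
    polynomial \<open>p\<close> over \<open>M\<close> occurs in the enumeration as the constant
    polynomial \<open>[:p:]\<close>.\<close>
  define Exc where "Exc i = (\<Union>k\<le>i. \<Union>j\<le>degree (\<rho> i (g k)).
      if coeff (\<rho> i (g k)) j = 0 then {} else {x. poly (coeff (\<rho> i (g k)) j) x = 0})" for i
  have "\<exists>t. t \<in> \<int> \<and> t \<notin> Exc i \<and> (\<forall>k\<le>i. separable_over_Rats (\<rho> i (g k)) \<longrightarrow> good (\<rho> i (g k)) t)" for i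
  proof -
    define \<G> where "\<G> = {G \<in> (\<lambda>k. \<rho> i (g k)) ` {..i}. separable_over_Rats G}"
    have "finite (Exc i)" unfolding Exc_def by (auto simp: poly_roots_finite)
    moreover have "finite \<G>" "\<And>G. G \<in> \<G> \<Longrightarrow> separable_over_Rats G" by (auto simp: \<G>_def)
    ultimately obtain t where "t \<in> \<int>" "t \<notin> Exc i" "\<And>G. G \<in> \<G> \<Longrightarrow> good G t"
      using hilbert_irreducibility_Rats[of \<G> "Exc i"] unfolding good_def by metis
    then show ?thesis by (intro exI[of _ t]) (auto simp: \<G>_def)
  qed
  then obtain tt where tt: "\<And>i. tt i \<in> \<int>" "\<And>i. tt i \<notin> Exc i"
    "\<And>i k. k \<le> i \<Longrightarrow> separable_over_Rats (\<rho> i (g k)) \<Longrightarrow> good (\<rho> i (g k)) (tt i)" by metis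
  define t where "t = star tt"
  have ev_t: "\<forall>\<^sub>F i in \<U>. rep i t = tt i" unfolding t_def by (rule rep_star)
  have transc: "poly p t \<noteq> 0" if p: "p \<in> polys_over M" "p \<noteq> 0" for p
  proof -
    have "[:p:] \<in> polys_over (polys_over M)" by (intro PM.pCons_over PM.zero_over p)
    then obtain k where k: "[:p:] = g k" using g by blast
    have "\<forall>\<^sub>F i in \<U>. rep i (poly p t) \<noteq> 0"
      using ultra_large[of k] map_rep_nonzero[OF p(2)] eventual_hom_poly[OF h0, of p t] ev_t
    proof eventually_elim
      case (elim i)
      have \<rho>: "\<rho> i (g k) = [:map_poly (rep i) p:]" by (simp add: \<rho>_def k[symmetric] map_poly_pCons)
      have "poly (map_poly (rep i) p) (tt i) \<noteq> 0"
      proof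
        assume "poly (map_poly (rep i) p) (tt i) = 0"
        then have "tt i \<in> Exc i" unfolding Exc_def
          using elim(1,2) \<rho> by (intro UN_I[of k] UN_I[of 0]) auto
        then show False using tt(2) by blast
      qed
      then show ?case using elim by simp
    qed
    then show ?thesis using rep_0 ultra_ex by fastforce
  qed
  have alg: "z \<in> adjoin M t" if z: "z \<in> internal \<rat>" "algebraic_over (adjoin M t) z" for z
  proof -
    define \<phi> where "\<phi> G = poly2 G t z" for G
    have \<phi>: "is_ring_hom \<phi>" by (rule is_ring_homI) (auto simp: \<phi>_def)
    have "\<exists>G. G \<in> polys_over (polys_over M) \<and> G \<noteq> 0 \<and> \<phi> G = 0"
    proof -
      obtain p where p: "p \<in> polys_over (adjoin M t)" "p \<noteq> 0" "poly p z = 0"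
        using z(2) by (auto simp: algebraic_over_def)
      obtain d G where G: "d \<in> polys_over M" "poly d t \<noteq> 0" "G \<in> polys_over (polys_over M)"
        "\<And>j. poly (coeff G j) t = poly d t * coeff p j"
        using clear_denominators[OF M(1) p(1)] by blast
      have "map_poly (\<lambda>c. poly c t) G = smult (poly d t) p"
        by (rule poly_eqI) (simp add: coeff_map_poly G(4))
      then have "\<phi> G = 0" unfolding \<phi>_def poly2_eq_poly_map using p(3) by simp
      moreover have "G \<noteq> 0" using G(2) G(4)[of "degree p"] p(2) by auto
      ultimately show ?thesis using G(3) by blast
    qed
    then obtain G0 where "G0 \<in> polys_over (polys_over M) \<and> G0 \<noteq> 0 \<and> \<phi> G0 = 0" by blast
    \<comment> \<open>Least degree in the second variable keeps the derivative from vanishing at (t,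
      z), so \<open>poly_bezout_min\<close> delivers a separability certificate. The certificate
      carries over to almost all components.\<close>
    from ex_has_least_nat[of "\<lambda>G. G \<in> polys_over (polys_over M) \<and> G \<noteq> 0 \<and> \<phi> G = 0", OF this, of degree]
    obtain G where G: "G \<in> polys_over (polys_over M)" "G \<noteq> 0" "\<phi> G = 0"
      and Gmin: "\<And>H. H \<in> polys_over (polys_over M) \<Longrightarrow> H \<noteq> 0 \<Longrightarrow> \<phi> H = 0 \<Longrightarrow> degree G \<le> degree H" by blast
    have dG: "degree G \<ge> 1"
    proof (rule ccontr)
      assume "\<not> degree G \<ge> 1"
      then have "degree G = 0" by simp
      then obtain c where c: "G = [:c:]" by (rule degree_eq_zeroE)
      then have "c \<in> polys_over M" using polys_overD[OF G(1), of 0] by simp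
      then show False using transc[of c] G(2,3) by (simp add: c \<phi>_def)
    qed
    have pd: "pderiv G \<in> polys_over (polys_over M)" by (rule PM.pderiv_over[OF G(1)])
    have "\<phi> (pderiv G) \<noteq> 0"
    proof
      assume "\<phi> (pderiv G) = 0"
      moreover have "pderiv G \<noteq> 0" using dG by (simp add: pderiv_eq_0_iff)
      ultimately show False using Gmin[OF pd] dG by (simp add: degree_pderiv)
    qed
    from PM.poly_bezout_min[OF \<phi> _ G Gmin pd this] transc
    obtain A B R where AB: "A \<in> polys_over (polys_over M)" "B \<in> polys_over (polys_over M)"
      "R \<in> polys_over M" "R \<noteq> 0" "A * G + B * pderiv G = [:R:]" by (auto simp: \<phi>_def)
    obtain k where k: "G = g k" using g[OF G(1)] by blast
    define c where "c = lead_coeff G"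
    have c0: "c \<noteq> 0" "c \<in> polys_over M" using G(1,2) by (auto simp: c_def polys_overD)
    define e where "e = (\<Sum>l\<le>degree G. degree (coeff G l))"
    have e: "degree (coeff G l) \<le> e" for l
    proof (cases "l \<le> degree G")
      case True
      then show ?thesis unfolding e_def by (intro member_le_sum) auto
    qed (simp add: coeff_eq_0)
    have PMI: "polys_over (polys_over M) \<subseteq> polys_over (polys_over (internal \<rat>))"
      by (intro polys_over_mono M(3))
    have ev_over: "\<forall>\<^sub>F i in \<U>. \<rho> i H \<in> polys_over (polys_over \<rat>)" if "H \<in> polys_over (polys_over M)" for H
      unfolding \<rho>_def using that PMI by (intro rep_polys2_over) auto
    have ev_deg: "\<forall>\<^sub>F i in \<U>. degree (\<rho> i G) = degree G"
      using map_rep_nonzero[OF c0(1)]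
      by eventually_elim (auto simp: \<rho>_def c_def intro: map_poly_degree_eq)
    have ev_cert: "\<forall>\<^sub>F i in \<U>. \<rho> i A * \<rho> i G + \<rho> i B * pderiv (\<rho> i G) = [:map_poly (rep i) R:]"
      using eventual_hom_add[OF h2, of "A * G" "B * pderiv G"] eventual_hom_mult[OF h2, of A G]
        eventual_hom_mult[OF h2, of B "pderiv G"] eventual_hom_pderiv[OF h1, of G]
      unfolding AB(5) by eventually_elim (simp add: \<rho>_def map_poly_pCons)
    have ev_sep: "\<forall>\<^sub>F i in \<U>. separable_over_Rats (\<rho> i G)"
      using ev_over[OF G(1)] ev_over[OF AB(1)] ev_over[OF AB(2)] ev_deg ev_cert map_rep_nonzero[OF AB(4)]
      by eventually_elim (use dG in \<open>auto simp: separable_over_Rats_def\<close>)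
    have ev_z: "\<forall>\<^sub>F i in \<U>. rep i z \<in> \<rat>" using z(1) by (simp add: internal_def)
    have ev_root: "\<forall>\<^sub>F i in \<U>. poly2 (\<rho> i G) (tt i) (rep i z) = 0"
      using eventual_hom_poly2[OF h0, of G z t] ev_t
      unfolding G(3)[unfolded \<phi>_def] by eventually_elim (simp add: \<rho>_def)
    define cond where "cond i P \<longleftrightarrow> P \<in> polys_over \<rat> \<and> poly P (tt i) = poly (map_poly (rep i) c) (tt i) * rep i z \<and>
        (\<forall>x\<in>\<rat>. poly (map_poly (rep i) c) x \<noteq> 0 \<longrightarrow> poly2 (\<rho> i G) x (poly P x / poly (map_poly (rep i) c) x) = 0) \<and>
        degree P \<le> (degree G + 1) * e" for i P
    have ev_cond: "\<forall>\<^sub>F i in \<U>. \<exists>P. cond i P"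
      using ev_sep ev_z ev_root ultra_large[of k] ev_deg
    proof eventually_elim
      case (elim i)
      have lc: "lead_coeff (\<rho> i G) = map_poly (rep i) c" using elim(5) by (simp add: \<rho>_def c_def coeff_map_poly)
      have "good (\<rho> i G) (tt i)" using tt(3)[OF elim(4)] elim(1) k by simp
      then obtain P where P: "P \<in> polys_over \<rat>" "poly P (tt i) = poly (map_poly (rep i) c) (tt i) * rep i z"
        "\<And>x. x \<in> \<rat> \<Longrightarrow> poly (map_poly (rep i) c) x \<noteq> 0 \<Longrightarrow> poly2 (\<rho> i G) x (poly P x / poly (map_poly (rep i) c) x) = 0"
        unfolding good_def lc using elim(2,3) by blast
      have "degree (coeff (\<rho> i G) l) \<le> e" for l
        using e[of l] map_poly_degree_leq[of "rep i" "coeff G l"] by (simp add: \<rho>_def coeff_map_poly)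
      then have "degree P \<le> (degree (\<rho> i G) + 1) * e"
        by (rule degree_branch_le[rotated], unfold lc) (use P(3) dG elim(5) in auto)
      then show ?case using P elim(5) unfolding cond_def by auto
    qed
    \<comment> \<open>The default 0 keeps the degree bound valid at every index, as gluing
      requires.\<close>
    define Pp where "Pp i = (if \<exists>P. cond i P then SOME P. cond i P else 0)" for i
    have Pp: "cond i (Pp i)" if "\<exists>P. cond i P" for i using someI_ex[OF that] that by (simp add: Pp_def)
    have ev_P: "\<forall>\<^sub>F i in \<U>. cond i (Pp i)" by (rule eventually_mono[OF ev_cond Pp])
    have "degree (Pp i) \<le> (degree G + 1) * e" for i
      using Pp[of i] by (cases "\<exists>P. cond i P") (auto simp: cond_def Pp_def)
    then obtain p where p: "\<forall>\<^sub>F i in \<U>. map_poly (rep i) p = Pp i" using star_poly_exists by metis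
    have pI: "p \<in> polys_over (internal \<rat>)"
    proof (rule polys_over_internalI)
      show "\<forall>\<^sub>F i in \<U>. map_poly (rep i) p \<in> polys_over \<rat>"
        using p ev_P by eventually_elim (simp add: cond_def)
    qed
    have cI: "c \<in> polys_over (internal \<rat>)" using c0(2) polys_over_mono[OF M(3)] by blast
    have "\<forall>\<^sub>F i in \<U>. rep i (poly p t) = rep i (poly c t * z)"
      using eventual_hom_poly[OF h0, of p t] eventual_hom_mult[OF h0, of "poly c t" z]
        eventual_hom_poly[OF h0, of c t] p ev_P ev_t
      by eventually_elim (simp add: cond_def)
    then have pt: "poly p t = poly c t * z" by (simp add: ultra_eq_iff)
    \<comment> \<open>The quotient \<open>y\<close> is a nonstandard rational and a root of the
      polynomial over \<open>M\<close> obtained from \<open>G\<close> at \<open>m\<close>. Relative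
      closedness of \<open>M\<close> puts it into \<open>M\<close>, so \<open>p\<close> has
      infinitely many values in \<open>M\<close>.\<close>
    have val: "poly p (of_nat m) \<in> M" if m: "poly c (of_nat m) \<noteq> 0" for m
    proof -
      define y where "y = poly p (of_nat m) / poly c (of_nat m)"
      have yI: "y \<in> internal \<rat>" unfolding y_def by (intro IQ.divide_mem IQ.poly_mem pI cI IQ.of_nat_mem)
      have "\<forall>\<^sub>F i in \<U>. rep i (poly2 G (of_nat m) y) = rep i 0"
        using eventual_hom_poly2[OF h0, of G y "of_nat m"] eventual_hom_of_nat[OF h0, of m]
          eventual_hom_mult[OF h0, of "poly p (of_nat m)" "inverse (poly c (of_nat m))"]
          rep_inverse[of "poly c (of_nat m)"] eventual_hom_poly[OF h0, of c "of_nat m"]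
          eventual_hom_poly[OF h0, of p "of_nat m"] rep_nonzero[OF m] p ev_P
      proof eventually_elim
        case (elim i)
        have "rep i y = poly (Pp i) (of_nat m) / poly (map_poly (rep i) c) (of_nat m)"
          using elim by (simp add: y_def divide_inverse)
        then show ?case using elim unfolding cond_def by (simp add: \<rho>_def)
      qed
      then have root: "poly2 G (of_nat m) y = 0" by (simp add: ultra_eq_iff)
      define q where "q = map_poly (\<lambda>c. poly c (of_nat m)) G"
      have cq: "coeff q j = poly (coeff G j) (of_nat m)" for j by (simp add: q_def coeff_map_poly)
      have "q \<in> polys_over M" using G(1) by (auto simp: polys_over_def[of M] cq intro!: M.poly_mem M.of_nat_mem polys_overD)
      moreover have "q \<noteq> 0" using m cq[of "degree G"] by (auto simp: c_def)
      moreover have "poly q y = 0" using root by (simp add: q_def poly2_eq_poly_map)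
      ultimately have "algebraic_over M y" by (auto simp: algebraic_over_def)
      then have "y \<in> M" using M(4) yI by (simp add: relatively_closed_def)
      moreover have "poly p (of_nat m) = y * poly c (of_nat m)" using m by (simp add: y_def)
      ultimately show ?thesis using c0(2) by (simp add: M.mult_mem M.poly_mem M.of_nat_mem)
    qed
    have "p \<in> polys_over M"
    proof (rule values_imp_polys_over[OF M(1)])
      have "infinite (range (of_nat :: nat \<Rightarrow> 'a ultrapower))"
        using infinite_UNIV_nat inj_of_nat finite_imageD by blast
      then show "infinite (range (of_nat :: nat \<Rightarrow> 'a ultrapower) - {x. poly c x = 0})"
        using poly_roots_finite[OF c0(1)] by (rule Diff_infinite_finite[rotated])
    qed (use val M.of_nat_mem in auto)
    moreover have "z = poly p t / poly c t" using pt transc[OF c0(2,1)] by simp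
    ultimately show ?thesis unfolding adjoin_def using c0(2) transc[OF c0(2,1)] by blast
  qed
  show ?thesis
  proof (rule that[of t])
    show "t \<in> internal \<int>" unfolding t_def star_in_internal using tt(1) by simp
    show "\<not> algebraic_over M t" using transc by (auto simp: algebraic_over_def)
    show "relatively_closed (adjoin M t) (internal \<rat>)" using alg by (simp add: relatively_closed_def)
  qed
qed

section \<open>Specialisation of solutions\<close>

lemma (in field_hom_on) subfield_set_preimage:
  assumes "subfield_set A"
  shows "subfield_set {x \<in> D. \<sigma> x \<in> A}"
proof -
  interpret A: subfield_set A by (rule assms)
  show ?thesis
    by unfold_locales
      (auto simp: D.one_mem hom_one A.one_mem D.diff_mem hom_diff A.diff_mem D.mult_mem hom_mult A.mult_mem
        D.inverse_mem hom_inverse A.inverse_mem)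
qed

text \<open>The coordinates of a solution are generators of \<open>E\<close>. Their images are algebraic over \<open>M\<close>, so that \<open>\<sigma> ` E\<close> is linearly
  disjoint from the internal rationals over \<open>M\<close>. The constants belong to \<open>D\<close> to keep track of the elements of \<open>B\<close>
  outside \<open>L\<close>.\<close>

definition specialization ::
  "'a::field_char_0 ultrapower set \<Rightarrow> 'a ultrapower set \<Rightarrow> ('a ultrapower \<Rightarrow> 'a ultrapower) \<Rightarrow> 'a ultrapower set \<Rightarrow> bool"
  where "specialization D E \<sigma> M \<longleftrightarrow>
    field_hom_on D \<sigma> \<and> range const \<subseteq> D \<and> (\<forall>c. \<sigma> (const c) = const c) \<and>
    subfield_set E \<and> E \<subseteq> D \<and>
    subfield_set M \<and> countable M \<and> M \<subseteq> internal \<rat> \<and> relatively_closed M (internal \<rat>) \<and>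
    M \<subseteq> \<sigma> ` E \<and> (\<forall>x\<in>D. algebraic_over M (\<sigma> x))"

text \<open>For \<open>u\<close> algebraic over \<open>D\<close> any extension of \<sigma> will do
  and \<open>M\<close> is kept. A transcendental \<open>u\<close> is sent to a fresh Hilbert element
  shifted by the image of \<open>s\<close>, and \<open>M\<close> grows by that element.\<close>

lemma specialization_extend:
  fixes u s :: "'a::{alg_closed_field, field_char_0} ultrapower"
  assumes sp: "specialization D E \<sigma> M" and s: "s \<in> E"
  obtains D' \<sigma>' M' where "specialization D' (adjoin E u) \<sigma>' M'" "D \<subseteq> D'" "\<And>x. x \<in> D \<Longrightarrow> \<sigma>' x = \<sigma> x"
    "\<not> algebraic_over D u \<Longrightarrow> \<sigma>' u - \<sigma> s \<in> internal \<int>"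
proof -
  have hom: "field_hom_on D \<sigma>" and E: "subfield_set E" "E \<subseteq> D" and M: "subfield_set M" "countable M" "M \<subseteq> internal \<rat>"
    "relatively_closed M (internal \<rat>)" "M \<subseteq> \<sigma> ` E" and c: "range const \<subseteq> D" "\<And>c. \<sigma> (const c) = const c"
    and alg: "\<And>x. x \<in> D \<Longrightarrow> algebraic_over M (\<sigma> x)"
    using sp by (auto simp: specialization_def)
  interpret h: field_hom_on D \<sigma> by (rule hom)
  interpret E: subfield_set E by (rule E)
  interpret M: subfield_set M by (rule M)
  have sD: "s \<in> D" using s E by blast
  have E': "subfield_set (adjoin E u)" "adjoin E u \<subseteq> adjoin D u"
    using E.subfield_set_adjoin E.adjoin_mono[OF E(2) h.D.subfield_set_axioms] by auto
  have DD: "D \<subseteq> adjoin D u" and uD: "u \<in> adjoin D u" by (rule h.D.subset_adjoin, rule h.D.mem_adjoin)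
  show ?thesis
  proof (cases "algebraic_over D u")
    case True
    obtain \<tau> where \<tau>: "field_hom_on (adjoin D u) \<tau>" "\<And>x. x \<in> D \<Longrightarrow> \<tau> x = \<sigma> x"
      using extend_algebraic[OF hom True] by blast
    interpret t: field_hom_on "adjoin D u" \<tau> by (rule \<tau>(1))
    have "\<tau> ` D = \<sigma> ` D" using \<tau>(2) by (auto simp: image_iff)
    then have "algebraic_over (\<sigma> ` D) (\<tau> u)" using hom_image_algebraic[OF \<tau>(1) uD DD True] by simp
    then have u: "algebraic_over M (\<tau> u)" by (rule algebraic_over_trans[OF M(1)]) (use alg in auto)
    have "adjoin D u \<subseteq> {x \<in> adjoin D u. \<tau> x \<in> {y. algebraic_over M y}}"
      by (rule h.D.adjoin_subset[OF t.subfield_set_preimage[OF subfield_set_algebraics[OF M(1)]]])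
        (use DD uD u alg \<tau>(2) in auto)
    moreover have "M \<subseteq> \<tau> ` adjoin E u"
    proof
      fix x assume "x \<in> M"
      then obtain y where "y \<in> E" "x = \<sigma> y" using M(5) by blast
      then show "x \<in> \<tau> ` adjoin E u" using \<tau>(2) E(2) E.subset_adjoin by (intro image_eqI[of _ _ y]) auto
    qed
    moreover have "\<tau> (const a) = const a" for a using \<tau>(2)[of "const a"] c by auto
    ultimately have "specialization (adjoin D u) (adjoin E u) \<tau> M"
      unfolding specialization_def using \<tau> E' M c DD by auto
    then show ?thesis using that[of "adjoin D u" \<tau> M] DD \<tau>(2) True by blast
  next
    case False
    obtain t where t: "t \<in> internal \<int>" "\<not> algebraic_over M t" "relatively_closed (adjoin M t) (internal \<rat>)"
      using hilbert_extension[OF M(1-4)] by blast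
    define M' where "M' = adjoin M t"
    define u' where "u' = t + \<sigma> s"
    have M': "subfield_set M'" "M \<subseteq> M'" "t \<in> M'"
      unfolding M'_def using M.subfield_set_adjoin M.subset_adjoin M.mem_adjoin by auto
    interpret A: subfield_set "{x. algebraic_over M x}" by (rule subfield_set_algebraics[OF M(1)])
    have "\<not> algebraic_over (\<sigma> ` D) u'"
    proof
      assume "algebraic_over (\<sigma> ` D) u'"
      then have "algebraic_over M u'" by (rule algebraic_over_trans[OF M(1)]) (use alg in auto)
      then have "u' - \<sigma> s \<in> {x. algebraic_over M x}" using alg[OF sD] by (intro A.diff_mem) auto
      then show False using t(2) by (simp add: u'_def)
    qed
    then obtain \<tau> where \<tau>: "field_hom_on (adjoin D u) \<tau>" "\<And>x. x \<in> D \<Longrightarrow> \<tau> x = \<sigma> x" "\<tau> u = u'"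
      using h.extend_transcendental[OF False] by blast
    interpret t: field_hom_on "adjoin D u" \<tau> by (rule \<tau>(1))
    interpret A': subfield_set "{x. algebraic_over M' x}" by (rule subfield_set_algebraics[OF M'(1)])
    have alg': "algebraic_over M' (\<sigma> x)" if "x \<in> D" for x
      by (rule algebraic_over_mono[OF M'(2) alg[OF that]])
    have "u' \<in> {x. algebraic_over M' x}" unfolding u'_def
      using alg'[OF sD] subfield_set.algebraic_over_mem[OF M'(1,3)] by (intro A'.add_mem) auto
    then have "adjoin D u \<subseteq> {x \<in> adjoin D u. \<tau> x \<in> {y. algebraic_over M' y}}"
      by (intro h.D.adjoin_subset[OF t.subfield_set_preimage[OF subfield_set_algebraics[OF M'(1)]]])
        (use DD uD alg' \<tau>(2,3) in auto)
    moreover have "M' \<subseteq> \<tau> ` adjoin E u" unfolding M'_def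
    proof (rule M.adjoin_subset[OF t.subfield_set_image[OF E'(2,1)]])
      show "M \<subseteq> \<tau> ` adjoin E u"
      proof
        fix x assume "x \<in> M"
        then obtain y where "y \<in> E" "x = \<sigma> y" using M(5) by blast
        then show "x \<in> \<tau> ` adjoin E u" using \<tau>(2) E(2) E.subset_adjoin by (intro image_eqI[of _ _ y]) auto
      qed
      \<comment> \<open>Here \<open>s \<in> E\<close> is used: the new element \<open>t\<close> is
        the image of \<open>u - s\<close>, so the larger \<open>M'\<close> stays inside the image of
        the larger \<open>E\<close>.\<close>
      have "u - s \<in> adjoin E u"
        using subfield_set.axioms(1)[OF E'(1)] E.mem_adjoin s E.subset_adjoin subring_set.diff_mem by blast
      moreover have "\<tau> (u - s) = t" using t.hom_diff[OF uD, of s] sD DD \<tau>(2,3) by (auto simp: u'_def)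
      ultimately show "t \<in> \<tau> ` adjoin E u" by blast
    qed
    moreover have "M' \<subseteq> internal \<rat>" unfolding M'_def
    proof (rule M.adjoin_subset[OF subfield_set_internal[OF subfield_set_Rats] M(3)])
      show "t \<in> internal \<rat>" using t(1) by (auto simp: internal_def elim!: eventually_mono intro: subsetD[OF Ints_subset_Rats])
    qed
    moreover have "countable M'" unfolding M'_def by (rule countable_adjoin[OF M(2)])
    moreover have "\<tau> (const a) = const a" for a using \<tau>(2)[of "const a"] c by auto
    ultimately have "specialization (adjoin D u) (adjoin E u) \<tau> M'"
      unfolding specialization_def using \<tau> E' M' c DD t(3) by (auto simp: M'_def)
    moreover have "\<tau> u - \<sigma> s \<in> internal \<int>" using t(1) by (simp add: \<tau>(3) u'_def)
    ultimately show ?thesis using that[of "adjoin D u" \<tau> M'] DD \<tau>(2) by blast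
  qed
qed

lemma map_rep_const: "\<forall>\<^sub>F i in \<U>. map_poly (rep i) (map_poly const p) = (p :: 'a::field poly)"
proof (induction p)
  case (pCons a p)
  have c0: "const (0 :: 'a) = 0" by (rule is_ring_hom_0[OF is_ring_hom_const])
  show ?case using pCons(2) rep_const[of a] by eventually_elim (simp add: map_poly_pCons c0)
qed simp

lemma ultra_finite_cases:
  assumes "finite A" "\<forall>\<^sub>F i in \<U>. f i \<in> A"
  shows "\<exists>a\<in>A. \<forall>\<^sub>F i in \<U>. f i = a"
proof (rule ccontr)
  assume "\<not> ?thesis"
  then have "\<forall>a\<in>A. \<forall>\<^sub>F i in \<U>. f i \<noteq> a" using ultra_cases by blast
  then have "\<forall>\<^sub>F i in \<U>. \<forall>a\<in>A. f i \<noteq> a" using assms(1) by (simp add: eventually_ball_finite)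
  with assms(2) have "\<forall>\<^sub>F i in \<U>. False" by eventually_elim blast
  then show False by simp
qed

text \<open>Almost all components of \<open>x\<close> are roots of one standard polynomial. These
  are finitely many, and the ultrafilter selects one of them.\<close>

lemma algebraic_over_const:
  fixes x :: "'a::field ultrapower"
  assumes "algebraic_over (range const) x"
  shows "\<exists>c. x = const c"
proof -
  obtain p where p: "p \<in> polys_over (range const)" "p \<noteq> 0" "poly p x = 0"
    using assms by (auto simp: algebraic_over_def)
  have c0: "const (0 :: 'a) = 0" by (rule is_ring_hom_0[OF is_ring_hom_const])
  define q where "q = map_poly (inv_into UNIV const) p"
  have "inv_into UNIV const (0 :: 'a ultrapower) = 0" using c0 by (metis const_eq_iff f_inv_into_f rangeI)
  then have pq: "p = map_poly const q" using p(1)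
    by (intro poly_eqI) (simp add: q_def coeff_map_poly c0 polys_over_def f_inv_into_f)
  have "q \<noteq> 0" using p(2) pq by auto
  have "\<forall>\<^sub>F i in \<U>. rep i x \<in> {y. poly q y = 0}"
    using map_rep_const[of q] eventual_hom_poly[OF eventual_hom_rep, of p x]
    unfolding p(3) pq[symmetric] by eventually_elim simp
  from ultra_finite_cases[OF poly_roots_finite[OF \<open>q \<noteq> 0\<close>] this]
  obtain a where "\<forall>\<^sub>F i in \<U>. rep i x = a" by auto
  then have "\<forall>\<^sub>F i in \<U>. rep i x = rep i (const a)" using rep_const[of a] by eventually_elim simp
  then show ?thesis using ultra_eq_iff by blast
qed

lemma subfield_set_range_const: "subfield_set (range (const :: 'a::field \<Rightarrow> 'a ultrapower))"
  using field_hom_on.subfield_set_image[OF is_ring_hom_imp_field_hom_on[OF is_ring_hom_const subfield_set_UNIV]]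
    subfield_set_UNIV by blast

text \<open>The rationals are relatively closed in the nonstandard rationals because an element
  algebraic over them is a constant, and a constant there is rational.\<close>

lemma specialization_init:
  assumes L: "subfield_set (L :: rat alg_closure set)"
  shows "specialization (range const) (const ` L) id \<rat>"
proof -
  note hc = is_ring_hom_imp_field_hom_on[OF is_ring_hom_const subfield_set_UNIV]
  have Rats: "x \<in> \<rat> \<longleftrightarrow> const x \<in> \<rat>" for x :: "rat alg_closure"
  proof
    assume "x \<in> \<rat>"
    then obtain a b where "x = of_int a / of_int b" by (auto elim: Rats_cases')
    then show "const x \<in> \<rat>" using field_hom_Rats[OF hc, of x a b] by simp
  next
    assume "const x \<in> \<rat>"
    then obtain a b where ab: "const x = of_int a / of_int b" by (auto elim: Rats_cases')
    then have "const x = const (of_int a / of_int b)" using field_hom_Rats[OF hc refl, of a b] by metis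
    then have "x = of_int a / of_int b" by simp
    then show "x \<in> \<rat>" by simp
  qed
  have Rc: "\<rat> \<subseteq> range (const :: rat alg_closure \<Rightarrow> _)" by (rule Rats_subset_subfield[OF subfield_set_range_const])
  have Ri: "\<rat> \<subseteq> internal (\<rat> :: rat alg_closure set)"
    by (rule Rats_subset_subfield[OF subfield_set_internal[OF subfield_set_Rats]])
  have sL: "subfield_set (const ` L)"
    using field_hom_on.subfield_set_image[OF hc _ L] by simp
  have "relatively_closed \<rat> (internal (\<rat> :: rat alg_closure set))"
    unfolding relatively_closed_def
  proof (intro ballI impI)
    fix z :: "rat alg_closure ultrapower" assume z: "z \<in> internal \<rat>" "algebraic_over \<rat> z"
    obtain c where "z = const c" using algebraic_over_const[OF algebraic_over_mono[OF Rc z(2)]] by blast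
    then show "z \<in> \<rat>" using z(1) Rats by simp
  qed
  moreover have "algebraic_over \<rat> (const x)" for x :: "rat alg_closure"
  proof -
    have "algebraic_over (const ` \<rat>) (const x)"
      by (rule hom_image_algebraic[OF hc _ _ alg_closure_algebraic_over_Rats]) auto
    then show ?thesis using Rats by (auto intro: algebraic_over_mono[of "const ` \<rat>"])
  qed
  moreover have "countable (\<rat> :: rat alg_closure ultrapower set)" by (simp add: countable_rat Rats_def)
  moreover have "field_hom_on (range (const :: rat alg_closure \<Rightarrow> _)) id"
    by (intro field_hom_on.intro[OF subfield_set_range_const] field_hom_on_axioms.intro) auto
  ultimately show ?thesis unfolding specialization_def
    using sL Rats_subset_subfield[OF sL] Ri subfield_set_Rats by auto
qed

text \<open>The separate interpretation \<open>c\<close> of the parameters allows one formula to be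
  read in the field (\<open>id\<close>), in the ultrapower (\<open>const\<close>) and after
  conjugation by an automorphism.\<close>

primrec term_eval :: "('p \<Rightarrow> 'b::idom) \<Rightarrow> ('v \<Rightarrow> 'b) \<Rightarrow> ('p, 'v) ring_term \<Rightarrow> 'b" where
  "term_eval c v (TVar i) = v i"
| "term_eval c v (TParam a) = c a"
| "term_eval c v TZero = 0"
| "term_eval c v TOne = 1"
| "term_eval c v (TAdd s t) = term_eval c v s + term_eval c v t"
| "term_eval c v (TNeg t) = - term_eval c v t"
| "term_eval c v (TMult s t) = term_eval c v s * term_eval c v t"

primrec qf_holds :: "('p \<Rightarrow> 'b::idom) \<Rightarrow> ('v \<Rightarrow> 'b) \<Rightarrow> ('p, 'v) qf_formula \<Rightarrow> bool" where
  "qf_holds c v (FEq s t) \<longleftrightarrow> term_eval c v s = term_eval c v t"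
| "qf_holds c v (FNot \<phi>) \<longleftrightarrow> \<not> qf_holds c v \<phi>"
| "qf_holds c v (FAnd \<phi> \<psi>) \<longleftrightarrow> qf_holds c v \<phi> \<and> qf_holds c v \<psi>"
| "qf_holds c v (FOr \<phi> \<psi>) \<longleftrightarrow> qf_holds c v \<phi> \<or> qf_holds c v \<psi>"

lemma finite_term_vars: "finite (term_vars t)"
  by (induction t) auto

lemma finite_qf_params: "finite (qf_params \<phi>)" "finite (qf_vars \<phi>)"
  by (induction \<phi>) (auto simp: finite_term_vars)

lemma term_val_field_on:
  fixes L :: "qbar set"
  assumes L: "subfield_set L"
  shows "term_params t \<subseteq> L \<Longrightarrow> v ` term_vars t \<subseteq> L \<Longrightarrow>
    term_val (field_on L) v t = term_eval id v t \<and> term_eval id v t \<in> L"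
proof (induction t)
  interpret L: subfield_set L by (rule L)
  have sel: "monoid.mult (field_on L) = (*)" "one (field_on L) = 1" "ring.zero (field_on L) = 0"
    "ring.add (field_on L) = (+)" "carrier (field_on L) = L"
    by (auto simp: ring_of_type_algebra_def)
  interpret R: ring "field_on L"
    by (rule ring.subring_is_ring[OF ring_from_type_algebra])
      (use L subfield_iff_subfield_set subfieldE(1) in blast)
  have minus: "\<ominus>\<^bsub>field_on L\<^esub> x = - x" if "x \<in> L" for x
    using R.minus_equality[of "- x" x] that by (simp add: sel L.uminus_mem)
  {
    case (TNeg t)
    then show ?case by (simp add: minus L.uminus_mem)
  next
    case (TAdd s t)
    then show ?case by (auto simp: sel L.add_mem image_Un)
  next
    case (TMult s t)
    then show ?case by (auto simp: sel L.mult_mem image_Un)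
  }
qed (auto simp: ring_of_type_algebra_def subring_set.zero_mem[OF subfield_set.axioms(1)[OF L]]
    subring_set.one_mem[OF subfield_set.axioms(1)[OF L]])

lemma qf_sat_field_on:
  fixes L :: "qbar set"
  assumes L: "subfield_set L"
  shows "qf_params \<phi> \<subseteq> L \<Longrightarrow> v ` qf_vars \<phi> \<subseteq> L \<Longrightarrow> qf_sat (field_on L) v \<phi> \<longleftrightarrow> qf_holds id v \<phi>"
  by (induction \<phi>) (auto simp: term_val_field_on[OF L] image_Un)

lemma term_eval_cong:
  "(\<And>a. a \<in> term_params t \<Longrightarrow> c a = c' a) \<Longrightarrow> (\<And>i. i \<in> term_vars t \<Longrightarrow> v i = v' i) \<Longrightarrow>
    term_eval c v t = term_eval c' v' t"
  by (induction t) auto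

lemma qf_holds_cong:
  "(\<And>a. a \<in> qf_params \<phi> \<Longrightarrow> c a = c' a) \<Longrightarrow> (\<And>i. i \<in> qf_vars \<phi> \<Longrightarrow> v i = v' i) \<Longrightarrow>
    qf_holds c v \<phi> = qf_holds c' v' \<phi>"
proof (induction \<phi>)
  case (FEq s t)
  then have "term_eval c v s = term_eval c' v' s" "term_eval c v t = term_eval c' v' t"
    by (auto intro!: term_eval_cong)
  then show ?case by simp
qed auto

lemma (in field_hom_on) term_eval_hom:
  "c ` term_params t \<subseteq> D \<Longrightarrow> v ` term_vars t \<subseteq> D \<Longrightarrow>
    term_eval (\<sigma> \<circ> c) (\<sigma> \<circ> v) t = \<sigma> (term_eval c v t) \<and> term_eval c v t \<in> D"
  by (induction t)
    (auto simp: hom_zero hom_one hom_add hom_mult hom_uminus image_Un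
      D.zero_mem D.one_mem D.add_mem D.mult_mem D.uminus_mem)

lemma (in field_hom_on) qf_holds_hom:
  "c ` qf_params \<phi> \<subseteq> D \<Longrightarrow> v ` qf_vars \<phi> \<subseteq> D \<Longrightarrow>
    qf_holds (\<sigma> \<circ> c) (\<sigma> \<circ> v) \<phi> \<longleftrightarrow> qf_holds c v \<phi>"
proof (induction \<phi>)
  case (FEq s t)
  then have "c ` term_params s \<subseteq> D" "v ` term_vars s \<subseteq> D" "c ` term_params t \<subseteq> D" "v ` term_vars t \<subseteq> D"
    by auto
  then show ?case using term_eval_hom[of c s v] term_eval_hom[of c t v] inj_on_eq_iff[OF hom_inj]
    unfolding qf_holds.simps by metis
qed (auto simp: image_Un)

lemma term_eval_rep:
  fixes t :: "('a::field, 'v) ring_term"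
  shows "\<forall>\<^sub>F i in \<U>. rep i (term_eval const v t) = term_eval id (\<lambda>k. rep i (v k)) t"
proof (induction t)
  case (TParam a)
  then show ?case using rep_const[of a] by simp
next
  case TOne
  then show ?case using eventual_hom_1[OF eventual_hom_rep[where ?'a = 'a]] by simp
next
  case (TAdd s t)
  then show ?case
    using eventual_hom_add[OF eventual_hom_rep, of "term_eval const v s" "term_eval const v t"]
    by eventually_elim simp
next
  case (TNeg t)
  then show ?case
    using eventual_hom_uminus[OF eventual_hom_rep, of "term_eval const v t"] by eventually_elim simp
next
  case (TMult s t)
  then show ?case
    using eventual_hom_mult[OF eventual_hom_rep, of "term_eval const v s" "term_eval const v t"]
    by eventually_elim simp
qed auto

text \<open>Los's theorem for quantifier-free formulas; negation and disjunction are where the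
  filter has to be an ultrafilter.\<close>

lemma qf_holds_rep:
  fixes \<phi> :: "('a::field, 'v) qf_formula"
  shows "qf_holds const v \<phi> \<longleftrightarrow> (\<forall>\<^sub>F i in \<U>. qf_holds id (\<lambda>k. rep i (v k)) \<phi>)"
proof (induction \<phi>)
  case (FEq s t)
  show ?case unfolding qf_holds.simps ultra_eq_iff
    by (rule eventually_cong[OF eventually_conj[OF term_eval_rep[of v s] term_eval_rep[of v t]]]) simp
next
  case (FNot \<phi>)
  then show ?case by (simp add: ultra_frequently)
next
  case (FAnd \<phi> \<psi>)
  then show ?case by (simp add: eventually_conj_iff)
next
  case (FOr \<phi> \<psi>)
  have "(\<forall>\<^sub>F i in \<U>. P i \<or> Q i) \<longleftrightarrow> eventually P \<U> \<or> eventually Q \<U>" for P Q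
  proof
    assume PQ: "\<forall>\<^sub>F i in \<U>. P i \<or> Q i"
    show "eventually P \<U> \<or> eventually Q \<U>"
    proof (rule disjCI)
      assume "\<not> eventually Q \<U>"
      then have "\<forall>\<^sub>F i in \<U>. \<not> Q i" by (simp add: ultra_frequently)
      with PQ show "eventually P \<U>" by eventually_elim blast
    qed
  qed (auto elim: eventually_mono)
  then show ?case using FOr by simp
qed

section \<open>Specialising solutions into number fields\<close>

definition solvable :: "qbar set \<Rightarrow> nat \<Rightarrow> (qbar, nat) qf_formula \<Rightarrow> qbar \<Rightarrow> bool"
  where "solvable L n \<phi> x \<longleftrightarrow> x \<in> L \<and>
    (\<exists>ys. length ys = n \<and> set ys \<subseteq> L \<and> qf_sat (field_on L) (\<lambda>i. (x # ys) ! i) \<phi>)"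

lemma solvable_iff:
  assumes L: "subfield_set L" and \<phi>: "qf_params \<phi> \<subseteq> L" "qf_vars \<phi> \<subseteq> {..n}"
  shows "solvable L n \<phi> x \<longleftrightarrow> (\<exists>v. v 0 = x \<and> range v \<subseteq> L \<and> qf_holds id v \<phi>)"
proof
  interpret L: subfield_set L by (rule L)
  assume "solvable L n \<phi> x"
  then obtain ys where ys: "x \<in> L" "length ys = n" "set ys \<subseteq> L" "qf_sat (field_on L) (\<lambda>i. (x # ys) ! i) \<phi>"
    by (auto simp: solvable_def)
  define v where "v i = (if i \<le> n then (x # ys) ! i else 0)" for i
  have mem: "(x # ys) ! i \<in> L" if "i \<le> n" for i
    using that ys nth_mem[of i "x # ys"] by auto
  have "qf_holds id (\<lambda>i. (x # ys) ! i) \<phi>"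
    using ys(4) qf_sat_field_on[OF L \<phi>(1), of "\<lambda>i. (x # ys) ! i"] mem \<phi>(2) by blast
  moreover have "qf_holds id v \<phi> = qf_holds id (\<lambda>i. (x # ys) ! i) \<phi>"
    by (rule qf_holds_cong) (use \<phi>(2) in \<open>auto simp: v_def\<close>)
  ultimately have "qf_holds id v \<phi>" by simp
  moreover have "range v \<subseteq> L" using mem L.zero_mem by (auto simp: v_def)
  ultimately show "\<exists>v. v 0 = x \<and> range v \<subseteq> L \<and> qf_holds id v \<phi>" by (intro exI[of _ v]) (simp add: v_def)
next
  assume "\<exists>v. v 0 = x \<and> range v \<subseteq> L \<and> qf_holds id v \<phi>"
  then obtain v where v: "v 0 = x" "range v \<subseteq> L" "qf_holds id v \<phi>" by blast
  define ys where "ys = map (\<lambda>i. v (Suc i)) [0..<n]"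
  have nth: "(x # ys) ! i = v i" if "i \<le> n" for i
    using that v(1) by (cases i) (auto simp: ys_def)
  have "qf_holds id (\<lambda>i. (x # ys) ! i) \<phi> = qf_holds id v \<phi>"
    by (rule qf_holds_cong) (use \<phi>(2) nth in auto)
  then have "qf_holds id (\<lambda>i. (x # ys) ! i) \<phi>" using v(3) by simp
  moreover have "(\<lambda>i. (x # ys) ! i) ` qf_vars \<phi> \<subseteq> L" using nth \<phi>(2) v(2) by fastforce
  ultimately have "qf_sat (field_on L) (\<lambda>i. (x # ys) ! i) \<phi>" using qf_sat_field_on[OF L \<phi>(1)] by blast
  then show "solvable L n \<phi> x" unfolding solvable_def
    using v by (intro conjI exI[of _ ys]) (auto simp: ys_def)
qed

text \<open>Membership of \<open>\<beta>\<^sub>i\<close> in \<open>\<rat>(\<theta>\<^sub>i)\<close> for almost all \<open>i\<close> is expressed by polynomials of bounded degree, because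
  \<open>\<theta>\<close> is algebraic over a subfield of the internal rationals.\<close>

lemma not_eventually_mem_adjoin:
  fixes \<theta> \<beta> :: "qbar ultrapower"
  assumes M: "subfield_set M" "M \<subseteq> internal \<rat>" "relatively_closed M (internal \<rat>)"
    and \<theta>: "algebraic_over M \<theta>" and b: "algebraic_over M \<beta>" "\<beta> \<notin> adjoin M \<theta>"
  shows "\<forall>\<^sub>F i in \<U>. rep i \<beta> \<notin> adjoin \<rat> (rep i \<theta>)"
proof (rule ccontr)
  assume "\<not> ?thesis"
  then have ev: "\<forall>\<^sub>F i in \<U>. rep i \<beta> \<in> adjoin \<rat> (rep i \<theta>)" using ultra_frequently[of "\<lambda>i. rep i \<beta> \<notin> adjoin \<rat> (rep i \<theta>)"] by simp
  interpret M: subfield_set M by (rule M)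
  interpret Q: subfield_set "\<rat> :: qbar set" by (rule subfield_set_Rats)
  define m where "m = min_poly M \<theta>"
  note m = M.min_poly[OF \<theta>, folded m_def]
  define cond where "cond i P \<longleftrightarrow> P \<in> polys_over \<rat> \<and> degree P \<le> degree m \<and> rep i \<beta> = poly P (rep i \<theta>)" for i P
  have mI: "m \<in> polys_over (internal \<rat>)" using m(1) polys_over_mono[OF M(2)] by blast
  have e1: "\<forall>\<^sub>F i in \<U>. rep i (1 :: qbar ultrapower) = 1" by (rule eventual_hom_1[OF eventual_hom_rep])
  have ev_cond: "\<forall>\<^sub>F i in \<U>. \<exists>P. cond i P"
    using ev rep_polys_over[OF mI Q.zero_mem] eventual_hom_poly[OF eventual_hom_rep, of m \<theta>] e1
    unfolding m(3)
  proof eventually_elim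
    case (elim i)
    define mi where "mi = map_poly (rep i) m"
    have mi: "mi \<in> polys_over \<rat>" "poly mi (rep i \<theta>) = 0" "degree mi = degree m"
      using elim m(2) by (auto simp: mi_def intro: map_poly_degree_eq)
    have mi0: "mi \<noteq> 0" using elim(4) m(2) by (metis coeff_0 coeff_map_poly mi_def rep_0 zero_neq_one)
    obtain P where P: "P \<in> polys_over \<rat>" "rep i \<beta> = poly P (rep i \<theta>)"
      using Q.adjoin_algebraic[OF alg_closure_algebraic_over_Rats elim(1)] by blast
    \<comment> \<open>Reduction modulo the minimal polynomial bounds the degree independently of
      \<open>i\<close>.\<close>
    obtain a q r where d: "a \<in> \<rat>" "q \<in> polys_over \<rat>" "r \<in> polys_over \<rat>" "a \<noteq> 0"
      "smult a P = mi * q + r" "r = 0 \<or> degree r < degree mi"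
      using Q.pseudo_division[OF mi(1) mi0 P(1)] by blast
    have "a * rep i \<beta> = poly r (rep i \<theta>)"
      using arg_cong[OF d(5), of "\<lambda>p. poly p (rep i \<theta>)"] mi(2) P(2) by simp
    then have "rep i \<beta> = poly (smult (inverse a) r) (rep i \<theta>)" using d(4) by (simp add: field_simps)
    moreover have "smult (inverse a) r \<in> polys_over \<rat>" using d by (intro Q.smult_over) auto
    moreover have "degree (smult (inverse a) r) \<le> degree m" using d(6) mi(3) by auto
    ultimately show ?case unfolding cond_def by blast
  qed
  define Pp where "Pp i = (if \<exists>P. cond i P then SOME P. cond i P else 0)" for i
  have Pp: "cond i (Pp i)" if "\<exists>P. cond i P" for i using someI_ex[OF that] that by (simp add: Pp_def)
  have ev_P: "\<forall>\<^sub>F i in \<U>. cond i (Pp i)" by (rule eventually_mono[OF ev_cond Pp])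
  have "degree (Pp i) \<le> degree m" for i
    using Pp[of i] by (cases "\<exists>P. cond i P") (auto simp: cond_def Pp_def)
  then obtain p where p: "\<forall>\<^sub>F i in \<U>. map_poly (rep i) p = Pp i" using star_poly_exists by metis
  have "p \<in> polys_over (internal \<rat>)"
  proof (rule polys_over_internalI)
    show "\<forall>\<^sub>F i in \<U>. map_poly (rep i) p \<in> polys_over \<rat>"
      using p ev_P by eventually_elim (simp add: cond_def)
  qed
  moreover have "\<forall>\<^sub>F i in \<U>. rep i \<beta> = rep i (poly p \<theta>)"
    using eventual_hom_poly[OF eventual_hom_rep, of p \<theta>] p ev_P
    by eventually_elim (simp add: cond_def)
  then have "\<beta> = poly p \<theta>" by (simp add: ultra_eq_iff)
  ultimately have "\<beta> \<in> adjoin M \<theta>"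
    by (rule linearly_disjoint[OF M(1) subfield_set_internal[OF subfield_set_Rats] M(2,3) \<theta> b(1)])
  with b(2) show False by blast
qed

text \<open>Otherwise \<open>star f\<close> would be a constant; but an injective sequence takes
  each value at most once, and the ultrafilter contains no finite set.\<close>

lemma star_injective_transcendental:
  assumes "inj f"
  shows "\<not> algebraic_over (range const) (star f)"
proof
  assume "algebraic_over (range const) (star f)"
  then obtain c where "star f = const c" using algebraic_over_const by blast
  then have c: "\<forall>\<^sub>F i in \<U>. f i = c" by (simp add: const_def star_eq_iff)
  then obtain i where i: "f i = c" using ultra_ex by blast
  have "\<forall>\<^sub>F j in \<U>. False" using c ultra_large[of "Suc i"]
    by eventually_elim (metis assms i injD not_less_eq_eq order_refl)
  then show False by simp
qed

text \<open>The coordinate \<open>u 0\<close> comes first, while \<open>D\<close> still consists of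
  the constants. It is therefore transcendental over \<open>D\<close> and is sent into s plus the
  nonstandard integers. The invariant for \<open>N = 0\<close> records that starting point.\<close>

lemma specialization_chain:
  fixes u :: "nat \<Rightarrow> qbar ultrapower"
  assumes L: "subfield_set L" and u: "\<And>k. u k \<in> internal L" "\<not> algebraic_over (range const) (u 0)" and s: "s \<in> L"
  shows "\<exists>D E \<sigma> M. specialization D E \<sigma> M \<and> const ` L \<subseteq> E \<and> E \<subseteq> internal L \<and> (\<forall>k<N. u k \<in> E) \<and>
    (if N = 0 then D = range const else \<sigma> (u 0) - const s \<in> internal \<int>)"
proof (induction N)
  case 0
  show ?case using specialization_init[OF L] by (intro exI conjI) auto
next
  case (Suc N)
  then obtain D E \<sigma> M where sp: "specialization D E \<sigma> M" and E: "const ` L \<subseteq> E" "E \<subseteq> internal L" "\<And>k. k < N \<Longrightarrow> u k \<in> E"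
    and N: "if N = 0 then D = range const else \<sigma> (u 0) - const s \<in> internal \<int>" by blast
  have sE: "const s \<in> E" using s E by blast
  have Ef: "subfield_set E" "E \<subseteq> D" and \<sigma>c: "\<sigma> (const s) = const s"
    using sp by (simp_all add: specialization_def)
  interpret E: subfield_set E by (rule Ef)
  obtain D' \<sigma>' M' where sp': "specialization D' (adjoin E (u N)) \<sigma>' M'" "D \<subseteq> D'" "\<And>x. x \<in> D \<Longrightarrow> \<sigma>' x = \<sigma> x"
    "\<not> algebraic_over D (u N) \<Longrightarrow> \<sigma>' (u N) - \<sigma> (const s) \<in> internal \<int>"
    by (rule specialization_extend[OF sp sE, of "u N"]) (rule that)
  have "adjoin E (u N) \<subseteq> internal L" by (rule E.adjoin_subset[OF subfield_set_internal[OF L] E(2) u(1)])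
  moreover have "const ` L \<subseteq> adjoin E (u N)" using E(1) E.subset_adjoin by blast
  moreover have "\<forall>k<Suc N. u k \<in> adjoin E (u N)"
    using E(3) E.subset_adjoin E.mem_adjoin by (auto simp: less_Suc_eq)
  moreover have "\<sigma>' (u 0) - const s \<in> internal \<int>"
  proof (cases "N = 0")
    case True
    then show ?thesis using N u(2) sp'(4) \<sigma>c by simp
  next
    case False
    then have "u 0 \<in> D" using E(3) Ef by blast
    then show ?thesis using N False sp'(3) by simp
  qed
  ultimately show ?case using sp'(1) by (intro exI conjI) auto
qed

theorem solvable_specialize:
  assumes L: "subfield_set L" and \<phi>: "qf_params \<phi> \<subseteq> L" "qf_vars \<phi> \<subseteq> {..n}"
    and inf: "infinite {x. solvable L n \<phi> x}"
    and A: "finite A" "A \<subseteq> L" and B: "finite B" "B \<inter> L = {}" and s: "s \<in> L"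
  obtains \<theta> m where "A \<subseteq> adjoin \<rat> \<theta>" "qf_params \<phi> \<subseteq> adjoin \<rat> \<theta>" "B \<inter> adjoin \<rat> \<theta> = {}"
    "solvable (adjoin \<rat> \<theta>) n \<phi> (of_int m + s)"
proof -
  interpret Q: subfield_set "\<rat> :: qbar set" by (rule subfield_set_Rats)
  obtain xs :: "nat \<Rightarrow> qbar" where xs: "inj xs" "range xs \<subseteq> {x. solvable L n \<phi> x}"
    using infinite_countable_subset[OF inf] by blast
  have "\<exists>v. v 0 = xs i \<and> range v \<subseteq> L \<and> qf_holds id v \<phi>" for i
    using xs(2) solvable_iff[OF L \<phi>] by blast
  then obtain v where v: "\<And>i. v i 0 = xs i" "\<And>i. range (v i) \<subseteq> L" "\<And>i. qf_holds id (v i) \<phi>" by metis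
  define u where "u k = star (\<lambda>i. v i k)" for k
  have "v i k \<in> L" for i k using v(2) by blast
  then have uL: "u k \<in> internal L" for k unfolding u_def star_in_internal by simp
  have u0: "\<not> algebraic_over (range const) (u 0)"
    unfolding u_def v(1) by (rule star_injective_transcendental[OF xs(1)])
  have hu: "qf_holds const u \<phi>" unfolding qf_holds_rep
  proof -
    have "\<forall>\<^sub>F i in \<U>. \<forall>k\<in>qf_vars \<phi>. rep i (u k) = v i k"
      using finite_qf_params(2) by (intro eventually_ball_finite) (auto simp: u_def rep_star)
    then show "\<forall>\<^sub>F i in \<U>. qf_holds id (\<lambda>k. rep i (u k)) \<phi>"
    proof eventually_elim
      case (elim i)
      then have "qf_holds id (\<lambda>k. rep i (u k)) \<phi> = qf_holds id (v i) \<phi>" by (intro qf_holds_cong) auto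
      then show ?case using v(3) by simp
    qed
  qed
  obtain D E \<sigma> M where sp: "specialization D E \<sigma> M" and E: "const ` L \<subseteq> E" "E \<subseteq> internal L" "\<And>k. k \<le> n \<Longrightarrow> u k \<in> E"
    and \<sigma>0: "\<sigma> (u 0) - const s \<in> internal \<int>"
    using specialization_chain[of L u s "Suc n", OF L uL u0 s] by (auto simp: less_Suc_eq_le)
  have hom: "field_hom_on D \<sigma>" and Ef: "subfield_set E" "E \<subseteq> D" and M: "subfield_set M" "M \<subseteq> internal \<rat>"
    "relatively_closed M (internal \<rat>)" "M \<subseteq> \<sigma> ` E" and c: "range const \<subseteq> D" "\<And>c. \<sigma> (const c) = const c"
    and alg: "\<And>x. x \<in> D \<Longrightarrow> algebraic_over M (\<sigma> x)"
    using sp by (auto simp: specialization_def)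
  interpret h: field_hom_on D \<sigma> by (rule hom)
  interpret M: subfield_set M by (rule M)
  \<comment> \<open>Everything that the number field must contain: \<open>A\<close>, the parameters,
    the shift and the coordinates of the solution.\<close>
  define S where "S = const ` (A \<union> qf_params \<phi> \<union> {s}) \<union> u ` {..n}"
  have SE: "S \<subseteq> E" unfolding S_def using A(2) \<phi>(1) s E(1,3) by auto
  have finS: "finite S" unfolding S_def using A(1) finite_qf_params(1) by auto
  have SD: "S \<subseteq> D" using SE Ef by blast
  have \<sigma>E: "subfield_set (\<sigma> ` E)" by (rule h.subfield_set_image[OF Ef(2,1)])
  obtain \<theta> where \<theta>: "\<theta> \<in> \<sigma> ` E" "algebraic_over M \<theta>" "\<sigma> ` S \<subseteq> adjoin M \<theta>"
    using primitive_element_finite[OF M(1) finite_imageI[OF finS, of \<sigma>] _ \<sigma>E M(4) image_mono[OF SE]] SD alg by blast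
  have memS: "\<forall>\<^sub>F i in \<U>. \<forall>x\<in>S. rep i (\<sigma> x) \<in> adjoin \<rat> (rep i \<theta>)"
  proof (rule eventually_ball_finite[OF finS], rule ballI)
    fix x assume "x \<in> S"
    then obtain p where p: "p \<in> polys_over M" "\<sigma> x = poly p \<theta>" using M.adjoin_algebraic[OF \<theta>(2)] \<theta>(3) by blast
    have "p \<in> polys_over (internal \<rat>)" using p(1) polys_over_mono[OF M(2)] by blast
    from rep_polys_over[OF this Q.zero_mem] eventual_hom_poly[OF eventual_hom_rep, of p \<theta>]
    show "\<forall>\<^sub>F i in \<U>. rep i (\<sigma> x) \<in> adjoin \<rat> (rep i \<theta>)"
      unfolding p(2) by eventually_elim (simp add: Q.adjoinI)
  qed
  have adM: "adjoin M \<theta> \<subseteq> \<sigma> ` E" by (rule M.adjoin_subset[OF \<sigma>E M(4) \<theta>(1)])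
  have avoidB: "\<forall>\<^sub>F i in \<U>. \<forall>b\<in>B. b \<notin> adjoin \<rat> (rep i \<theta>)"
  proof (rule eventually_ball_finite[OF B(1)], rule ballI)
    fix b assume b: "b \<in> B"
    \<comment> \<open>The map \<sigma> is injective and fixes constants, so a preimage in
      \<open>E\<close> would be \<open>const b\<close> itself; but \<open>E\<close> is contained in
      \<open>internal L\<close> and \<open>b\<close> is not in \<open>L\<close>.\<close>
    have "const b \<notin> adjoin M \<theta>"
    proof
      assume "const b \<in> adjoin M \<theta>"
      then obtain e where e: "e \<in> E" "const b = \<sigma> e" using adM by blast
      then have "\<sigma> (const b) = \<sigma> e" using c(2)[of b] by metis
      then have "const b = e" using h.hom_inj c(1) e(1) Ef(2) by (meson inj_onD rangeI subsetD)
      then have "b \<in> L" using e(1) E(2) by auto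
      then show False using b B(2) by blast
    qed
    moreover have "algebraic_over M (const b)" using alg[of "const b"] c by auto
    ultimately have "\<forall>\<^sub>F i in \<U>. rep i (const b) \<notin> adjoin \<rat> (rep i \<theta>)"
      by (intro not_eventually_mem_adjoin[OF M(1-3) \<theta>(2)])
    then show "\<forall>\<^sub>F i in \<U>. b \<notin> adjoin \<rat> (rep i \<theta>)" using rep_const[of b] by eventually_elim simp
  qed
  have "qf_holds (\<sigma> \<circ> const) (\<sigma> \<circ> u) \<phi>"
    using hu E(3) Ef(2) \<phi>(2) c(1) by (subst h.qf_holds_hom) auto
  moreover have "\<sigma> \<circ> const = const" using c(2) by auto
  ultimately have "\<forall>\<^sub>F i in \<U>. qf_holds id (\<lambda>k. rep i (\<sigma> (u k))) \<phi>" by (simp add: qf_holds_rep)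
  moreover have "\<forall>\<^sub>F i in \<U>. rep i (\<sigma> (u 0) - const s) \<in> \<int>" using \<sigma>0 by (simp add: internal_def)
  moreover have "\<forall>\<^sub>F i in \<U>. \<forall>a\<in>A \<union> qf_params \<phi> \<union> {s}. rep i (const a) = a"
    using A(1) finite_qf_params(1) rep_const by (intro eventually_ball_finite) auto
  ultimately have "\<forall>\<^sub>F i in \<U>. (\<forall>x\<in>S. rep i (\<sigma> x) \<in> adjoin \<rat> (rep i \<theta>)) \<and>
      (\<forall>b\<in>B. b \<notin> adjoin \<rat> (rep i \<theta>)) \<and> qf_holds id (\<lambda>k. rep i (\<sigma> (u k))) \<phi> \<and>
      (\<forall>a\<in>A \<union> qf_params \<phi> \<union> {s}. rep i (const a) = a) \<and> rep i (\<sigma> (u 0)) - s \<in> \<int>"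
    using memS avoidB eventual_hom_diff[OF eventual_hom_rep, of "\<sigma> (u 0)" "const s"]
    by eventually_elim simp
  then obtain i where i: "\<And>x. x \<in> S \<Longrightarrow> rep i (\<sigma> x) \<in> adjoin \<rat> (rep i \<theta>)"
    "\<And>b. b \<in> B \<Longrightarrow> b \<notin> adjoin \<rat> (rep i \<theta>)" "qf_holds id (\<lambda>k. rep i (\<sigma> (u k))) \<phi>"
    "\<And>a. a \<in> A \<union> qf_params \<phi> \<union> {s} \<Longrightarrow> rep i (const a) = a" "rep i (\<sigma> (u 0)) - s \<in> \<int>"
    using ultra_ex by blast
  define K where "K = adjoin \<rat> (rep i \<theta>)"
  have K: "subfield_set K" unfolding K_def by (rule Q.subfield_set_adjoin)
  have mem: "a \<in> K" if a: "a \<in> A \<union> qf_params \<phi> \<union> {s}" for a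
  proof -
    have "rep i (\<sigma> (const a)) \<in> K" unfolding K_def by (rule i(1)) (use a in \<open>auto simp: S_def\<close>)
    then show ?thesis using i(4)[OF a] c(2) by simp
  qed
  obtain m where m: "rep i (\<sigma> (u 0)) - s = of_int m" using i(5) by (elim Ints_cases)
  define w where "w k = (if k \<le> n then rep i (\<sigma> (u k)) else 0)" for k
  have "qf_holds id w \<phi> = qf_holds id (\<lambda>k. rep i (\<sigma> (u k))) \<phi>"
    by (rule qf_holds_cong) (use \<phi>(2) in \<open>auto simp: w_def\<close>)
  moreover have "range w \<subseteq> K"
    using i(1) subring_set.zero_mem[OF subfield_set.axioms(1)[OF K]] by (auto simp: w_def S_def K_def)
  moreover have "w 0 = of_int m + s" using m by (simp add: w_def algebra_simps)
  moreover have pK: "qf_params \<phi> \<subseteq> K" using mem by blast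
  ultimately have "solvable K n \<phi> (of_int m + s)" using solvable_iff[OF K pK \<phi>(2)] i(3) by blast
  moreover have "A \<subseteq> K" using mem by blast
  moreover have "B \<inter> K = {}" using i(2) by (auto simp: K_def)
  ultimately show ?thesis using that pK unfolding K_def by blast
qed

text \<open>Otherwise a transcendental nonstandard integer t, with Q(t) relatively closed in the
  nonstandard rationals, would have a square root in their extension by \<gamma>. Linear
  disjointness would move this root into Q(t, \<gamma>), hence into rational functions of t with
  standard coefficients, where the parity of degrees forbids it.\<close>

lemma square_root_not_in_adjoin:
  fixes \<gamma> :: qbar
  shows "\<exists>n :: int. \<forall>x. x\<^sup>2 = of_int n \<longrightarrow> x \<notin> adjoin \<rat> \<gamma>"
proof (rule ccontr)
  assume "\<not> ?thesis"
  then have sqrt: "\<exists>x. x\<^sup>2 = of_int n \<and> x \<in> adjoin \<rat> \<gamma>" for n :: int by blast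
  have init: "specialization (range const) (const ` (UNIV :: qbar set)) id \<rat>"
    by (rule specialization_init[OF subfield_set_UNIV])
  then have R: "subfield_set (\<rat> :: qbar ultrapower set)" "countable (\<rat> :: qbar ultrapower set)"
    "\<rat> \<subseteq> internal (\<rat> :: qbar set)" "relatively_closed \<rat> (internal (\<rat> :: qbar set))"
    "\<And>x :: qbar. algebraic_over \<rat> (const x)"
    by (auto simp: specialization_def)
  interpret R: subfield_set "\<rat> :: qbar ultrapower set" by (rule R)
  obtain t :: "qbar ultrapower" where t: "t \<in> internal \<int>" "\<not> algebraic_over \<rat> t" "relatively_closed (adjoin \<rat> t) (internal \<rat>)"
    using hilbert_extension[OF R(1-4)] by blast
  define F where "F = adjoin \<rat> t"
  interpret F: subfield_set F unfolding F_def by (rule R.subfield_set_adjoin)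
  have tF: "t \<in> F" "\<rat> \<subseteq> F" unfolding F_def by (rule R.mem_adjoin, rule R.subset_adjoin)
  have FI: "F \<subseteq> internal \<rat>" unfolding F_def
    by (rule R.adjoin_subset[OF subfield_set_internal[OF subfield_set_Rats] R(3)])
      (use t(1) in \<open>auto simp: internal_def elim!: eventually_mono intro: subsetD[OF Ints_subset_Rats]\<close>)
  define f where "f i = (SOME x. x\<^sup>2 = rep i t \<and> x \<in> adjoin \<rat> \<gamma>)" for i
  have "\<forall>\<^sub>F i in \<U>. rep i t \<in> \<int>" using t(1) by (simp add: internal_def)
  then have f: "\<forall>\<^sub>F i in \<U>. (f i)\<^sup>2 = rep i t \<and> f i \<in> adjoin \<rat> \<gamma>"
  proof eventually_elim
    case (elim i)
    then obtain n where "rep i t = of_int n" by (elim Ints_cases)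
    then show ?case using someI_ex[OF sqrt[of n]] by (simp add: f_def)
  qed
  define x where "x = star f"
  have "\<forall>\<^sub>F i in \<U>. rep i (x * x) = rep i t"
    using eventual_hom_mult[OF eventual_hom_rep, of x x] rep_star[of f] f
    by eventually_elim (simp add: x_def power2_eq_square)
  then have xx: "x * x = t" by (simp add: ultra_eq_iff)
  have "[:- t, 0, 1:] \<in> polys_over F" by (intro F.pCons_over F.zero_over F.uminus_mem F.zero_mem F.one_mem tF)
  moreover have "poly [:- t, 0, 1:] x = 0" using xx by simp
  ultimately have xF: "algebraic_over F x" unfolding algebraic_over_def by (intro bexI[of _ "[:- t, 0, 1:]"]) auto
  have "x \<in> adjoin F (const \<gamma>)"
  proof (rule ccontr)
    assume n: "x \<notin> adjoin F (const \<gamma>)"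
    have "\<forall>\<^sub>F i in \<U>. rep i x \<notin> adjoin \<rat> (rep i (const \<gamma>))"
      by (rule not_eventually_mem_adjoin[OF F.subfield_set_axioms FI t(3)[folded F_def] _ xF n])
        (rule algebraic_over_mono[OF tF(2) R(5)])
    then have "\<forall>\<^sub>F i in \<U>. False" using rep_const[of \<gamma>] rep_star[of f] f
      by eventually_elim (simp add: x_def)
    then show False by simp
  qed
  define C where "C = range (const :: qbar \<Rightarrow> _)"
  interpret C: subfield_set C unfolding C_def by (rule subfield_set_range_const)
  interpret PC: subring_set "polys_over C" by (rule C.polys_over_subring)
  have "adjoin F (const \<gamma>) \<subseteq> adjoin C t"
  proof (rule F.adjoin_subset[OF C.subfield_set_adjoin])
    show "F \<subseteq> adjoin C t" unfolding F_def
      by (rule R.adjoin_mono[OF Rats_subset_subfield[OF C.subfield_set_axioms] C.subfield_set_axioms])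
    show "const \<gamma> \<in> adjoin C t" using C.subset_adjoin by (auto simp: C_def)
  qed
  with \<open>x \<in> adjoin F (const \<gamma>)\<close> obtain p q where pq: "x = poly p t / poly q t" "p \<in> polys_over C" "q \<in> polys_over C" "poly q t \<noteq> 0"
    unfolding adjoin_def[of C] by blast
  have "poly p t * poly p t = t * (poly q t * poly q t)"
    using xx pq(1,4) by (simp add: field_simps)
  then have "poly (p * p - [:0, 1:] * (q * q)) t = 0" by simp
  moreover have "p * p - [:0, 1:] * (q * q) \<in> polys_over C"
    using pq by (intro PC.diff_mem PC.mult_mem C.pCons_over C.zero_over C.zero_mem C.one_mem)
  moreover have "\<not> algebraic_over C t"
  proof
    assume "algebraic_over C t"
    then obtain c where "t = const c" using algebraic_over_const by (auto simp: C_def)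
    then show False using t(2) R(5) by simp
  qed
  ultimately have "p * p - [:0, 1:] * (q * q) = 0" by (auto simp: algebraic_over_def)
  then have e: "p * p = [:0, 1:] * (q * q)" by simp
  have "q \<noteq> 0" using pq(4) by auto
  then have "p \<noteq> 0" using e by auto
  then have "2 * degree p = 1 + 2 * degree q"
    using arg_cong[OF e, of degree] \<open>q \<noteq> 0\<close> by (simp add: degree_mult_eq del: mult_pCons_left)
  then show False by presburger
qed

section \<open>The space of isomorphism types\<close>

text \<open>The basic open sets of the topology on subfields.\<close>

definition cylinder :: "qbar set \<Rightarrow> qbar set \<Rightarrow> qbar set set"
  where "cylinder A B = {L \<in> Sub_Qbar. A \<subseteq> L \<and> B \<inter> L = {}}"

lemma Sub_Qbar_iff: "L \<in> Sub_Qbar \<longleftrightarrow> subfield_set L"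
  by (simp add: Sub_Qbar_def subfield_iff_subfield_set)

lemma openin_cylinder:
  assumes "finite A" "finite B"
  shows "openin Sub_Qbar_topology (cylinder A B)"
proof -
  define V :: "qbar \<Rightarrow> bool set" where "V x = {b. (x \<in> A \<longrightarrow> b) \<and> (x \<in> B \<longrightarrow> \<not> b)}" for x
  have "{x. V x \<noteq> UNIV} \<subseteq> A \<union> B" by (auto simp: V_def)
  then have "finite {x. V x \<noteq> UNIV}" using assms finite_subset by blast
  then have "openin (product_topology (\<lambda>_. discrete_topology (UNIV :: bool set)) UNIV) (Pi\<^sub>E UNIV V)"
    by (intro product_topology_basis) auto
  moreover have "cylinder A B = (\<lambda>L x. x \<in> L) -` (Pi\<^sub>E UNIV V) \<inter> Sub_Qbar"
    by (auto simp: cylinder_def V_def PiE_def Pi_def)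
  ultimately show ?thesis unfolding Sub_Qbar_topology_def openin_pullback_topology by blast
qed

lemma openin_contains_cylinder:
  assumes "openin Sub_Qbar_topology W" "L \<in> W"
  obtains A B where "finite A" "finite B" "L \<in> cylinder A B" "cylinder A B \<subseteq> W"
proof -
  obtain U where U: "openin (product_topology (\<lambda>_. discrete_topology (UNIV :: bool set)) UNIV) U"
    "W = (\<lambda>L x. x \<in> L) -` U \<inter> Sub_Qbar"
    using assms(1) unfolding Sub_Qbar_topology_def openin_pullback_topology by blast
  then have "(\<lambda>x. x \<in> L) \<in> U" using assms(2) by blast
  then obtain V :: "qbar \<Rightarrow> bool set" where V: "finite {i. V i \<noteq> UNIV}" "(\<lambda>x. x \<in> L) \<in> Pi\<^sub>E UNIV V" "Pi\<^sub>E UNIV V \<subseteq> U"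
    using U(1) unfolding openin_product_topology_alt by fastforce
  define A where "A = {i. V i \<noteq> UNIV} \<inter> L"
  define B where "B = {i. V i \<noteq> UNIV} - L"
  show ?thesis
  proof (rule that[of A B])
    show "L \<in> cylinder A B" using assms(2) U(2) by (auto simp: cylinder_def A_def B_def)
    show "cylinder A B \<subseteq> W"
    proof
      fix K assume K: "K \<in> cylinder A B"
      have "(x \<in> K) \<in> V x" for x
      proof (cases "V x = UNIV")
        case False
        then have "x \<in> K \<longleftrightarrow> x \<in> L" using K by (auto simp: cylinder_def A_def B_def)
        then show ?thesis using V(2) by auto
      qed simp
      then show "K \<in> W" using K V(3) U(2) by (auto simp: cylinder_def)
    qed
  qed (use V(1) in \<open>auto simp: A_def B_def\<close>)
qed

definition automorphisms :: "(qbar \<Rightarrow> qbar) set"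
  where "automorphisms = {\<alpha>. is_ring_hom \<alpha> \<and> bij \<alpha>}"

lemma automorphism_comp: "\<alpha> \<in> automorphisms \<Longrightarrow> \<beta> \<in> automorphisms \<Longrightarrow> \<alpha> \<circ> \<beta> \<in> automorphisms"
  unfolding automorphisms_def
  by (auto intro!: is_ring_homI bij_comp simp: is_ring_hom_0 is_ring_hom_1 is_ring_hom_add is_ring_hom_mult)

lemma automorphism_inv:
  assumes "\<alpha> \<in> automorphisms" shows "inv_into UNIV \<alpha> \<in> automorphisms"
proof -
  have h: "is_ring_hom \<alpha>" and b: "bij \<alpha>" using assms by (auto simp: automorphisms_def)
  have eq: "inv_into UNIV \<alpha> x = y \<longleftrightarrow> x = \<alpha> y" for x y using b by (metis bij_inv_eq_iff)
  have s: "\<alpha> (inv_into UNIV \<alpha> x) = x" for x using b by (simp add: bij_is_surj surj_f_inv_f)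
  have "is_ring_hom (inv_into UNIV \<alpha>)"
    by (rule is_ring_homI)
      (simp_all add: eq is_ring_hom_0[OF h] is_ring_hom_1[OF h] is_ring_hom_add[OF h] is_ring_hom_mult[OF h] s)
  then show ?thesis using b by (simp add: automorphisms_def bij_imp_bij_inv)
qed

lemma automorphism_id: "id \<in> automorphisms"
  by (auto simp: automorphisms_def intro: is_ring_homI)

lemma automorphism_hom: "\<alpha> \<in> automorphisms \<Longrightarrow> field_hom_on UNIV \<alpha>"
  by (simp add: automorphisms_def is_ring_hom_imp_field_hom_on subfield_set_UNIV)

lemma automorphism_image: "\<alpha> \<in> automorphisms \<Longrightarrow> L \<in> Sub_Qbar \<Longrightarrow> \<alpha> ` L \<in> Sub_Qbar"
  unfolding Sub_Qbar_iff using field_hom_on.subfield_set_image[OF automorphism_hom] by blast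

lemma automorphism_inj: "\<alpha> \<in> automorphisms \<Longrightarrow> inj \<alpha>"
  by (auto simp: automorphisms_def bij_def)

text \<open>Every isomorphism between two subfields extends to an automorphism of the
  closure.\<close>

lemma field_on_iso_iff:
  assumes L: "L \<in> Sub_Qbar" and L': "L' \<in> Sub_Qbar"
  shows "field_on L \<simeq> field_on L' \<longleftrightarrow> (\<exists>\<alpha>\<in>automorphisms. \<alpha> ` L = L')"
proof
  interpret L: subfield_set L using L by (simp add: Sub_Qbar_iff)
  assume "field_on L \<simeq> field_on L'"
  then obtain h where h: "h \<in> ring_hom (field_on L) (field_on L')" "bij_betw h L L'"
    by (auto simp: is_ring_iso_def ring_iso_def)
  have "field_hom_on L h"
    by (rule field_hom_on.intro[OF L.subfield_set_axioms], unfold_locales)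
      (use h(1) in \<open>auto simp: ring_hom_def ring_of_type_algebra_def\<close>)
  then obtain \<alpha> where "is_ring_hom \<alpha>" "bij \<alpha>" "\<And>x. x \<in> L \<Longrightarrow> \<alpha> x = h x"
    using extend_to_automorphism by blast
  moreover from this(3) have "\<alpha> ` L = L'" using h(2) by (auto simp: bij_betw_def image_iff)
  ultimately show "\<exists>\<alpha>\<in>automorphisms. \<alpha> ` L = L'" by (auto simp: automorphisms_def)
next
  assume "\<exists>\<alpha>\<in>automorphisms. \<alpha> ` L = L'"
  then obtain \<alpha> where \<alpha>: "is_ring_hom \<alpha>" "bij \<alpha>" "\<alpha> ` L = L'" by (auto simp: automorphisms_def)
  then have "\<alpha> \<in> ring_iso (field_on L) (field_on L')"
    by (auto simp: ring_iso_def ring_hom_def ring_of_type_algebra_def bij_betw_def inj_on_def bij_def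
      is_ring_hom_1 is_ring_hom_add is_ring_hom_mult)
  then show "field_on L \<simeq> field_on L'" by (auto simp: is_ring_iso_def)
qed

lemma iso_class_eq_iff:
  assumes L: "L \<in> Sub_Qbar" and L': "L' \<in> Sub_Qbar"
  shows "iso_class L = iso_class L' \<longleftrightarrow> (\<exists>\<alpha>\<in>automorphisms. \<alpha> ` L' = L)"
proof -
  have iso: "iso_class K = {M. \<exists>\<alpha>\<in>automorphisms. M = \<alpha> ` K}" if "K \<in> Sub_Qbar" for K
  proof (rule Set.set_eqI)
    fix M
    have "M \<in> iso_class K \<longleftrightarrow> M \<in> Sub_Qbar \<and> (\<exists>\<alpha>\<in>automorphisms. \<alpha> ` K = M)"
      using field_on_iso_iff[OF that, of M] unfolding iso_class_def by blast
    then show "M \<in> iso_class K \<longleftrightarrow> M \<in> {M. \<exists>\<alpha>\<in>automorphisms. M = \<alpha> ` K}"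
      using automorphism_image[OF _ that] by blast
  qed
  show ?thesis
  proof
    assume "iso_class L = iso_class L'"
    moreover have "L \<in> iso_class L" unfolding iso[OF L] using automorphism_id by (auto intro!: bexI[of _ id])
    ultimately show "\<exists>\<alpha>\<in>automorphisms. \<alpha> ` L' = L" using iso[OF L'] by auto
  next
    assume "\<exists>\<alpha>\<in>automorphisms. \<alpha> ` L' = L"
    then obtain \<alpha> where \<alpha>: "\<alpha> \<in> automorphisms" "L = \<alpha> ` L'" by blast
    have inv: "inv_into UNIV \<alpha> ` L = L'"
      using inv_f_f[OF automorphism_inj[OF \<alpha>(1)]] by (auto simp: \<alpha>(2) image_image)
    show "iso_class L = iso_class L'" unfolding iso[OF L] iso[OF L']
    proof (rule Set.set_eqI, rule iffI)
      fix M assume "M \<in> {M. \<exists>\<beta>\<in>automorphisms. M = \<beta> ` L}"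
      then obtain \<beta> where "\<beta> \<in> automorphisms" "M = (\<beta> \<circ> \<alpha>) ` L'" by (auto simp: \<alpha>(2) image_comp)
      then show "M \<in> {M. \<exists>\<beta>\<in>automorphisms. M = \<beta> ` L'}" using automorphism_comp \<alpha>(1) by blast
    next
      fix M assume "M \<in> {M. \<exists>\<beta>\<in>automorphisms. M = \<beta> ` L'}"
      then obtain \<beta> where "\<beta> \<in> automorphisms" "M = \<beta> ` L'" by blast
      moreover from this(2) have "M = (\<beta> \<circ> inv_into UNIV \<alpha>) ` L" unfolding image_comp[symmetric] inv .
      ultimately show "M \<in> {M. \<exists>\<beta>\<in>automorphisms. M = \<beta> ` L}" using automorphism_comp automorphism_inv \<alpha>(1) by blast
    qed
  qed
qed

text \<open>The quotient map is open, since the saturation of a cylinder is the union of its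
  conjugates, which are cylinders.\<close>

lemma openin_iso_class_cylinder:
  assumes "finite A" "finite B"
  shows "openin Sub_Qbar_iso_topology (iso_class ` cylinder A B)"
  unfolding Sub_Qbar_iso_topology_def openin_quotient_topology topspace_Sub_Qbar_topology
proof
  show "iso_class ` cylinder A B \<subseteq> iso_class ` Sub_Qbar" by (auto simp: cylinder_def)
  have "{L \<in> Sub_Qbar. iso_class L \<in> iso_class ` cylinder A B} = (\<Union>\<alpha>\<in>automorphisms. cylinder (\<alpha> ` A) (\<alpha> ` B))"
  proof (rule Set.set_eqI, rule iffI)
    fix L assume "L \<in> {L \<in> Sub_Qbar. iso_class L \<in> iso_class ` cylinder A B}"
    then obtain K where K: "L \<in> Sub_Qbar" "K \<in> cylinder A B" "iso_class L = iso_class K" by blast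
    then obtain \<alpha> where \<alpha>: "\<alpha> \<in> automorphisms" "\<alpha> ` K = L"
      using iso_class_eq_iff[of L K] by (auto simp: cylinder_def)
    have "L \<in> cylinder (\<alpha> ` A) (\<alpha> ` B)"
      using K(1,2) \<alpha>(2) automorphism_inj[OF \<alpha>(1)] by (auto simp: cylinder_def inj_eq)
    then show "L \<in> (\<Union>\<alpha>\<in>automorphisms. cylinder (\<alpha> ` A) (\<alpha> ` B))" using \<alpha>(1) by blast
  next
    fix L assume "L \<in> (\<Union>\<alpha>\<in>automorphisms. cylinder (\<alpha> ` A) (\<alpha> ` B))"
    then obtain \<alpha> where \<alpha>: "\<alpha> \<in> automorphisms" "L \<in> cylinder (\<alpha> ` A) (\<alpha> ` B)" by blast
    then have L: "L \<in> Sub_Qbar" by (simp add: cylinder_def)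
    define K where "K = inv_into UNIV \<alpha> ` L"
    have K: "K \<in> Sub_Qbar" unfolding K_def by (rule automorphism_image[OF automorphism_inv[OF \<alpha>(1)] L])
    have "bij \<alpha>" using \<alpha>(1) by (simp add: automorphisms_def)
    then have aK: "\<alpha> ` K = L" unfolding K_def by (simp add: image_f_inv_f bij_is_surj)
    then have mem: "\<alpha> x \<in> L \<longleftrightarrow> x \<in> K" for x using automorphism_inj[OF \<alpha>(1)] by (auto simp: inj_eq)
    have "K \<in> cylinder A B" using \<alpha>(2) K mem by (auto simp: cylinder_def)
    moreover have "iso_class L = iso_class K" using iso_class_eq_iff[OF L K] \<alpha>(1) aK by blast
    ultimately show "L \<in> {L \<in> Sub_Qbar. iso_class L \<in> iso_class ` cylinder A B}" using L by blast
  qed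
  then show "openin Sub_Qbar_topology {L \<in> Sub_Qbar. iso_class L \<in> iso_class ` cylinder A B}"
    using assms by (auto intro!: openin_Union openin_cylinder)
qed

text \<open>Nowhere density read off on cylinders. It is used for sets of fields, before the passage
  to isomorphism classes.\<close>

definition avoidable :: "qbar set set \<Rightarrow> bool"
  where "avoidable S \<longleftrightarrow> (\<forall>A B. finite A \<longrightarrow> finite B \<longrightarrow> cylinder A B \<noteq> {} \<longrightarrow>
    (\<exists>A' B'. finite A' \<and> finite B' \<and> cylinder A' B' \<noteq> {} \<and> cylinder A' B' \<subseteq> cylinder A B \<and> cylinder A' B' \<inter> S = {}))"

lemma avoidableE:
  assumes "avoidable S" "finite A" "finite B" "cylinder A B \<noteq> {}"
  obtains A' B' where "finite A'" "finite B'" "cylinder A' B' \<noteq> {}" "cylinder A' B' \<subseteq> cylinder A B" "cylinder A' B' \<inter> S = {}"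
proof -
  have "\<exists>A' B'. finite A' \<and> finite B' \<and> cylinder A' B' \<noteq> {} \<and> cylinder A' B' \<subseteq> cylinder A B \<and> cylinder A' B' \<inter> S = {}"
    using assms(1)[unfolded avoidable_def, rule_format, OF assms(2-4)] .
  then show ?thesis by (elim exE conjE) (rule that)
qed

lemma avoidable_Union:
  assumes "finite \<S>" "\<And>S. S \<in> \<S> \<Longrightarrow> avoidable S"
  shows "avoidable (\<Union>\<S>)"
  using assms
proof (induction \<S> rule: finite_induct)
  case empty
  show ?case by (auto simp: avoidable_def)
next
  case (insert S \<S>)
  show ?case unfolding avoidable_def
  proof (intro allI impI)
    fix A B assume AB: "finite A" "finite B" "cylinder A B \<noteq> {}"
    have IH: "avoidable (\<Union>\<S>)" "avoidable S" using insert by blast+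
    obtain A' B' where 1: "finite A'" "finite B'" "cylinder A' B' \<noteq> {}" "cylinder A' B' \<subseteq> cylinder A B" "cylinder A' B' \<inter> \<Union>\<S> = {}"
      using avoidableE[OF IH(1) AB] .
    obtain A'' B'' where 2: "finite A''" "finite B''" "cylinder A'' B'' \<noteq> {}" "cylinder A'' B'' \<subseteq> cylinder A' B'" "cylinder A'' B'' \<inter> S = {}"
      using avoidableE[OF IH(2) 1(1-3)] .
    have "cylinder A'' B'' \<subseteq> cylinder A B" using 1(4) 2(4) by (rule order_trans[rotated])
    moreover have "cylinder A'' B'' \<inter> \<Union>(insert S \<S>) = {}" using 1(5) 2(4,5) by auto
    ultimately show "\<exists>A' B'. finite A' \<and> finite B' \<and> cylinder A' B' \<noteq> {} \<and> cylinder A' B' \<subseteq> cylinder A B \<and> cylinder A' B' \<inter> \<Union>(insert S \<S>) = {}"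
      using 2(1-3) by (intro exI conjI)
  qed
qed

lemma nowhere_dense_inI:
  assumes "N \<subseteq> topspace T"
    and "\<And>V. openin T V \<Longrightarrow> V \<noteq> {} \<Longrightarrow> \<exists>W. openin T W \<and> W \<noteq> {} \<and> W \<subseteq> V \<and> W \<inter> N = {}"
  shows "nowhere_dense_in T N"
  unfolding nowhere_dense_in_def
proof (intro conjI assms(1))
  show "T interior_of (T closure_of N) = {}"
  proof (rule ccontr)
    assume "T interior_of (T closure_of N) \<noteq> {}"
    then obtain W where W: "openin T W" "W \<noteq> {}" "W \<subseteq> T interior_of (T closure_of N)" "W \<inter> N = {}"
      using assms(2) openin_interior_of by metis
    have "W \<inter> T closure_of N = {}" using openin_Int_closure_of_eq_empty[OF W(1)] W(4) by blast
    moreover have "W \<subseteq> T closure_of N" by (rule order_trans[OF W(3) interior_of_subset])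
    ultimately show False using W(2) by blast
  qed
qed

text \<open>In the quotient, \<open>S\<close> counts with all of its conjugates. These are required
  to lie in finitely many avoidable sets, since avoidability passes to finite unions.\<close>

lemma nowhere_dense_iso_class:
  assumes S: "S \<subseteq> Sub_Qbar" and fin: "finite \<S>" "\<And>T. T \<in> \<S> \<Longrightarrow> avoidable T"
    and conj: "\<And>L \<alpha>. L \<in> S \<Longrightarrow> \<alpha> \<in> automorphisms \<Longrightarrow> \<alpha> ` L \<in> \<Union>\<S>"
  shows "nowhere_dense_in Sub_Qbar_iso_topology (iso_class ` S)"
proof (rule nowhere_dense_inI)
  show "iso_class ` S \<subseteq> topspace Sub_Qbar_iso_topology" using S by auto
  fix V assume V: "openin Sub_Qbar_iso_topology V" "V \<noteq> {}"
  define V' where "V' = {L \<in> Sub_Qbar. iso_class L \<in> V}"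
  have sub: "V \<subseteq> iso_class ` Sub_Qbar" and op: "openin Sub_Qbar_topology V'"
    using V(1) unfolding Sub_Qbar_iso_topology_def openin_quotient_topology V'_def by auto
  then obtain L where "L \<in> V'" using V(2) by (auto simp: V'_def)
  then obtain A B where AB: "finite A" "finite B" "L \<in> cylinder A B" "cylinder A B \<subseteq> V'"
    using openin_contains_cylinder[OF op] by metis
  have "avoidable (\<Union>\<S>)" by (rule avoidable_Union[OF fin])
  then obtain A' B' where A': "finite A'" "finite B'" "cylinder A' B' \<noteq> {}" "cylinder A' B' \<subseteq> cylinder A B" "cylinder A' B' \<inter> \<Union>\<S> = {}"
    by (rule avoidableE[OF _ AB(1,2)]) (use AB(3) in auto)
  have "iso_class ` cylinder A' B' \<inter> iso_class ` S = {}"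
  proof (rule ccontr)
    assume "iso_class ` cylinder A' B' \<inter> iso_class ` S \<noteq> {}"
    then obtain K K' where K: "K \<in> cylinder A' B'" "K' \<in> S" "iso_class K = iso_class K'" by blast
    then obtain \<alpha> where "\<alpha> \<in> automorphisms" "\<alpha> ` K' = K"
      using iso_class_eq_iff[of K K'] S by (auto simp: cylinder_def)
    then have "K \<in> \<Union>\<S>" using conj K(2) by blast
    then show False using A'(5) K(1) by blast
  qed
  then show "\<exists>W. openin Sub_Qbar_iso_topology W \<and> W \<noteq> {} \<and> W \<subseteq> V \<and> W \<inter> iso_class ` S = {}"
    using openin_iso_class_cylinder[OF A'(1,2)] A'(3,4) AB(4)
    by (intro exI[of _ "iso_class ` cylinder A' B'"]) (auto simp: V'_def)
qed

lemma nowhere_dense_in_subset: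
  "nowhere_dense_in T N \<Longrightarrow> N' \<subseteq> N \<Longrightarrow> nowhere_dense_in T N'"
  unfolding nowhere_dense_in_def using closure_of_mono interior_of_mono by (metis order_trans subset_empty)

lemma meager_in_image:
  assumes "countable J" "S \<subseteq> (\<Union>j\<in>J. F j)" "\<And>j. j \<in> J \<Longrightarrow> nowhere_dense_in T (f ` F j)"
  shows "meager_in T (f ` S)"
  unfolding meager_in_def
proof (intro exI conjI)
  show "countable ((\<lambda>j. f ` F j \<inter> f ` S) ` J)" using assms(1) by (rule countable_image)
  show "\<forall>N\<in>(\<lambda>j. f ` F j \<inter> f ` S) ` J. nowhere_dense_in T N"
    using assms(3) nowhere_dense_in_subset by blast
  show "f ` S = \<Union>((\<lambda>j. f ` F j \<inter> f ` S) ` J)" using assms(2) by blast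
qed

section \<open>Meager sets of isomorphism types\<close>

instance ring_term :: (countable, countable) countable
  by countable_datatype

instance qf_formula :: (countable, countable) countable
  by countable_datatype

text \<open>An automorphism moves an algebraic number within the root set of one rational
  polynomial.\<close>

lemma finite_automorphism_restrictions:
  assumes "finite P"
  shows "finite ((\<lambda>\<alpha>. restrict \<alpha> P) ` automorphisms)"
proof -
  have "\<exists>p\<in>polys_over \<rat>. p \<noteq> 0 \<and> poly p a = 0" for a :: qbar
    using alg_closure_algebraic_over_Rats[of a] by (simp add: algebraic_over_def)
  then obtain p :: "qbar \<Rightarrow> qbar poly" where p: "\<And>a. p a \<in> polys_over \<rat>" "\<And>a. p a \<noteq> 0" "\<And>a. poly (p a) a = 0"
    by metis
  have "(\<lambda>\<alpha>. restrict \<alpha> P) ` automorphisms \<subseteq> Pi\<^sub>E P (\<lambda>a. {y. poly (p a) y = 0})"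
    using field_hom_root_Rats[OF automorphism_hom p(1,3)] by auto
  moreover have "finite (Pi\<^sub>E P (\<lambda>a. {y. poly (p a) y = 0}))"
    using assms p(2) by (intro finite_PiE poly_roots_finite)
  ultimately show ?thesis by (rule finite_subset)
qed

lemma qf_holds_map: "qf_holds c v (map_qf_formula f id \<phi>) = qf_holds (c \<circ> f) v \<phi>"
proof -
  have "term_eval c v (map_ring_term f id t) = term_eval (c \<circ> f) v t" for t
    by (induction t) auto
  then show ?thesis by (induction \<phi>) auto
qed

lemma solvable_image:
  assumes \<alpha>: "\<alpha> \<in> automorphisms" and L: "subfield_set L" and \<phi>: "qf_params \<phi> \<subseteq> L" "qf_vars \<phi> \<subseteq> {..n}"
  shows "solvable (\<alpha> ` L) n (map_qf_formula \<alpha> id \<phi>) (\<alpha> x) \<longleftrightarrow> solvable L n \<phi> x"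
proof -
  interpret field_hom_on UNIV \<alpha> by (rule automorphism_hom[OF \<alpha>])
  have L': "subfield_set (\<alpha> ` L)" using subfield_set_image L by blast
  have \<phi>': "qf_params (map_qf_formula \<alpha> id \<phi>) \<subseteq> \<alpha> ` L" "qf_vars (map_qf_formula \<alpha> id \<phi>) \<subseteq> {..n}"
    using \<phi> by (auto simp: qf_formula.set_map)
  have holds: "qf_holds id (\<alpha> \<circ> v) (map_qf_formula \<alpha> id \<phi>) = qf_holds id v \<phi>" for v
    using qf_holds_hom[of id \<phi> v] by (simp add: qf_holds_map)
  show ?thesis unfolding solvable_iff[OF L \<phi>] solvable_iff[OF L' \<phi>']
  proof
    assume "\<exists>v. v 0 = x \<and> range v \<subseteq> L \<and> qf_holds id v \<phi>"
    then obtain v where "v 0 = x" "range v \<subseteq> L" "qf_holds id v \<phi>" by blast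
    then show "\<exists>v. v 0 = \<alpha> x \<and> range v \<subseteq> \<alpha> ` L \<and> qf_holds id v (map_qf_formula \<alpha> id \<phi>)"
      using holds by (intro exI[of _ "\<alpha> \<circ> v"]) auto
  next
    assume "\<exists>v. v 0 = \<alpha> x \<and> range v \<subseteq> \<alpha> ` L \<and> qf_holds id v (map_qf_formula \<alpha> id \<phi>)"
    then obtain w where w: "w 0 = \<alpha> x" "range w \<subseteq> \<alpha> ` L" "qf_holds id w (map_qf_formula \<alpha> id \<phi>)" by blast
    define v where "v = inv_into UNIV \<alpha> \<circ> w"
    have inj: "inj \<alpha>" by (rule hom_inj)
    have "\<alpha> \<circ> v = w"
    proof
      fix k
      have "w k \<in> range \<alpha>" using w(2) by blast
      then show "(\<alpha> \<circ> v) k = w k" by (simp add: v_def f_inv_into_f)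
    qed
    moreover have "v 0 = x" using w(1) inj by (simp add: v_def)
    moreover have "range v \<subseteq> L"
    proof
      fix y assume "y \<in> range v"
      then obtain k where k: "y = v k" by blast
      have "w k \<in> \<alpha> ` L" using w(2) by blast
      then show "y \<in> L" using inj by (auto simp: v_def k)
    qed
    ultimately show "\<exists>v. v 0 = x \<and> range v \<subseteq> L \<and> qf_holds id v \<phi>" using w(3) holds by blast
  qed
qed

text \<open>A formula that defines one of the sets in question, or its complement, has solutions for infinitely
  many values of \<open>X\<close>, but none for \<open>X \<in> s + \<int>\<close>, where \<open>s\<close> is a suitable shift.\<close>

definition shift_gap :: "nat \<Rightarrow> (qbar, nat) qf_formula \<Rightarrow> qbar \<Rightarrow> qbar set set"
  where "shift_gap n \<phi> s = {L \<in> Sub_Qbar. qf_params \<phi> \<subseteq> L \<and> qf_vars \<phi> \<subseteq> {..n} \<and> s \<in> L \<and>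
    infinite {x. solvable L n \<phi> x} \<and> (\<forall>m::int. \<not> solvable L n \<phi> (of_int m + s))}"

lemma avoidable_shift_gap: "avoidable (shift_gap n \<phi> s)"
  unfolding avoidable_def
proof (intro allI impI)
  fix A B assume AB: "finite A" "finite B" "cylinder A B \<noteq> {}"
  show "\<exists>A' B'. finite A' \<and> finite B' \<and> cylinder A' B' \<noteq> {} \<and> cylinder A' B' \<subseteq> cylinder A B \<and>
    cylinder A' B' \<inter> shift_gap n \<phi> s = {}"
  proof (cases "cylinder A B \<inter> shift_gap n \<phi> s = {}")
    case True
    then show ?thesis using AB by (intro exI[of _ A] exI[of _ B] conjI order_refl)
  next
    case False
    then obtain L where L: "L \<in> cylinder A B" "L \<in> shift_gap n \<phi> s" by blast
    have Lf: "subfield_set L" "A \<subseteq> L" "B \<inter> L = {}" using L(1) by (auto simp: cylinder_def Sub_Qbar_iff)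
    have \<phi>: "qf_params \<phi> \<subseteq> L" "qf_vars \<phi> \<subseteq> {..n}" "infinite {x. solvable L n \<phi> x}" "s \<in> L"
      using L(2) by (auto simp: shift_gap_def)
    interpret Q: subfield_set "\<rat> :: qbar set" by (rule subfield_set_Rats)
    obtain \<theta> m where \<theta>: "A \<subseteq> adjoin \<rat> \<theta>" "qf_params \<phi> \<subseteq> adjoin \<rat> \<theta>" "B \<inter> adjoin \<rat> \<theta> = {}"
      "solvable (adjoin \<rat> \<theta>) n \<phi> (of_int m + s)"
      using solvable_specialize[OF Lf(1) \<phi>(1-3) AB(1) Lf(2) AB(2) Lf(3) \<phi>(4)] .
    \<comment> \<open>Requiring \<theta> in addition forces each member of the cylinder to contain
      the number field, and with it the solution at a point of s + Z.\<close>
    have ne: "adjoin \<rat> \<theta> \<in> cylinder (insert \<theta> A) B"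
      using \<theta> Q.mem_adjoin Q.subfield_set_adjoin by (auto simp: cylinder_def Sub_Qbar_iff)
    have sub: "cylinder (insert \<theta> A) B \<subseteq> cylinder A B" by (auto simp: cylinder_def)
    have "cylinder (insert \<theta> A) B \<inter> shift_gap n \<phi> s = {}"
    proof (rule ccontr)
      assume "\<not> ?thesis"
      then obtain K where "K \<in> cylinder (insert \<theta> A) B" "K \<in> shift_gap n \<phi> s" by blast
      then have K: "K \<in> Sub_Qbar" "\<theta> \<in> K" "qf_params \<phi> \<subseteq> K" "\<not> solvable K n \<phi> (of_int m + s)"
        by (simp_all add: cylinder_def shift_gap_def)
      then have Kf: "subfield_set K" by (simp add: Sub_Qbar_iff)
      have "adjoin \<rat> \<theta> \<subseteq> K" by (rule Q.adjoin_subset[OF Kf Rats_subset_subfield[OF Kf] K(2)])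
      then have "solvable K n \<phi> (of_int m + s)"
        using \<theta>(4) unfolding solvable_iff[OF Q.subfield_set_adjoin \<theta>(2) \<phi>(2)] solvable_iff[OF Kf K(3) \<phi>(2)]
        by blast
      then show False using K(4) by blast
    qed
    then show ?thesis using AB(1,2) ne sub
      by (intro exI[of _ "insert \<theta> A"] exI[of _ B] conjI) auto
  qed
qed

lemma nowhere_dense_shift_gap: "nowhere_dense_in Sub_Qbar_iso_topology (iso_class ` shift_gap n \<phi> s)"
proof (rule nowhere_dense_iso_class)
  \<comment> \<open>The conjugated gap set depends only on the values of the automorphism at
    \<open>s\<close> and at the parameters; restricting to them makes the family finite.\<close>
  define P where "P = insert s (qf_params \<phi>)"
  define \<S> where "\<S> = (\<lambda>\<beta>. shift_gap n (map_qf_formula \<beta> id \<phi>) (\<beta> s)) ` (\<lambda>\<alpha>. restrict \<alpha> P) ` automorphisms"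
  show "shift_gap n \<phi> s \<subseteq> Sub_Qbar" by (auto simp: shift_gap_def)
  show "finite \<S>" unfolding \<S>_def P_def
    by (intro finite_imageI finite_automorphism_restrictions) (simp add: finite_qf_params)
  show "avoidable T" if "T \<in> \<S>" for T using that avoidable_shift_gap by (auto simp: \<S>_def)
  fix L \<alpha> assume L: "L \<in> shift_gap n \<phi> s" and \<alpha>: "\<alpha> \<in> automorphisms"
  interpret field_hom_on UNIV \<alpha> by (rule automorphism_hom[OF \<alpha>])
  have Lf: "subfield_set L" "qf_params \<phi> \<subseteq> L" "qf_vars \<phi> \<subseteq> {..n}" using L by (auto simp: shift_gap_def Sub_Qbar_iff)
  note sol = solvable_image[OF \<alpha> Lf]
  have "map_qf_formula (restrict \<alpha> P) id \<phi> = map_qf_formula \<alpha> id \<phi>"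
    by (rule qf_formula.map_cong0) (auto simp: P_def)
  moreover have "restrict \<alpha> P s = \<alpha> s" by (simp add: P_def)
  moreover have "shift_gap n (map_qf_formula (restrict \<alpha> P) id \<phi>) (restrict \<alpha> P s) \<in> \<S>"
    unfolding \<S>_def by (intro imageI \<alpha>)
  ultimately have "shift_gap n (map_qf_formula \<alpha> id \<phi>) (\<alpha> s) \<in> \<S>" by simp
  moreover have "\<alpha> ` L \<in> shift_gap n (map_qf_formula \<alpha> id \<phi>) (\<alpha> s)"
    unfolding shift_gap_def
  proof (intro CollectI conjI allI)
    show "\<alpha> ` L \<in> Sub_Qbar" using automorphism_image[OF \<alpha>] L by (simp add: shift_gap_def)
    show "\<alpha> s \<in> \<alpha> ` L" using L by (simp add: shift_gap_def)
    show "qf_params (map_qf_formula \<alpha> id \<phi>) \<subseteq> \<alpha> ` L" "qf_vars (map_qf_formula \<alpha> id \<phi>) \<subseteq> {..n}"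
      using Lf(2,3) by (simp_all add: qf_formula.set_map image_mono)
    have "infinite (\<alpha> ` {x. solvable L n \<phi> x})"
    proof
      assume "finite (\<alpha> ` {x. solvable L n \<phi> x})"
      then have "finite {x. solvable L n \<phi> x}" by (rule finite_imageD) (rule inj_on_subset[OF hom_inj subset_UNIV])
      then show False using L by (simp add: shift_gap_def)
    qed
    moreover have "\<alpha> ` {x. solvable L n \<phi> x} \<subseteq> {x. solvable (\<alpha> ` L) n (map_qf_formula \<alpha> id \<phi>) x}"
      using sol by auto
    ultimately show "infinite {x. solvable (\<alpha> ` L) n (map_qf_formula \<alpha> id \<phi>) x}" using finite_subset by blast
    fix m :: int
    have "\<alpha> (of_int m) = of_int m" using field_hom_Rats[OF automorphism_hom[OF \<alpha>], of "of_int m" m 1] by simp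
    then have "of_int m + \<alpha> s = \<alpha> (of_int m + s)" by (simp add: hom_add)
    then show "\<not> solvable (\<alpha> ` L) n (map_qf_formula \<alpha> id \<phi>) (of_int m + \<alpha> s)"
      using sol L by (simp add: shift_gap_def)
  qed
  ultimately show "\<alpha> ` L \<in> \<Union>\<S>" by blast
qed

lemma avoidable_adjoin: "avoidable {adjoin \<rat> (\<theta> :: qbar)}"
  unfolding avoidable_def
proof (intro allI impI)
  define F where "F = adjoin \<rat> \<theta>"
  interpret Q: subfield_set "\<rat> :: qbar set" by (rule subfield_set_Rats)
  interpret F: subfield_set F unfolding F_def by (rule Q.subfield_set_adjoin)
  fix A B assume AB: "finite A" "finite B" "cylinder A B \<noteq> {}"
  show "\<exists>A' B'. finite A' \<and> finite B' \<and> cylinder A' B' \<noteq> {} \<and> cylinder A' B' \<subseteq> cylinder A B \<and>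
    cylinder A' B' \<inter> {adjoin \<rat> \<theta>} = {}"
  proof (cases "F \<in> cylinder A B")
    case False
    then have "cylinder A B \<inter> {adjoin \<rat> \<theta>} = {}" by (simp add: F_def)
    then show ?thesis using AB by (intro exI[of _ A] exI[of _ B] conjI order_refl)
  next
    case True
    then have FB: "A \<subseteq> F" "B \<inter> F = {}" by (auto simp: cylinder_def)
    \<comment> \<open>One number field that contains \<theta> and all of \<open>B\<close>; the
      square root is then chosen outside of it.\<close>
    obtain \<gamma> where \<gamma>: "insert \<theta> B \<subseteq> adjoin \<rat> \<gamma>"
      using primitive_element_finite[OF subfield_set_Rats, of "insert \<theta> B" UNIV]
        alg_closure_algebraic_over_Rats subfield_set_UNIV AB(2) by auto
    define G where "G = adjoin \<rat> \<gamma>"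
    interpret G: subfield_set G unfolding G_def by (rule Q.subfield_set_adjoin)
    have FG: "F \<subseteq> G" unfolding F_def
      by (rule Q.adjoin_subset[OF G.subfield_set_axioms Rats_subset_subfield[OF G.subfield_set_axioms]])
        (use \<gamma> in \<open>auto simp: G_def\<close>)
    obtain n :: int where n: "\<And>x. x\<^sup>2 = of_int n \<Longrightarrow> x \<notin> G"
      using square_root_not_in_adjoin[of \<gamma>] by (auto simp: G_def)
    obtain c :: qbar where c: "c\<^sup>2 = of_int n" using nth_root_exists[of 2 "of_int n"] by auto
    have cG: "c \<notin> G" using n c by blast
    have lin: "\<exists>u\<in>F. \<exists>v\<in>F. poly p c = u + v * c" if "p \<in> polys_over F" for p
      using that
    proof (induction rule: F.poly_over_induct)
      case zero
      show ?case by (intro bexI[of _ 0]) (auto intro: F.zero_mem)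
    next
      case (pCons a p)
      then obtain u v where uv: "u \<in> F" "v \<in> F" "poly p c = u + v * c" by blast
      have "poly (pCons a p) c = (a + v * of_int n) + u * c"
        using uv(3) c by (simp add: algebra_simps power2_eq_square)
      then show ?case using uv pCons(1) by (intro bexI[of _ "a + v * of_int n"] bexI[of _ u])
        (auto intro: F.add_mem F.mult_mem F.of_int_mem)
    qed
    have cF: "algebraic_over F c"
      by (rule algebraic_over_mono[OF Rats_subset_subfield[OF F.subfield_set_axioms] alg_closure_algebraic_over_Rats])
    \<comment> \<open>An element b = u + v c of \<open>B\<close> has v nonzero because it is not in
      \<open>F\<close>. Solving for \<open>c\<close> would put the square root into
      \<open>G\<close>.\<close>
    have "B \<inter> adjoin F c = {}"
    proof (rule ccontr)
      assume "B \<inter> adjoin F c \<noteq> {}"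
      then obtain b where b: "b \<in> B" "b \<in> adjoin F c" by blast
      obtain p where "p \<in> polys_over F" "b = poly p c" using F.adjoin_algebraic[OF cF b(2)] .
      then obtain u v where uv: "u \<in> F" "v \<in> F" "b = u + v * c" using lin by blast
      have "v \<noteq> 0" using uv b(1) FB(2) by auto
      then have "(b - u) / v = c" using uv(3) by simp
      moreover have "b \<in> G" using \<gamma> b(1) by (auto simp: G_def)
      then have "(b - u) / v \<in> G" using uv(1,2) FG by (intro G.divide_mem G.diff_mem) auto
      ultimately have "c \<in> G" by metis
      then show False using cG by blast
    qed
    then have ne: "adjoin F c \<in> cylinder (insert c A) B"
      using F.mem_adjoin[of c] F.subfield_set_adjoin[of c] order_trans[OF FB(1) F.subset_adjoin[of c]]
      by (simp add: cylinder_def Sub_Qbar_iff)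
    have sub: "cylinder (insert c A) B \<subseteq> cylinder A B" by (auto simp: cylinder_def)
    have "F \<notin> cylinder (insert c A) B" using cG FG by (auto simp: cylinder_def)
    then have "cylinder (insert c A) B \<inter> {adjoin \<rat> \<theta>} = {}" by (simp add: F_def)
    then show ?thesis using AB(1,2) ne sub by (intro exI[of _ "insert c A"] exI[of _ B] conjI) auto
  qed
qed

lemma nowhere_dense_adjoin: "nowhere_dense_in Sub_Qbar_iso_topology (iso_class ` {adjoin \<rat> \<theta>})"
proof (rule nowhere_dense_iso_class)
  interpret Q: subfield_set "\<rat> :: qbar set" by (rule subfield_set_Rats)
  define \<S> where "\<S> = (\<lambda>\<beta>. {adjoin \<rat> (\<beta> \<theta>)}) ` (\<lambda>\<alpha>. restrict \<alpha> {\<theta>}) ` automorphisms"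
  show "{adjoin \<rat> \<theta>} \<subseteq> Sub_Qbar" using Q.subfield_set_adjoin by (simp add: Sub_Qbar_iff)
  show "finite \<S>" unfolding \<S>_def by (intro finite_imageI finite_automorphism_restrictions) simp
  show "avoidable T" if "T \<in> \<S>" for T using that avoidable_adjoin by (auto simp: \<S>_def)
  fix L \<alpha> assume L: "L \<in> {adjoin \<rat> \<theta>}" and \<alpha>: "\<alpha> \<in> automorphisms"
  have sub: "adjoin \<rat> (\<beta> \<eta>) \<subseteq> \<beta> ` adjoin \<rat> \<eta>" if "\<beta> \<in> automorphisms" for \<beta> \<eta>
  proof -
    have s: "subfield_set (\<beta> ` adjoin \<rat> \<eta>)"
      using field_hom_on.subfield_set_image[OF automorphism_hom[OF that]] Q.subfield_set_adjoin by blast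
    show ?thesis by (rule Q.adjoin_subset[OF s Rats_subset_subfield[OF s]]) (simp add: Q.mem_adjoin)
  qed
  have "\<alpha> ` adjoin \<rat> \<theta> = adjoin \<rat> (\<alpha> \<theta>)"
  proof
    show "adjoin \<rat> (\<alpha> \<theta>) \<subseteq> \<alpha> ` adjoin \<rat> \<theta>" by (rule sub[OF \<alpha>])
    have bij: "bij \<alpha>" using \<alpha> by (simp add: automorphisms_def)
    have "adjoin \<rat> \<theta> \<subseteq> inv_into UNIV \<alpha> ` adjoin \<rat> (\<alpha> \<theta>)"
      using sub[OF automorphism_inv[OF \<alpha>], of "\<alpha> \<theta>"] automorphism_inj[OF \<alpha>] by simp
    then have "\<alpha> ` adjoin \<rat> \<theta> \<subseteq> \<alpha> ` inv_into UNIV \<alpha> ` adjoin \<rat> (\<alpha> \<theta>)" by (rule image_mono)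
    also have "\<dots> = adjoin \<rat> (\<alpha> \<theta>)" using bij by (simp add: image_f_inv_f bij_is_surj)
    finally show "\<alpha> ` adjoin \<rat> \<theta> \<subseteq> adjoin \<rat> (\<alpha> \<theta>)" .
  qed
  then show "\<alpha> ` L \<in> \<Union>\<S>" using L \<alpha> by (auto simp: \<S>_def)
qed

lemma number_field_eq_adjoin:
  assumes "number_field F"
  obtains \<theta> where "F = adjoin \<rat> \<theta>"
proof -
  interpret R: field "Qbar" by (rule field_from_type_algebra)
  interpret Q: subfield_set "\<rat> :: qbar set" by (rule subfield_set_Rats)
  have F: "subfield_set F" and fd: "R.finite_dimension \<rat> F"
    using assms by (auto simp: number_field_def subfield_iff_subfield_set)
  have sQ: "subfield \<rat> Qbar" using subfield_set_Rats subfield_iff_subfield_set by blast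
  have RF: "\<rat> \<subseteq> F" by (rule Rats_subset_subfield[OF F])
  obtain n where "R.dimension n \<rat> F" using fd by (auto simp: R.finite_dimension_def)
  then obtain us where us: "set us \<subseteq> carrier Qbar" "R.Span \<rat> us = F" using R.exists_base[OF sQ] by blast
  have "set us \<subseteq> F" using R.Span_base_incl[OF sQ us(1)] us(2) by simp
  then obtain \<theta> where \<theta>: "\<theta> \<in> F" "set us \<subseteq> adjoin \<rat> \<theta>"
    using primitive_element_finite[OF subfield_set_Rats, of "set us" F] alg_closure_algebraic_over_Rats F RF by auto
  interpret K: subfield_set "adjoin \<rat> \<theta>" by (rule Q.subfield_set_adjoin)
  have sel: "x \<otimes>\<^bsub>Qbar\<^esub> y = x * y" "x \<oplus>\<^bsub>Qbar\<^esub> y = x + y" "\<zero>\<^bsub>Qbar\<^esub> = 0" for x y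
    by (simp_all add: ring_of_type_algebra_def)
  have comb: "R.combine ks us \<in> adjoin \<rat> \<theta>" if "set ks \<subseteq> \<rat>" "set us \<subseteq> adjoin \<rat> \<theta>" for ks us
    using that
  proof (induction ks us rule: R.combine.induct)
    case (1 k ks u us)
    then show ?case using Q.subset_adjoin[of \<theta>]
      by (auto simp: sel intro!: K.add_mem K.mult_mem)
  qed (auto simp: sel K.zero_mem)
  have "F \<subseteq> adjoin \<rat> \<theta>"
    unfolding us(2)[symmetric] R.Span_eq_combine_set[OF sQ us(1)] using comb[OF _ \<theta>(2)] by blast
  moreover have "adjoin \<rat> \<theta> \<subseteq> F" by (rule Q.adjoin_subset[OF F RF \<theta>(1)])
  ultimately show ?thesis using that by blast
qed

lemma existentially_definable_iff:
  "existentially_definable (field_on L) C \<longleftrightarrow>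
    (\<exists>n \<phi>. qf_params \<phi> \<subseteq> L \<and> qf_vars \<phi> \<subseteq> {..n} \<and> C = {x. solvable L n \<phi> x})"
  by (simp add: existentially_definable_def solvable_def)

lemma universally_definable_imp:
  assumes "universally_definable (field_on L) C"
  obtains n \<phi> where "qf_params \<phi> \<subseteq> L" "qf_vars \<phi> \<subseteq> {..n}" "L - C = {x. solvable L n \<phi> x}"
proof -
  obtain n and \<phi> :: "(qbar, nat) qf_formula" where "qf_params \<phi> \<subseteq> L" "qf_vars \<phi> \<subseteq> {..n}"
    "C = {x \<in> L. \<forall>ys. length ys = n \<and> set ys \<subseteq> L \<longrightarrow> qf_sat (field_on L) (\<lambda>i. (x # ys) ! i) \<phi>}"
    using assms by (auto simp: universally_definable_def)
  then have "L - C = {x. solvable L n (FNot \<phi>) x}" "qf_params (FNot \<phi>) \<subseteq> L" "qf_vars (FNot \<phi>) \<subseteq> {..n}"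
    by (auto simp: solvable_def)
  then show ?thesis using that by blast
qed

text \<open>An existential definition of \<open>C\<close> holds at the integers and fails at
  half-integers; a universal one gives an existential definition of the complement, where the roles
  are exchanged. The hypotheses on \<open>C\<close> fit both the integers and the ring of integers
  of \<open>L\<close>.\<close>

lemma definable_imp_shift_gap:
  assumes L: "L \<in> Sub_Qbar" and C: "\<int> \<subseteq> C" "C \<subseteq> L" "\<And>m::int. of_int m + 1 / 2 \<notin> C"
    and "existentially_definable (field_on L) C \<or> universally_definable (field_on L) C"
  shows "\<exists>n \<phi> s. L \<in> shift_gap n \<phi> s"
proof -
  interpret L: subfield_set L using L by (simp add: Sub_Qbar_iff)
  have half: "of_int m + 1 / 2 \<in> L" for m :: int
    using L.add_mem L.of_int_mem L.divide_mem[OF L.one_mem L.of_nat_mem[of 2]] by simp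
  have inf: "infinite (range (\<lambda>m::int. of_int m + c :: qbar))" for c
  proof
    assume "finite (range (\<lambda>m::int. of_int m + c :: qbar))"
    then have "finite (UNIV :: int set)" by (rule finite_imageD) (simp add: inj_on_def)
    then show False by simp
  qed
  from assms(5) show ?thesis
  proof
    assume "existentially_definable (field_on L) C"
    then obtain n \<phi> where \<phi>: "qf_params \<phi> \<subseteq> L" "qf_vars \<phi> \<subseteq> {..n}" "C = {x. solvable L n \<phi> x}"
      by (auto simp: existentially_definable_iff)
    have "range (\<lambda>m::int. of_int m + 0 :: qbar) \<subseteq> C" using C(1) by auto
    then have "infinite C" using inf finite_subset by blast
    then have "L \<in> shift_gap n \<phi> (1 / 2)"
      using L \<phi> C(3) half[of 0] by (auto simp: shift_gap_def)
    then show ?thesis by blast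
  next
    assume "universally_definable (field_on L) C"
    then obtain n \<phi> where \<phi>: "qf_params \<phi> \<subseteq> L" "qf_vars \<phi> \<subseteq> {..n}" "L - C = {x. solvable L n \<phi> x}"
      by (rule universally_definable_imp)
    have "range (\<lambda>m::int. of_int m + 1 / 2 :: qbar) \<subseteq> L - C" using C(3) half by auto
    then have "infinite (L - C)" using inf finite_subset by blast
    moreover have "\<not> solvable L n \<phi> (of_int m + 0)" for m :: int
    proof -
      have "of_int m \<in> C" using C(1) Ints_of_int by blast
      then show ?thesis using \<phi>(3) by auto
    qed
    ultimately have "L \<in> shift_gap n \<phi> 0"
      using L \<phi> L.zero_mem by (auto simp: shift_gap_def)
    then show ?thesis by blast
  qed
qed

lemma half_integer_not_algebraic_int: "\<not> algebraic_int (of_int m + 1 / 2 :: qbar)"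
proof
  assume "algebraic_int (of_int m + 1 / 2 :: qbar)"
  moreover have "of_int m + 1 / 2 \<in> (\<rat> :: qbar set)" by simp
  ultimately have "of_int m + 1 / 2 \<in> (\<int> :: qbar set)" by (rule rational_algebraic_int_is_int)
  then obtain k where k: "of_int m + 1 / 2 = (of_int k :: qbar)" by (elim Ints_cases)
  have "of_int (2 * m + 1) = (2 * (of_int m + 1 / 2) :: qbar)" by (simp add: distrib_left)
  also have "\<dots> = of_int (2 * k)" unfolding k by simp
  finally have "2 * m + 1 = 2 * k" by (simp only: of_int_eq_iff)
  then show False by presburger
qed

lemma meager_shift_gap:
  assumes "S \<subseteq> (\<Union>(n, \<phi>, s)\<in>UNIV. shift_gap n \<phi> s)"
  shows "meager_in Sub_Qbar_iso_topology (iso_class ` S)"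
  by (rule meager_in_image[OF _ assms]) (auto simp: nowhere_dense_shift_gap)

theorem corollary5p18:
  shows "meager_in Sub_Qbar_iso_topology
           (iso_class ` {L \<in> Sub_Qbar.
              existentially_definable (field_on L) (ring_of_integers L) \<or>
              universally_definable (field_on L) (ring_of_integers L)})
       \<and> meager_in Sub_Qbar_iso_topology
           (iso_class ` {L \<in> Sub_Qbar.
              existentially_definable (field_on L) \<int> \<or>
              universally_definable (field_on L) \<int>})
       \<and> meager_in Sub_Qbar_iso_topology
           (iso_class ` {L \<in> Sub_Qbar.
              \<exists>F. number_field F \<and> F \<subseteq> L \<and> existentially_definable (field_on L) F})"
proof (intro conjI)
  have int_L: "\<int> \<subseteq> L" if "L \<in> Sub_Qbar" for L
    using that subring_set.of_int_mem[OF subfield_set.axioms(1)] by (auto simp: Sub_Qbar_iff elim!: Ints_cases)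
  show "meager_in Sub_Qbar_iso_topology (iso_class ` {L \<in> Sub_Qbar.
      existentially_definable (field_on L) (ring_of_integers L) \<or>
      universally_definable (field_on L) (ring_of_integers L)})"
  proof (rule meager_shift_gap, rule subsetI)
    fix L assume L: "L \<in> {L \<in> Sub_Qbar. existentially_definable (field_on L) (ring_of_integers L) \<or>
      universally_definable (field_on L) (ring_of_integers L)}"
    have "\<int> \<subseteq> ring_of_integers L"
      using int_L L by (auto simp: ring_of_integers_def int_imp_algebraic_int)
    then have "\<exists>n \<phi> s. L \<in> shift_gap n \<phi> s"
      using L half_integer_not_algebraic_int
      by (intro definable_imp_shift_gap[of L "ring_of_integers L"]) (auto simp: ring_of_integers_def)
    then show "L \<in> (\<Union>(n, \<phi>, s)\<in>UNIV. shift_gap n \<phi> s)" by auto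
  qed
  show "meager_in Sub_Qbar_iso_topology (iso_class ` {L \<in> Sub_Qbar.
      existentially_definable (field_on L) \<int> \<or> universally_definable (field_on L) \<int>})"
  proof (rule meager_shift_gap, rule subsetI)
    fix L assume L: "L \<in> {L \<in> Sub_Qbar. existentially_definable (field_on L) \<int> \<or>
      universally_definable (field_on L) \<int>}"
    then have "\<exists>n \<phi> s. L \<in> shift_gap n \<phi> s"
      using int_L half_integer_not_algebraic_int int_imp_algebraic_int
      by (intro definable_imp_shift_gap[of L \<int>]) auto
    then show "L \<in> (\<Union>(n, \<phi>, s)\<in>UNIV. shift_gap n \<phi> s)" by auto
  qed
  show "meager_in Sub_Qbar_iso_topology (iso_class ` {L \<in> Sub_Qbar.
      \<exists>F. number_field F \<and> F \<subseteq> L \<and> existentially_definable (field_on L) F})"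
  proof (rule meager_in_image)
    \<comment> \<open>Fields with a gap are indexed by formulas and shifts. Number fields that
      define themselves form a second countable family, indexed by primitive elements.\<close>
    let ?F = "case_sum (\<lambda>\<theta>. {adjoin \<rat> \<theta>}) (\<lambda>(n, \<phi>, s). shift_gap n \<phi> s)"
    show "{L \<in> Sub_Qbar. \<exists>F. number_field F \<and> F \<subseteq> L \<and> existentially_definable (field_on L) F} \<subseteq>
      (\<Union>j\<in>UNIV. ?F j)"
    proof
      fix L assume "L \<in> {L \<in> Sub_Qbar. \<exists>F. number_field F \<and> F \<subseteq> L \<and> existentially_definable (field_on L) F}"
      then obtain F where L: "L \<in> Sub_Qbar" and F: "number_field F" "F \<subseteq> L" "existentially_definable (field_on L) F"
        by blast
      interpret F: subfield_set F using F(1) by (simp add: number_field_def subfield_iff_subfield_set)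
      show "L \<in> (\<Union>j\<in>UNIV. ?F j)"
      proof (cases "L = F")
        \<comment> \<open>With \<open>L = F\<close> no shift outside of \<open>F\<close> exists, so
          there is no gap, and the field has to be treated as a single point.\<close>
        case True
        obtain \<theta> where "F = adjoin \<rat> \<theta>" using number_field_eq_adjoin[OF F(1)] .
        then have "L \<in> ?F (Inl \<theta>)" using True by simp
        then show ?thesis by blast
      next
        case False
        then obtain s where s: "s \<in> L" "s \<notin> F" using F(2) by blast
        obtain n \<phi> where \<phi>: "qf_params \<phi> \<subseteq> L" "qf_vars \<phi> \<subseteq> {..n}" "F = {x. solvable L n \<phi> x}"
          using F(3) by (auto simp: existentially_definable_iff)
        have "\<rat> \<subseteq> F" by (rule Rats_subset_subfield[OF F.subfield_set_axioms])
        then have "infinite F" using Rats_infinite finite_subset by blast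
        moreover have "of_int m + s \<notin> F" for m :: int
          using s(2) F.diff_mem[of "of_int m + s" "of_int m"] F.of_int_mem by auto
        ultimately have "L \<in> shift_gap n \<phi> s" using L \<phi> s(1) by (auto simp: shift_gap_def)
        then have "L \<in> ?F (Inr (n, \<phi>, s))" by simp
        then show ?thesis by blast
      qed
    qed
    show "nowhere_dense_in Sub_Qbar_iso_topology (iso_class ` ?F j)" for j
      using nowhere_dense_adjoin nowhere_dense_shift_gap by (cases j) auto
  qed simp
qed

end
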